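(* Shift case: let $b_1(x),\ldots,b_n(x)\in\mathbb{C}(x)$ and let $u_1(x),\ldots,u_n(x)$ be nonzero functions meromorphic on $\mathbb{C}$ such that $u_i(x+1)=b_i(x)u_i(x)$ for $i=1,\ldots,n$. Then $u_1(x),\ldots,u_n(x)$ are differentially dependent over $\mathcal{F}(x)$ if and only if there exists a nonzero homogeneous linear differential polynomial $L(Y_1,\ldots,Y_n)$ with coefficients in $\mathbb{C}$ such that $$L\left(\frac{\partial(b_1(x))}{b_1(x)},\ldots,\frac{\partial(b_n(x))}{b_n(x)}\right) = g(x+1)-g(x)$$ for some $g(x)\in\mathbb{C}(x)$. $q$-difference case: let $b_1(x),\ldots,b_n(x)\in\mathbb{C}(x)$ and let $u_1(x),\ldots,u_n(x)$ be nonzero functions meromorphic on $\mathbb{C}^*$ such that $u_i(qx)=b_i(x)u_i(x)$ for $i=1,\ldots,n$. Then $u_1(x),\ldots,u_n(x)$ are differentially dependent over $\mathcal{G}(x)$ if and only if there exists a nonzero homogeneous linear differential polynomial $L(Y_1,\ldots,Y_n)$ with coefficients in $\mathbb{C}$ such that $$L\left(\frac{\partial(b_1(x))}{b_1(x)},\ldots,\frac{\partial(b_n(x))}{b_n(x)}\right) = g(qx)-g(x)$$ for some $g(x)\in\mathbb{C}(x)$.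
   Context: $\mathcal{F}$ is the field of $1$-periodic meromorphic functions, i.e. meromorphic functions $f$ on $\mathbb{C}$ with $f(x+1)=f(x)$. $q\in\mathbb{C}$ is nonzero with $|q|\neq 1$, and $\mathcal{G}$ is the field of functions $f$ meromorphic on $\mathbb{C}^*=\mathbb{C}\setminus\{0\}$ with $f(qx)=f(x)$. $\mathcal{F}(x)$ and $\mathcal{G}(x)$ are the fields generated over $\mathcal{F}$, resp. $\mathcal{G}$, by the function $x$. The derivation is $\partial=\frac{d}{dx}$ in the shift case and $\partial = x\frac{d}{dx}$ in the $q$-difference case. A homogeneous linear differential polynomial $L(Y_1,\ldots,Y_n)$ is a linear form in the variables $Y_i^{(j)}$, $j\ge0$; when elements $a_i$ are substituted for the $Y_i$, $Y_i^{(j)}$ is replaced by $\partial^j(a_i)$. Functions $u_1,\ldots,u_n$ are differentially dependent over a differential field $k$ if there is a nonzero differential polynomial $P\in k\{Y_1,\ldots,Y_n\}$ with $P(u_1,\ldots,u_n)=0$. *)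

theory Defs
  imports
    "HOL-Complex_Analysis.Complex_Analysis"
    "HOL-Library.Poly_Mapping"
    "HOL-Library.Function_Algebras"
begin

text \<open>
  An element of the field of meromorphic functions on an open connected set \<open>D\<close> is represented
  by a total function \<open>f\<close> with \<open>f meromorphic_on D\<close>. The values at poles, at the
  points of a set without limit points in \<open>D\<close>, and outside \<open>D\<close> carry no information, so
  equality in the field is \<open>\<forall>\<^sub>\<approx>x\<in>D. f x = g x\<close>, and \<open>f\<close> is nonzero in the field iff
  \<open>\<not> (\<forall>\<^sub>\<approx>x\<in>D. f x = 0)\<close>. The domain is \<open>UNIV\<close> in the shift case and
  \<open>- {0}\<close> in the \<open>q\<close>-difference case; in the latter nothing is required at \<open>0\<close>.
\<close>

definition periodic_field :: "(complex \<Rightarrow> complex) set" where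
  "periodic_field = {f. f meromorphic_on UNIV \<and> (\<forall>\<^sub>\<approx>x. f (x + 1) = f x)}"

definition q_periodic_field :: "complex \<Rightarrow> (complex \<Rightarrow> complex) set" where
  "q_periodic_field q = {f. f meromorphic_on (- {0}) \<and> (\<forall>\<^sub>\<approx>x\<in>- {0}. f (q * x) = f x)}"

definition rational_functions :: "(complex \<Rightarrow> complex) set" where
  "rational_functions = {f. \<exists>p r :: complex poly. r \<noteq> 0 \<and> f = (\<lambda>x. poly p x / poly r x)}"

text \<open>
  The field generated over \<open>F\<close> by the function \<open>x\<close>. The zero function needs no exclusion in
  the inverse rule: by \<open>inverse 0 = 0\<close> the pointwise inverse of a function that
  vanishes off a sparse set again vanishes off that set.
\<close>

inductive_set adjoin_x :: "(complex \<Rightarrow> complex) set \<Rightarrow> (complex \<Rightarrow> complex) set"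
  for F where
  base: "f \<in> F \<Longrightarrow> f \<in> adjoin_x F"
| x: "(\<lambda>x. x) \<in> adjoin_x F"
| add: "f \<in> adjoin_x F \<Longrightarrow> g \<in> adjoin_x F \<Longrightarrow> (\<lambda>x. f x + g x) \<in> adjoin_x F"
| uminus: "f \<in> adjoin_x F \<Longrightarrow> (\<lambda>x. - f x) \<in> adjoin_x F"
| mult: "f \<in> adjoin_x F \<Longrightarrow> g \<in> adjoin_x F \<Longrightarrow> (\<lambda>x. f x * g x) \<in> adjoin_x F"
| inverse: "f \<in> adjoin_x F \<Longrightarrow> (\<lambda>x. inverse (f x)) \<in> adjoin_x F"

definition q_deriv :: "(complex \<Rightarrow> complex) \<Rightarrow> complex \<Rightarrow> complex" where
  "q_deriv f = (\<lambda>x. x * deriv f x)"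

text \<open>
  The pair \<open>(i, j)\<close> stands for the variable \<open>\<partial>^j Y_i\<close>. A monomial is a finitely supported
  exponent function on such pairs, a differential polynomial a finitely supported family of
  coefficients indexed by monomials, and a homogeneous linear differential polynomial over
  the complex numbers a finitely supported family of constants indexed by variables.
\<close>

type_synonym diff_monomial = "(nat \<times> nat) \<Rightarrow>\<^sub>0 nat"
type_synonym diff_poly = "diff_monomial \<Rightarrow>\<^sub>0 (complex \<Rightarrow> complex)"
type_synonym linear_diff_poly = "(nat \<times> nat) \<Rightarrow>\<^sub>0 complex"

definition diff_polys :: "(complex \<Rightarrow> complex) set \<Rightarrow> nat \<Rightarrow> diff_poly set" where
  "diff_polys K n = {P. \<forall>m\<in>Poly_Mapping.keys P.
     Poly_Mapping.lookup P m \<in> K \<and> Poly_Mapping.keys m \<subseteq> {1..n} \<times> UNIV}"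

definition eval_diff_poly ::
  "((complex \<Rightarrow> complex) \<Rightarrow> complex \<Rightarrow> complex) \<Rightarrow> diff_poly
    \<Rightarrow> (nat \<Rightarrow> complex \<Rightarrow> complex) \<Rightarrow> complex \<Rightarrow> complex" where
  "eval_diff_poly \<delta> P u x =
     (\<Sum>m\<in>Poly_Mapping.keys P. Poly_Mapping.lookup P m x *
       (\<Prod>(i, j)\<in>Poly_Mapping.keys m.
          (\<delta> ^^ j) (u i) x ^ Poly_Mapping.lookup m (i, j)))"

text \<open>
  The requirement \<open>P \<noteq> 0\<close> is made on some coefficient as an element of the field of
  meromorphic functions; \<open>P \<noteq> 0\<close> in the type \<open>diff_poly\<close> would be too weak,
  since there a coefficient that vanishes off a sparse set without being identically
  zero counts as nonzero.
\<close>

definition differentially_dependent ::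
  "complex set \<Rightarrow> ((complex \<Rightarrow> complex) \<Rightarrow> complex \<Rightarrow> complex) \<Rightarrow> (complex \<Rightarrow> complex) set
    \<Rightarrow> nat \<Rightarrow> (nat \<Rightarrow> complex \<Rightarrow> complex) \<Rightarrow> bool" where
  "differentially_dependent D \<delta> K n u \<longleftrightarrow>
     (\<exists>P\<in>diff_polys K n.
        (\<exists>m. \<not> (\<forall>\<^sub>\<approx>x\<in>D. Poly_Mapping.lookup P m x = 0)) \<and>
        (\<forall>\<^sub>\<approx>x\<in>D. eval_diff_poly \<delta> P u x = 0))"

definition linear_diff_polys :: "nat \<Rightarrow> linear_diff_poly set" where
  "linear_diff_polys n = {L. Poly_Mapping.keys L \<subseteq> {1..n} \<times> UNIV}"

definition eval_linear_diff_poly ::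
  "((complex \<Rightarrow> complex) \<Rightarrow> complex \<Rightarrow> complex) \<Rightarrow> linear_diff_poly
    \<Rightarrow> (nat \<Rightarrow> complex \<Rightarrow> complex) \<Rightarrow> complex \<Rightarrow> complex" where
  "eval_linear_diff_poly \<delta> L a x =
     (\<Sum>(i, j)\<in>Poly_Mapping.keys L. Poly_Mapping.lookup L (i, j) * (\<delta> ^^ j) (a i) x)"

end

theory Submission
  imports Defs
begin

text \<open>
  If \<open>L(\<partial>b/b) = \<phi>(g) - g\<close>, where \<open>\<phi>\<close> is the shift or the \<open>q\<close>-dilation, then \<open>L(\<partial>u/u) - g\<close> is
  \<open>\<phi>\<close>-invariant, and clearing denominators in \<open>L(\<partial>u/u) = g + f\<close> gives a differential relation.

  Conversely, a differential relation is restricted to a generic orbit \<open>t\<^sub>m = \<phi>\<^sup>m(z)\<close>. There the elements of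
  \<open>\<F>\<close> are constant, so the coefficients become rational functions over \<open>\<complex>\<close>, and no descent from
  \<open>\<F>\<close> to \<open>\<complex>\<close> is needed. Written in the \<open>u\<^sub>i\<close> and \<open>\<partial>\<^sup>l(\<partial>u\<^sub>i/u\<^sub>i)\<close>, which \<open>\<phi>\<close> multiplies by \<open>b\<^sub>i\<close>
  and translates by \<open>\<partial>\<^sup>l(\<partial>b\<^sub>i/b\<^sub>i)\<close> respectively, a relation of minimal degree in the latter is
  \<open>\<phi>\<close>-semi-invariant (the argument of Kolchin and Ostrowski). Comparing its coefficients in the two highest
  degrees yields either a multiplicative relation \<open>\<Prod> b\<^sub>i\<^bsup>k(i)\<^esup> = h / \<phi>(h)\<close>, to be differentiated
  logarithmically, or directly a linear relation between the \<open>\<partial>\<^sup>l(\<partial>b\<^sub>i/b\<^sub>i)\<close>.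
\<close>

section \<open>Polynomials as finitely supported maps\<close>

text \<open>Restriction to an orbit must lose neither the nontriviality of the relation nor the way
  back to functions. Sequences along an orbit form only a ring with zero divisors, so the
  Kolchin-Ostrowski argument is run in a commutative ring with a distinguished subfield
  \<open>k\<close>; it divides by elements of \<open>k\<close> alone and has the nonvanishing of
  monomials in the \<open>u i\<close> as a separate hypothesis. The way back rests on two facts: a
  rational function that vanishes along an infinite orbit is zero, and a germ fixed by the shift is
  a complex constant. Nontriviality is at stake in the passage from the derivatives of
  \<open>u i\<close> to those of its logarithmic derivative, in which
  \<open>\<partial>^j u / u\<close> is a complete Bell polynomial. The weights
  \<open>2 * l + 1\<close> make the linear term of that polynomial strictly dominant, so that
  distinct monomials get distinct leading monomials. In the opposite direction the same expansion
  isolates the highest derivative that occurs.\<close>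

abbreviation "keys \<equiv> Poly_Mapping.keys"
abbreviation "lookup \<equiv> Poly_Mapping.lookup"

definition mon_eval :: "('v \<Rightarrow> 'a::comm_ring_1) \<Rightarrow> ('v \<Rightarrow>\<^sub>0 nat) \<Rightarrow> 'a" where
  "mon_eval x s = (\<Prod>v\<in>keys s. x v ^ lookup s v)"

definition mpoly_eval :: "('v \<Rightarrow> 'a::comm_ring_1) \<Rightarrow> (('v \<Rightarrow>\<^sub>0 nat) \<Rightarrow>\<^sub>0 'a) \<Rightarrow> 'a" where
  "mpoly_eval x p = (\<Sum>s\<in>keys p. lookup p s * mon_eval x s)"

lemma mon_eval_superset:
  assumes "finite A" "keys s \<subseteq> A"
  shows "mon_eval x s = (\<Prod>v\<in>A. x v ^ lookup s v)"
  unfolding mon_eval_def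
  by (rule prod.mono_neutral_left) (use assms in \<open>auto simp: in_keys_iff\<close>)

lemma mon_eval_zero [simp]: "mon_eval x 0 = 1"
  by (simp add: mon_eval_def)

lemma mon_eval_single [simp]: "mon_eval x (Poly_Mapping.single v m) = x v ^ m"
  by (cases "m = 0") (simp_all add: mon_eval_def)

lemma mon_eval_add: "mon_eval x (s + t) = mon_eval x s * mon_eval x t"
proof -
  let ?A = "keys s \<union> keys t"
  have "keys (s + t) \<subseteq> ?A"
    by (rule keys_add)
  then show ?thesis
    by (simp add: mon_eval_superset[of ?A] lookup_add power_add prod.distrib)
qed

lemma mon_eval_sum: "mon_eval x (sum f A) = (\<Prod>i\<in>A. mon_eval x (f i))"
  by (induction A rule: infinite_finite_induct) (auto simp: mon_eval_add)

lemma mpoly_eval_superset: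
  assumes "finite A" "keys p \<subseteq> A"
  shows "mpoly_eval x p = (\<Sum>s\<in>A. lookup p s * mon_eval x s)"
  unfolding mpoly_eval_def
  by (rule sum.mono_neutral_left) (use assms in \<open>auto simp: in_keys_iff\<close>)

lemma mpoly_eval_zero [simp]: "mpoly_eval x 0 = 0"
  by (simp add: mpoly_eval_def)

lemma mpoly_eval_single [simp]: "mpoly_eval x (Poly_Mapping.single s c) = c * mon_eval x s"
  by (cases "c = 0") (simp_all add: mpoly_eval_def)

lemma mpoly_eval_one [simp]: "mpoly_eval x 1 = 1"
  using mpoly_eval_single[of x 0 1] by simp

lemma mpoly_eval_add: "mpoly_eval x (p + q) = mpoly_eval x p + mpoly_eval x q"
proof -
  let ?A = "keys p \<union> keys q"
  have "keys (p + q) \<subseteq> ?A"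
    by (rule keys_add)
  then show ?thesis
    by (simp add: mpoly_eval_superset[of ?A] lookup_add distrib_right sum.distrib)
qed

lemma mpoly_eval_uminus: "mpoly_eval x (- p) = - mpoly_eval x p"
  using mpoly_eval_add[of x p "- p"] by (simp add: add_eq_0_iff)

lemma mpoly_eval_diff: "mpoly_eval x (p - q) = mpoly_eval x p - mpoly_eval x q"
  using mpoly_eval_add[of x p "- q"] by (simp add: mpoly_eval_uminus)

lemma mpoly_eval_sum: "mpoly_eval x (sum f A) = (\<Sum>i\<in>A. mpoly_eval x (f i))"
  by (induction A rule: infinite_finite_induct) (auto simp: mpoly_eval_add)

lemma poly_mapping_sum_single: "(\<Sum>s\<in>keys p. Poly_Mapping.single s (lookup p s)) = p"
  by (rule poly_mapping_eqI)
     (auto simp: lookup_sum lookup_single when_def sum.delta' in_keys_iff)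

lemma mpoly_eval_mult: "mpoly_eval x (p * q) = mpoly_eval x p * mpoly_eval x q"
proof -
  have "p * q = (\<Sum>s\<in>keys p. Poly_Mapping.single s (lookup p s)) *
      (\<Sum>t\<in>keys q. Poly_Mapping.single t (lookup q t))"
    by (simp add: poly_mapping_sum_single)
  also have "\<dots> = (\<Sum>s\<in>keys p. \<Sum>t\<in>keys q. Poly_Mapping.single (s + t) (lookup p s * lookup q t))"
    by (simp add: sum_product mult_single)
  also have "mpoly_eval x \<dots> = mpoly_eval x p * mpoly_eval x q"
    by (simp add: mpoly_eval_sum mon_eval_add mpoly_eval_def[of x p] mpoly_eval_def[of x q]
        sum_product algebra_simps)
  finally show ?thesis .
qed

lemma lookup_mult_single:
  fixes p :: "('v \<Rightarrow>\<^sub>0 nat) \<Rightarrow>\<^sub>0 'a::comm_ring_1"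
  shows "lookup (p * Poly_Mapping.single t c) (s + t) = lookup p s * c"
    and "(\<And>r. s \<noteq> r + t) \<Longrightarrow> lookup (p * Poly_Mapping.single t c) s = 0"
proof -
  have *: "p * Poly_Mapping.single t c = (\<Sum>s\<in>keys p. Poly_Mapping.single (s + t) (lookup p s * c))"
    by (subst (1) poly_mapping_sum_single[of p, symmetric]) (simp add: sum_distrib_right mult_single)
  show "lookup (p * Poly_Mapping.single t c) (s + t) = lookup p s * c"
    by (auto simp: * lookup_sum lookup_single when_def in_keys_iff)
  show "lookup (p * Poly_Mapping.single t c) s = 0" if "\<And>r. s \<noteq> r + t"
    unfolding * lookup_sum
    by (intro sum.neutral ballI) (simp add: lookup_single that[symmetric])
qed

lemma lookup_mult_single_zero:
  fixes p :: "('v \<Rightarrow>\<^sub>0 nat) \<Rightarrow>\<^sub>0 'a::comm_ring_1"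
  shows "lookup (p * Poly_Mapping.single 0 c) s = lookup p s * c"
  using lookup_mult_single(1)[of p 0 c s] by simp

lemma monomial_eq_add_single:
  fixes s :: "'v \<Rightarrow>\<^sub>0 nat"
  assumes "lookup s v > 0"
  obtains r where "s = r + Poly_Mapping.single v (Suc 0)"
proof
  show "s = (s - Poly_Mapping.single v (Suc 0)) + Poly_Mapping.single v (Suc 0)"
    using assms by (intro poly_mapping_eqI) (auto simp: lookup_add lookup_minus lookup_single when_def)
qed

lemma single_Suc_0_eq_iff [simp]:
  "Poly_Mapping.single v (Suc 0) = Poly_Mapping.single w (Suc 0) \<longleftrightarrow> v = w"
  by (metis lookup_single_eq lookup_single_not_eq nat.distinct(1))

lemma monomial_induct [case_names zero add]:
  fixes s :: "'v \<Rightarrow>\<^sub>0 nat"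
  assumes "P 0" "\<And>s v. P s \<Longrightarrow> P (s + Poly_Mapping.single v (Suc 0))"
  shows "P s"
proof (induction "\<Sum>v\<in>keys s. lookup s v" arbitrary: s rule: less_induct)
  case less
  show ?case
  proof (cases "s = 0")
    case False
    then obtain v where v: "v \<in> keys s" by (metis all_not_in_conv keys_eq_empty)
    then obtain r where r: "s = r + Poly_Mapping.single v (Suc 0)"
      using monomial_eq_add_single by (metis in_keys_iff neq0_conv)
    have sub: "keys r \<subseteq> keys s"
      by (auto simp: r in_keys_iff lookup_add)
    have "(\<Sum>w\<in>keys r. lookup r w) = (\<Sum>w\<in>keys s. lookup r w)"
      by (rule sum.mono_neutral_left) (use sub in \<open>auto simp: in_keys_iff\<close>)
    also have "\<dots> < (\<Sum>w\<in>keys s. lookup s w)"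
      by (rule sum_strict_mono_ex1) (use v in \<open>auto simp: r lookup_add lookup_single when_def intro!: bexI[of _ v]\<close>)
    finally show ?thesis
      using less assms(2) r by metis
  qed (use assms in auto)
qed

text \<open>The weight is a parameter because two gradings are in use: the degree in the translated
  variables, with values 0 and 1 on variables, and \<open>pweight\<close>, which detects leading
  terms.\<close>

definition wdeg :: "('v \<Rightarrow> nat) \<Rightarrow> ('v \<Rightarrow>\<^sub>0 nat) \<Rightarrow> nat" where
  "wdeg d s = (\<Sum>v\<in>keys s. lookup s v * d v)"

lemma wdeg_superset:
  assumes "finite A" "keys s \<subseteq> A"
  shows "wdeg d s = (\<Sum>v\<in>A. lookup s v * d v)"
  unfolding wdeg_def
  by (rule sum.mono_neutral_left) (use assms in \<open>auto simp: in_keys_iff\<close>)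

lemma wdeg_add: "wdeg d (s + t) = wdeg d s + wdeg d t"
proof -
  let ?A = "keys s \<union> keys t"
  have "keys (s + t) \<subseteq> ?A"
    by (rule keys_add)
  then show ?thesis
    by (simp add: wdeg_superset[of ?A] lookup_add distrib_right sum.distrib)
qed

lemma wdeg_zero [simp]: "wdeg d 0 = 0"
  by (simp add: wdeg_def)

lemma wdeg_single [simp]: "wdeg d (Poly_Mapping.single v m) = m * d v"
  by (cases "m = 0") (simp_all add: wdeg_def)

section \<open>Relations over difference fields\<close>

text \<open>Invertibility is asked of \<open>k\<close> only, since the ring of germs to which this
  is applied has zero divisors. Characteristic zero enters through the exponents that appear as
  factors one degree below the top.\<close>

locale difference_ring =
  fixes \<sigma> :: "'a::{comm_ring_1,ring_char_0} \<Rightarrow> 'a" and k :: "'a set"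
  assumes sigma_add: "\<sigma> (a + b) = \<sigma> a + \<sigma> b"
    and sigma_mult: "\<sigma> (a * b) = \<sigma> a * \<sigma> b"
    and sigma_one: "\<sigma> 1 = 1"
    and sigma_k: "a \<in> k \<Longrightarrow> \<sigma> a \<in> k"
    and one_k: "1 \<in> k"
    and add_k: "a \<in> k \<Longrightarrow> b \<in> k \<Longrightarrow> a + b \<in> k"
    and uminus_k: "a \<in> k \<Longrightarrow> - a \<in> k"
    and mult_k: "a \<in> k \<Longrightarrow> b \<in> k \<Longrightarrow> a * b \<in> k"
    and inverse_k: "a \<in> k \<Longrightarrow> a \<noteq> 0 \<Longrightarrow> \<exists>b\<in>k. a * b = 1"
begin

lemma zero_k: "0 \<in> k"
  using add_k[OF one_k uminus_k[OF one_k]] by simp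

lemma diff_k: "a \<in> k \<Longrightarrow> b \<in> k \<Longrightarrow> a - b \<in> k"
  using add_k[OF _ uminus_k, of a b] by simp

lemma sum_k: "(\<And>i. i \<in> A \<Longrightarrow> f i \<in> k) \<Longrightarrow> sum f A \<in> k"
  by (induction A rule: infinite_finite_induct) (auto intro: zero_k add_k)

lemma of_nat_k: "of_nat m \<in> k"
  by (induction m) (auto intro: zero_k add_k one_k)

lemma power_k: "a \<in> k \<Longrightarrow> a ^ m \<in> k"
  by (induction m) (auto intro: one_k mult_k)

lemma prod_k: "(\<And>i. i \<in> A \<Longrightarrow> f i \<in> k) \<Longrightarrow> prod f A \<in> k"
  by (induction A rule: infinite_finite_induct) (auto intro: one_k mult_k)

lemma mon_eval_k: "(\<And>v. v \<in> keys s \<Longrightarrow> x v \<in> k) \<Longrightarrow> mon_eval x s \<in> k"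
  unfolding mon_eval_def by (intro prod_k power_k)

lemma sigma_zero: "\<sigma> 0 = 0"
  using sigma_add[of 0 0] by simp

lemma sigma_sum: "\<sigma> (sum f A) = (\<Sum>i\<in>A. \<sigma> (f i))"
  by (induction A rule: infinite_finite_induct) (auto simp: sigma_zero sigma_add)

text \<open>Replaces cancellation in an integral domain: \<open>a\<close> has an inverse in
  \<open>k\<close>, whatever the other factor is.\<close>

lemma mult_eq_0_k: "a \<in> k \<Longrightarrow> a \<noteq> 0 \<Longrightarrow> a * b = 0 \<Longrightarrow> b = 0"
  by (metis inverse_k mult.left_commute mult.right_neutral mult_zero_right)

lemma lookup_mult_k:
  fixes p q :: "('v \<Rightarrow>\<^sub>0 nat) \<Rightarrow>\<^sub>0 'a"
  assumes "\<And>s. lookup p s \<in> k" "\<And>s. lookup q s \<in> k"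
  shows "lookup (p * q) s \<in> k"
proof -
  have "p * q = (\<Sum>s\<in>keys p. Poly_Mapping.single s (lookup p s)) *
      (\<Sum>t\<in>keys q. Poly_Mapping.single t (lookup q t))"
    by (simp add: poly_mapping_sum_single)
  also have "\<dots> = (\<Sum>s\<in>keys p. \<Sum>t\<in>keys q. Poly_Mapping.single (s + t) (lookup p s * lookup q t))"
    by (simp add: sum_product mult_single)
  finally show ?thesis
    using assms by (auto simp: lookup_sum lookup_single when_def intro!: sum_k mult_k zero_k)
qed

end

text \<open>One affine formula covers both kinds of variables. Those of degree 0 are multiplied by
  \<open>\<beta> v\<close>, as the \<open>u i\<close> are; those of degree 1 are translated by
  \<open>a v\<close>, as the logarithmic derivatives are. Hence \<open>\<sigma>\<close> never raises
  the degree and acts on the top degree monomial by monomial.\<close>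

locale unipotent_system = difference_ring \<sigma> k
  for \<sigma> :: "'a::{comm_ring_1,ring_char_0} \<Rightarrow> 'a" and k +
  fixes V :: "'v set" and d :: "'v \<Rightarrow> nat" and x \<beta> a :: "'v \<Rightarrow> 'a"
  assumes sigma_x: "v \<in> V \<Longrightarrow> \<sigma> (x v) = \<beta> v * x v + a v"
    and beta_k: "v \<in> V \<Longrightarrow> \<beta> v \<in> k" and beta_nz: "v \<in> V \<Longrightarrow> \<beta> v \<noteq> 0"
    and a_k: "v \<in> V \<Longrightarrow> a v \<in> k"
    and d_cases: "v \<in> V \<Longrightarrow> d v = 0 \<and> a v = 0 \<or> d v = 1 \<and> \<beta> v = 1"
begin

abbreviation "e v \<equiv> Poly_Mapping.single v (Suc 0)"

text \<open>Of the expansion of \<open>\<sigma> (x\<^sup>s)\<close> only the terms of the two highest degrees are made explicit.\<close>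

definition shift_expansion :: "('v \<Rightarrow>\<^sub>0 nat) \<Rightarrow> (('v \<Rightarrow>\<^sub>0 nat) \<Rightarrow>\<^sub>0 'a) \<Rightarrow> bool" where
  "shift_expansion s T \<longleftrightarrow>
    (\<forall>r. lookup T r \<in> k) \<and> (\<forall>r\<in>keys T. keys r \<subseteq> V) \<and>
    mpoly_eval x T = \<sigma> (mon_eval x s) \<and>
    (\<forall>r. wdeg d s \<le> wdeg d r \<longrightarrow> lookup T r = (if r = s then mon_eval \<beta> s else 0)) \<and>
    (\<forall>r v. s = r + e v \<longrightarrow> d v = 1 \<longrightarrow>
       lookup T r = mon_eval \<beta> s * (of_nat (Suc (lookup r v)) * a v)) \<and>
    (\<forall>r. Suc (wdeg d r) = wdeg d s \<longrightarrow> (\<forall>v. s \<noteq> r + e v) \<longrightarrow> lookup T r = 0)"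

text \<open>Multiply the expansion for \<open>t\<close> by \<open>\<beta> v * x v + a v\<close>. One
  degree below the top this is a first-order Taylor expansion: removing one factor
  \<open>x v\<close> contributes its exponent times \<open>a v\<close>, and
  \<open>Suc (lookup r v)\<close> is that exponent in \<open>s\<close>.\<close>

lemma exists_shift_expansion:
  assumes "keys s \<subseteq> V"
  shows "\<exists>T. shift_expansion s T"
  unfolding shift_expansion_def
  using assms
proof (induction s rule: monomial_induct)
    case zero
    have *: "r + Poly_Mapping.single v (Suc 0) \<noteq> 0" "Poly_Mapping.single v (Suc 0) \<noteq> 0"
      for r :: "'v \<Rightarrow>\<^sub>0 nat" and v
      by (metis add_is_0 lookup_add lookup_single_eq lookup_zero nat.distinct(1))+
    show ?case
      by (rule exI[of _ 1]) (auto simp: sigma_one lookup_one when_def one_k zero_k * *[symmetric])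
  next
    case (add t v)
    have sub: "keys t \<subseteq> V" and vV: "v \<in> V"
      using add.prems by (auto simp: in_keys_iff lookup_add subset_iff)
    obtain T where T: "\<And>r. lookup T r \<in> k" "\<And>r. r \<in> keys T \<Longrightarrow> keys r \<subseteq> V"
      "mpoly_eval x T = \<sigma> (mon_eval x t)"
      and T1: "\<And>r. wdeg d t \<le> wdeg d r \<Longrightarrow> lookup T r = (if r = t then mon_eval \<beta> t else 0)"
      and T2: "\<And>r v. t = r + e v \<Longrightarrow> d v = 1 \<Longrightarrow>
       lookup T r = mon_eval \<beta> t * (of_nat (Suc (lookup r v)) * a v)"
      and T3: "\<And>r. Suc (wdeg d r) = wdeg d t \<Longrightarrow> (\<And>v. t \<noteq> r + e v) \<Longrightarrow> lookup T r = 0"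
      using add.IH[OF sub] by blast
    define T' where "T' = T * Poly_Mapping.single (e v) (\<beta> v) + T * Poly_Mapping.single 0 (a v)"
    have k': "lookup T' r \<in> k" for r
      unfolding T'_def lookup_add
      by (intro add_k lookup_mult_k T) (auto simp: lookup_single when_def zero_k beta_k a_k vV)
    have l1: "lookup T' (r + e v) = lookup T r * \<beta> v + lookup T (r + e v) * a v" for r
      unfolding T'_def lookup_add lookup_mult_single(1) lookup_mult_single_zero ..
    have l2: "lookup T' r = lookup T r * a v" if "\<And>r'. r \<noteq> r' + e v" for r
      unfolding T'_def lookup_add lookup_mult_single(2)[OF that] lookup_mult_single_zero by simp
    have keys': "keys r \<subseteq> V" if r: "r \<in> keys T'" for r
    proof (cases "\<exists>r'. r = r' + e v")
      case True
      then obtain r' where r': "r = r' + e v" by blast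
      have "r' \<in> keys T \<or> r \<in> keys T"
        using r l1[of r'] by (auto simp: in_keys_iff r')
      then show ?thesis
      proof
        assume "r' \<in> keys T"
        then show ?thesis
          using T(2)[of r'] vV keys_add[of r' "e v"] by (auto simp: r')
      qed (rule T(2))
    next
      case False
      then have "lookup T r \<noteq> 0"
        using l2[of r] r by (auto simp: in_keys_iff)
      then show ?thesis
        using T(2)[of r] by (simp add: in_keys_iff)
    qed
    have ev': "mpoly_eval x T' = \<sigma> (mon_eval x (t + e v))"
      by (simp add: T'_def mpoly_eval_add mpoly_eval_mult T(3) mon_eval_add sigma_mult
          sigma_x[OF vV] algebra_simps)
    have no_dec: "\<And>r'. r \<noteq> r' + e v" if "lookup r v = 0" for r
      using that by (auto simp: lookup_add)
    have cancel: "r + e v + e w = t + e v \<longleftrightarrow> t = r + e w" for r w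
    proof -
      have "r + e v + e w = (r + e w) + e v"
        by (simp only: add.assoc add.commute[of "e v" "e w"])
      then show ?thesis by (auto simp only: add_right_cancel)
    qed
    show ?case
    proof (intro exI[of _ T'] conjI allI ballI impI k' keys' ev')
      fix r
      assume r: "wdeg d (t + e v) \<le> wdeg d r"
      \<comment> \<open>Either \<open>d v = 0\<close> and \<open>a v = 0\<close>, or
        \<open>d v = 1\<close> and \<open>r\<close> is heavier than \<open>t\<close>, where
        \<open>T\<close> has no term.\<close>
      have 1: "lookup T r * a v = 0"
        using d_cases[OF vV] T1[of r] r by (auto simp: wdeg_add)
      show "lookup T' r = (if r = t + e v then mon_eval \<beta> (t + e v) else 0)"
      proof (cases "\<exists>r'. r = r' + e v")
        case True
        then obtain r' where r': "r = r' + e v" by blast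
        show ?thesis
          using T1[of r'] r 1 by (auto simp: r' l1 wdeg_add mon_eval_add)
      next
        case False
        then show ?thesis using l2[of r] 1 by auto
      qed
    next
      fix r w
      assume r: "t + e v = r + e w" and w: "d w = 1"
      show "lookup T' r = mon_eval \<beta> (t + e v) * (of_nat (Suc (lookup r w)) * a w)"
      proof (cases "w = v")
        case True
        then have rt: "r = t" using r by simp
        have beta: "\<beta> v = 1" using d_cases[OF vV] w True by auto
        show ?thesis
        proof (cases "lookup t v = 0")
          case True
          then show ?thesis
            using l2[OF no_dec[OF True]] T1[of t]
            by (simp add: rt \<open>w = v\<close> beta mon_eval_add)
        next
          case False
          then obtain t' where t': "t = t' + e v"
            using monomial_eq_add_single by (metis neq0_conv)
          \<comment> \<open>The monomial \<open>t\<close> arises twice: from the old term at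
            \<open>t'\<close> multiplied by \<open>x v\<close>, and from the top term at
            \<open>t\<close> multiplied by \<open>a v\<close>. Together they raise the exponent
            factor by one.\<close>
          have "lookup T' t = mon_eval \<beta> t * (of_nat (Suc (lookup t' v)) * a v) + mon_eval \<beta> t * a v"
            using T2[OF t'] T1[of t] l1[of t'] w \<open>w = v\<close> beta by (simp flip: t')
          also have "\<dots> = mon_eval \<beta> t * (of_nat (Suc (lookup t v)) * a v)"
            by (simp add: t' lookup_add algebra_simps)
          finally show ?thesis
            by (simp add: rt \<open>w = v\<close> beta mon_eval_add)
        qed
      next
        case False
        have "lookup r v > 0"
          using arg_cong[OF r, of "\<lambda>s. lookup s v"] False by (simp add: lookup_add lookup_single)
        then obtain r' where r': "r = r' + e v"
          using monomial_eq_add_single by metis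
        have t: "t = r' + e w"
          using r[symmetric] cancel[of r' w] by (simp only: r')
        have rt: "r \<noteq> t"
          using False by (simp add: t r' add.commute[of r'])
        \<comment> \<open>If \<open>a v\<close> is nonzero, \<open>v\<close> has degree 1 like
          \<open>w\<close>, so \<open>r\<close> has the degree of \<open>t\<close> but differs from
          it.\<close>
        have "lookup T r * a v = 0"
        proof (cases "a v = 0")
          case False
          then have "d v = 1" using d_cases[OF vV] by auto
          then have "wdeg d r = wdeg d t"
            using w by (simp add: t r' wdeg_add)
          then show ?thesis using T1[of r] rt by simp
        qed simp
        then show ?thesis
          using T2[OF t w] l1[of r'] False
          by (simp add: r' mon_eval_add lookup_add lookup_single algebra_simps)
      qed
    next
      fix r
      assume r: "Suc (wdeg d r) = wdeg d (t + e v)" and nr: "\<forall>w. t + e v \<noteq> r + e w"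
      have rt: "r \<noteq> t" using nr by blast
      have 1: "lookup T r * a v = 0"
        using d_cases[OF vV] T1[of r] r rt by (auto simp: wdeg_add)
      show "lookup T' r = 0"
      proof (cases "\<exists>r'. r = r' + e v")
        case True
        then obtain r' where r': "r = r' + e v" by blast
        have "lookup T r' = 0"
        proof (rule T3)
          show "Suc (wdeg d r') = wdeg d t"
            using r by (simp add: r' wdeg_add)
          show "t \<noteq> r' + e w" for w
            using nr cancel unfolding r' by metis
        qed
        then show ?thesis
          using 1 l1[of r'] by (simp add: r')
      next
        case False
        then show ?thesis using l2[of r] 1 by auto
      qed
    qed
qed

text \<open>\<open>R\<close> is the image of the relation under \<open>\<sigma>\<close>, rewritten
  in the same variables. In degree \<open>D\<close> each monomial stays by itself; one degree lower,
  \<open>r\<close> also receives, through the translations, contributions of the monomials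
  \<open>r + e v\<close>.\<close>

lemma exists_shifted_relation:
  assumes "\<And>s. lookup Q s \<in> k" "\<And>s. s \<in> keys Q \<Longrightarrow> keys s \<subseteq> V" "mpoly_eval x Q = 0"
    and D: "\<And>s. s \<in> keys Q \<Longrightarrow> wdeg d s \<le> D"
  obtains R where "\<And>s. lookup R s \<in> k" "\<And>s. s \<in> keys R \<Longrightarrow> keys s \<subseteq> V" "mpoly_eval x R = 0"
    "\<And>s. s \<in> keys R \<Longrightarrow> wdeg d s \<le> D"
    "\<And>s. wdeg d s = D \<Longrightarrow> lookup R s = \<sigma> (lookup Q s) * mon_eval \<beta> s"
    "\<And>r. Suc (wdeg d r) = D \<Longrightarrow> lookup R r = \<sigma> (lookup Q r) * mon_eval \<beta> r +
       (\<Sum>v | d v = 1 \<and> r + e v \<in> keys Q. \<sigma> (lookup Q (r + e v)) *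
          (mon_eval \<beta> (r + e v) * (of_nat (Suc (lookup r v)) * a v)))"
proof -
  obtain T where "\<forall>s\<in>keys Q. shift_expansion s (T s)"
    using exists_shift_expansion assms(2) by metis
  then have T: "\<And>s r. s \<in> keys Q \<Longrightarrow> lookup (T s) r \<in> k"
      "\<And>s r. s \<in> keys Q \<Longrightarrow> r \<in> keys (T s) \<Longrightarrow> keys r \<subseteq> V"
      "\<And>s. s \<in> keys Q \<Longrightarrow> mpoly_eval x (T s) = \<sigma> (mon_eval x s)"
    and T1: "\<And>s r. s \<in> keys Q \<Longrightarrow> wdeg d s \<le> wdeg d r \<Longrightarrow>
      lookup (T s) r = (if r = s then mon_eval \<beta> s else 0)"
    and T2: "\<And>s r v. s \<in> keys Q \<Longrightarrow> s = r + e v \<Longrightarrow> d v = 1 \<Longrightarrow>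
      lookup (T s) r = mon_eval \<beta> s * (of_nat (Suc (lookup r v)) * a v)"
    and T3: "\<And>s r. s \<in> keys Q \<Longrightarrow> Suc (wdeg d r) = wdeg d s \<Longrightarrow> (\<And>v. s \<noteq> r + e v) \<Longrightarrow>
      lookup (T s) r = 0"
    unfolding shift_expansion_def by simp_all
  define R where "R = (\<Sum>s\<in>keys Q. T s * Poly_Mapping.single 0 (\<sigma> (lookup Q s)))"
  have R: "lookup R r = (\<Sum>s\<in>keys Q. \<sigma> (lookup Q s) * lookup (T s) r)" for r
    by (simp add: R_def lookup_sum lookup_mult_single_zero mult.commute)
  have nz: "\<exists>s\<in>keys Q. r \<in> keys (T s)" if "r \<in> keys R" for r
  proof (rule ccontr)
    assume "\<not> ?thesis"
    then have "lookup R r = 0"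
      unfolding R by (auto simp: in_keys_iff)
    with that show False by (simp add: in_keys_iff)
  qed
  show ?thesis
  proof (rule that[of R])
    show "lookup R s \<in> k" for s
      unfolding R by (intro sum_k mult_k sigma_k T assms)
    show "keys s \<subseteq> V" if "s \<in> keys R" for s
      using nz[OF that] T(2) by blast
    show "mpoly_eval x R = 0"
    proof -
      have "mpoly_eval x R = (\<Sum>s\<in>keys Q. \<sigma> (lookup Q s * mon_eval x s))"
        by (simp add: R_def mpoly_eval_sum mpoly_eval_mult T sigma_mult mult.commute)
      also have "\<dots> = \<sigma> (mpoly_eval x Q)"
        by (simp add: mpoly_eval_def sigma_sum)
      finally show ?thesis by (simp add: assms sigma_zero)
    qed
    show "wdeg d r \<le> D" if "r \<in> keys R" for r
    proof -
      obtain s where s: "s \<in> keys Q" "r \<in> keys (T s)" using nz[OF \<open>r \<in> keys R\<close>] by blast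
      have "wdeg d r \<le> wdeg d s"
        using T1[OF s(1), of r] s by (cases "wdeg d s \<le> wdeg d r") (auto simp: in_keys_iff split: if_splits)
      with D[OF s(1)] show ?thesis by simp
    qed
    show "lookup R r = \<sigma> (lookup Q r) * mon_eval \<beta> r" if "wdeg d r = D" for r
    proof -
      have "lookup R r = (\<Sum>s\<in>keys Q. if s = r then \<sigma> (lookup Q s) * mon_eval \<beta> r else 0)"
        unfolding R by (intro sum.cong) (use that D T1 in auto)
      also have "\<dots> = \<sigma> (lookup Q r) * mon_eval \<beta> r"
        by (auto simp: in_keys_iff sigma_zero)
      finally show ?thesis .
    qed
    show "lookup R r = \<sigma> (lookup Q r) * mon_eval \<beta> r +
       (\<Sum>v | d v = 1 \<and> r + e v \<in> keys Q. \<sigma> (lookup Q (r + e v)) *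
          (mon_eval \<beta> (r + e v) * (of_nat (Suc (lookup r v)) * a v)))" (is "_ = _ + ?S")
      if r: "Suc (wdeg d r) = D" for r
    proof -
      \<comment> \<open>Below degree \<open>D\<close> only the monomial \<open>r\<close> itself can
        produce \<open>r\<close>; in degree \<open>D\<close> only the products of \<open>r\<close>
        with a single variable of degree 1 can.\<close>
      let ?A = "{s\<in>keys Q. wdeg d s < D}" and ?B = "{s\<in>keys Q. wdeg d s = D}"
      let ?W = "{v. d v = 1 \<and> r + e v \<in> keys Q}"
      have AB: "keys Q = ?A \<union> ?B" using D by force
      have "lookup R r = (\<Sum>s\<in>?A. \<sigma> (lookup Q s) * lookup (T s) r) + (\<Sum>s\<in>?B. \<sigma> (lookup Q s) * lookup (T s) r)"
        unfolding R by (subst AB, subst sum.union_disjoint) auto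
      also have "(\<Sum>s\<in>?A. \<sigma> (lookup Q s) * lookup (T s) r) =
          (\<Sum>s\<in>?A. if s = r then \<sigma> (lookup Q s) * mon_eval \<beta> r else 0)"
        by (intro sum.cong) (use r T1 in auto)
      also have "\<dots> = \<sigma> (lookup Q r) * mon_eval \<beta> r"
        using r by (auto simp: in_keys_iff sigma_zero)
      also have "(\<Sum>s\<in>?B. \<sigma> (lookup Q s) * lookup (T s) r) =
          (\<Sum>s\<in>(\<lambda>v. r + e v) ` ?W. \<sigma> (lookup Q s) * lookup (T s) r)"
      proof (rule sum.mono_neutral_right)
        show "(\<lambda>v. r + e v) ` ?W \<subseteq> ?B"
          using r by (auto simp: wdeg_add)
        show "\<forall>s\<in>?B - (\<lambda>v. r + e v) ` ?W. \<sigma> (lookup Q s) * lookup (T s) r = 0"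
        proof
          fix s assume s: "s \<in> ?B - (\<lambda>v. r + e v) ` ?W"
          have "s \<noteq> r + e v" for v
          proof
            assume "s = r + e v"
            moreover from this have "d v = 1" using s r by (auto simp: wdeg_add)
            ultimately show False using s by auto
          qed
          then show "\<sigma> (lookup Q s) * lookup (T s) r = 0"
            using T3[of s r] s r by auto
        qed
      qed simp
      also have "\<dots> = (\<Sum>v\<in>?W. \<sigma> (lookup Q (r + e v)) * lookup (T (r + e v)) r)"
      proof (subst sum.reindex)
        show "inj_on (\<lambda>v. r + e v) ?W"
          by (auto simp: inj_on_def)
      qed (simp add: o_def)
      also have "\<dots> = ?S"
        by (intro sum.cong) (auto simp: T2)
      finally show ?thesis .
    qed
  qed
qed

section \<open>Minimal relations and the Kolchin-Ostrowski alternative\<close>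

definition relation :: "(('v \<Rightarrow>\<^sub>0 nat) \<Rightarrow>\<^sub>0 'a) \<Rightarrow> bool" where
  "relation Q \<longleftrightarrow> Q \<noteq> 0 \<and> (\<forall>s. lookup Q s \<in> k) \<and> (\<forall>s\<in>keys Q. keys s \<subseteq> V) \<and> mpoly_eval x Q = 0"

text \<open>Lexicographic minimality: the degree first, then the number of monomials of that degree.
  The last clause also covers a relation \<open>R\<close> of smaller degree, because its set of
  monomials of degree \<open>D\<close> is empty.\<close>

lemma minimal_relation:
  assumes "relation Q"
  obtains Q D where "relation Q" "\<And>s. s \<in> keys Q \<Longrightarrow> wdeg d s \<le> D" "\<exists>s\<in>keys Q. wdeg d s = D"
    "\<And>R. relation R \<Longrightarrow> (\<And>s. s \<in> keys R \<Longrightarrow> wdeg d s \<le> D) \<Longrightarrow>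
       \<not> {s\<in>keys R. wdeg d s = D} \<subset> {s\<in>keys Q. wdeg d s = D}"
proof -
  define deg where "deg = (\<lambda>Q::('v \<Rightarrow>\<^sub>0 nat) \<Rightarrow>\<^sub>0 'a. Max (wdeg d ` keys Q))"
  define top where "top = (\<lambda>Q::('v \<Rightarrow>\<^sub>0 nat) \<Rightarrow>\<^sub>0 'a. card {s\<in>keys Q. wdeg d s = deg Q})"
  obtain Q where Q: "relation Q"
    and min: "\<And>R. (R, Q) \<in> measures [deg, top] \<Longrightarrow> \<not> relation R"
    using wfE_min[of "measures [deg, top]" _ "Collect relation"] assms by auto
  have nz: "keys R \<noteq> {}" if "relation R" for R
    using that by (auto simp: relation_def)
  show ?thesis
  proof (rule that[of Q "deg Q"])
    show "relation Q" by fact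
    show "wdeg d s \<le> deg Q" if "s \<in> keys Q" for s
      using that by (auto simp: deg_def)
    show "\<exists>s\<in>keys Q. wdeg d s = deg Q"
      using Max_in[of "wdeg d ` keys Q"] nz[OF Q] by (fastforce simp: deg_def)
    fix R assume R: "relation R" and le: "\<And>s. s \<in> keys R \<Longrightarrow> wdeg d s \<le> deg Q"
    show "\<not> {s\<in>keys R. wdeg d s = deg Q} \<subset> {s\<in>keys Q. wdeg d s = deg Q}"
    proof
      assume psub: "{s\<in>keys R. wdeg d s = deg Q} \<subset> {s\<in>keys Q. wdeg d s = deg Q}"
      have "deg R \<le> deg Q"
        using le nz[OF R] by (subst deg_def) simp
      moreover have "top R < top Q" if "deg R = deg Q"
        using psub by (auto simp: top_def that intro: psubset_card_mono)
      ultimately have "(R, Q) \<in> measures [deg, top]"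
        by auto
      with min R show False by blast
    qed
  qed
qed

text \<open>With a top coefficient normalised to 1, \<open>R - b * Q\<close> loses a top monomial
  and is zero by minimality. A top monomial whose exponents on degree-0 variables differ from those
  of the normalised one gives the first alternative. If there is none, the top coefficients are
  invariant, and a coefficient one degree below gives the second. The hypothesis \<open>unit\<close>
  excludes a relation that consists of a single monomial in the degree-0 variables.\<close>

theorem kolchin_ostrowski:
  assumes "relation P"
    and unit: "\<And>s. keys s \<subseteq> V \<Longrightarrow> wdeg d s = 0 \<Longrightarrow> mon_eval x s \<noteq> 0"
  shows "(\<exists>s t c. keys s \<subseteq> V \<and> keys t \<subseteq> V \<and> (\<exists>v\<in>V. d v = 0 \<and> lookup s v \<noteq> lookup t v) \<and>
            c \<in> k \<and> c \<noteq> 0 \<and> \<sigma> c * mon_eval \<beta> s = mon_eval \<beta> t * c) \<or>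
         (\<exists>\<kappa> W g. finite W \<and> W \<subseteq> V \<and> (\<forall>v\<in>W. d v = 1 \<and> \<kappa> v \<in> k \<and> \<sigma> (\<kappa> v) = \<kappa> v) \<and>
            (\<exists>v\<in>W. \<kappa> v \<noteq> 0) \<and> g \<in> k \<and> (\<Sum>v\<in>W. \<kappa> v * a v) = g - \<sigma> g)"
    (is "?mult \<or> ?lin")
proof (rule disj_imp[THEN iffD2], rule impI)
  assume nmult: "\<not> ?mult"
  obtain Q0 D where Q0: "relation Q0" and D0: "\<And>s. s \<in> keys Q0 \<Longrightarrow> wdeg d s \<le> D"
    and s0: "\<exists>s\<in>keys Q0. wdeg d s = D"
    and min0: "\<And>R. relation R \<Longrightarrow> (\<And>s. s \<in> keys R \<Longrightarrow> wdeg d s \<le> D) \<Longrightarrow>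
       \<not> {s\<in>keys R. wdeg d s = D} \<subset> {s\<in>keys Q0. wdeg d s = D}"
    by (rule minimal_relation[OF assms(1)]) blast
  obtain s0 where s0: "s0 \<in> keys Q0" "wdeg d s0 = D" using s0 by blast
  obtain c where c: "c \<in> k" "lookup Q0 s0 * c = 1"
    using inverse_k[of "lookup Q0 s0"] Q0 s0 by (auto simp: relation_def in_keys_iff)
  have c0: "c \<noteq> 0" using c by auto
  define Q where "Q = Q0 * Poly_Mapping.single 0 c"
  have lookup_Q: "lookup Q s = lookup Q0 s * c" for s
    by (simp add: Q_def lookup_mult_single_zero)
  have keys_Q: "keys Q = keys Q0"
    using mult_eq_0_k[OF c(1) c0] by (auto simp: in_keys_iff lookup_Q mult.commute)
  have Qs0: "lookup Q s0 = 1" by (simp add: lookup_Q c)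
  have Q: "\<And>s. lookup Q s \<in> k" "\<And>s. s \<in> keys Q \<Longrightarrow> keys s \<subseteq> V" "mpoly_eval x Q = 0"
  proof -
    show "lookup Q s \<in> k" for s using Q0 c by (simp add: lookup_Q relation_def mult_k)
    show "keys s \<subseteq> V" if "s \<in> keys Q" for s using Q0 that by (simp add: keys_Q relation_def)
    show "mpoly_eval x Q = 0" using Q0 by (simp add: Q_def mpoly_eval_mult relation_def)
  qed
  have QD: "\<And>s. s \<in> keys Q \<Longrightarrow> wdeg d s \<le> D" using D0 by (simp add: keys_Q)
  obtain R where R: "\<And>s. lookup R s \<in> k" "\<And>s. s \<in> keys R \<Longrightarrow> keys s \<subseteq> V" "mpoly_eval x R = 0"
    "\<And>s. s \<in> keys R \<Longrightarrow> wdeg d s \<le> D"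
    and R_top: "\<And>s. wdeg d s = D \<Longrightarrow> lookup R s = \<sigma> (lookup Q s) * mon_eval \<beta> s"
    and R_next: "\<And>r. Suc (wdeg d r) = D \<Longrightarrow> lookup R r = \<sigma> (lookup Q r) * mon_eval \<beta> r +
       (\<Sum>v | d v = 1 \<and> r + e v \<in> keys Q. \<sigma> (lookup Q (r + e v)) *
          (mon_eval \<beta> (r + e v) * (of_nat (Suc (lookup r v)) * a v)))"
    by (rule exists_shifted_relation[OF Q QD], assumption, assumption, (rule that; blast))
  define b where "b = mon_eval \<beta> s0"
  have bk: "mon_eval \<beta> s \<in> k" if "keys s \<subseteq> V" for s
    using that beta_k by (intro mon_eval_k) auto
  have bnz: "mon_eval \<beta> s \<noteq> 0" if "keys s \<subseteq> V" for s
    using that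
  proof (induction s rule: monomial_induct)
    case (add s v)
    have s: "keys s \<subseteq> V" "v \<in> V"
      using add.prems by (auto simp: in_keys_iff lookup_add subset_iff)
    show ?case
      using mult_eq_0_k[OF bk[OF s(1)] add.IH[OF s(1)], of "\<beta> v"] beta_nz[OF s(2)]
      by (auto simp: mon_eval_add)
  qed auto
  have s0V: "keys s0 \<subseteq> V" using Q(2) s0 keys_Q by auto
  define P' where "P' = R - Q * Poly_Mapping.single 0 b"
  have lookup_P': "lookup P' s = lookup R s - b * lookup Q s" for s
    by (simp add: P'_def lookup_minus lookup_mult_single_zero mult.commute)
  have keys_P': "s \<in> keys R \<or> s \<in> keys Q" if "s \<in> keys P'" for s
    using that by (auto simp: in_keys_iff lookup_P')
  \<comment> \<open>The term at \<open>s0\<close> cancels, its coefficient being 1 in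
    \<open>Q\<close> and \<open>b\<close> in \<open>R\<close>. No new top monomial appears, because
    \<open>R\<close> has top monomials only where \<open>Q\<close> has them.\<close>
  have "P' = 0"
  proof (rule ccontr)
    assume "P' \<noteq> 0"
    moreover have "lookup P' s \<in> k" for s
      unfolding lookup_P' b_def by (intro diff_k mult_k R(1) Q(1) bk s0V)
    moreover have "keys s \<subseteq> V" if "s \<in> keys P'" for s
      using keys_P'[OF that] R(2) Q(2) by blast
    moreover have "mpoly_eval x P' = 0"
      by (simp add: P'_def mpoly_eval_diff mpoly_eval_mult R(3) Q(3))
    ultimately have "relation P'"
      by (simp add: relation_def)
    moreover have "wdeg d s \<le> D" if "s \<in> keys P'" for s
      using keys_P'[OF that] R(4) D0 by (auto simp: keys_Q)
    moreover have "{s\<in>keys P'. wdeg d s = D} \<subset> {s\<in>keys Q0. wdeg d s = D}"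
    proof
      show "{s \<in> keys P'. wdeg d s = D} \<subseteq> {s \<in> keys Q0. wdeg d s = D}"
        using keys_Q by (auto simp: in_keys_iff lookup_P' R_top sigma_zero lookup_Q)
      have "s0 \<notin> keys P'"
        using s0 by (simp add: in_keys_iff lookup_P' R_top Qs0 sigma_one b_def)
      then show "{s \<in> keys P'. wdeg d s = D} \<noteq> {s \<in> keys Q0. wdeg d s = D}"
        using s0 by blast
    qed
    ultimately show False using min0 by blast
  qed
  then have R_eq: "lookup R s = b * lookup Q s" for s
    using lookup_P'[of s] by simp
  have same: "lookup s v = lookup s0 v" if "s \<in> keys Q" "wdeg d s = D" "v \<in> V" "d v = 0" for s v
  proof (rule ccontr)
    assume "lookup s v \<noteq> lookup s0 v"
    then have ?mult
      using that s0V Q R_top[of s] R_eq[of s]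
      by (intro exI[of _ s] exI[of _ s0] exI[of _ "lookup Q s"])
         (auto simp: b_def in_keys_iff)
    with nmult show False by blast
  qed
  \<comment> \<open>On variables of degree 1 the factor \<open>\<beta>\<close> is 1, so only the
    exponents on degree-0 variables count.\<close>
  have mon_cong: "mon_eval \<beta> s = mon_eval \<beta> t"
    if "keys s \<subseteq> V" "keys t \<subseteq> V" "\<And>v. v \<in> V \<Longrightarrow> d v = 0 \<Longrightarrow> lookup s v = lookup t v" for s t
  proof -
    have "mon_eval \<beta> s = (\<Prod>v\<in>keys s \<union> keys t. \<beta> v ^ lookup s v)"
      by (rule mon_eval_superset) auto
    also have "\<dots> = (\<Prod>v\<in>keys s \<union> keys t. \<beta> v ^ lookup t v)"
      by (intro prod.cong) (use that d_cases in force)+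
    also have "\<dots> = mon_eval \<beta> t"
      by (rule mon_eval_superset[symmetric]) auto
    finally show ?thesis .
  qed
  have cancel_b: "y = z" if "b * y = b * z" for y z
    using mult_eq_0_k[OF bk[OF s0V] bnz[OF s0V], of "y - z"] that by (simp add: b_def right_diff_distrib)
  have top_b: "mon_eval \<beta> s = b" if "s \<in> keys Q" "wdeg d s = D" for s
    unfolding b_def by (rule mon_cong) (use that Q s0V same in auto)
  have inv: "\<sigma> (lookup Q s) = lookup Q s" if "s \<in> keys Q" "wdeg d s = D" for s
  proof -
    have "b * \<sigma> (lookup Q s) = lookup R s"
      using R_top[of s] top_b[OF that] that by (simp add: mult.commute)
    also have "\<dots> = b * lookup Q s" by (rule R_eq)
    finally show ?thesis by (rule cancel_b)
  qed
  \<comment> \<open>In degree 0 all monomials have the exponents of \<open>s0\<close>, so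
    \<open>Q\<close> would be the single monomial \<open>s0\<close>, whose value is nonzero by
    \<open>unit\<close>.\<close>
  have "D \<noteq> 0"
  proof
    assume D: "D = 0"
    have "s = s0" if s: "s \<in> keys Q" for s
    proof (rule poly_mapping_eqI)
      fix v
      have ws: "wdeg d s = 0" "wdeg d s0 = 0" using D0[of s] s s0 D keys_Q by auto
      show "lookup s v = lookup s0 v"
      proof (cases "v \<in> V \<and> d v = 0")
        case True
        then show ?thesis using same[of s v] s ws D by auto
      next
        case False
        have "lookup r v = 0" if "keys r \<subseteq> V" "wdeg d r = 0" for r
        proof (rule ccontr)
          assume "lookup r v \<noteq> 0"
          then have v: "v \<in> keys r" by (simp add: in_keys_iff)
          then have "d v = 0" using that(2) by (auto simp: wdeg_def in_keys_iff)
          with v that(1) False show False by blast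
        qed
        then show ?thesis using ws Q(2)[OF s] s0V by simp
      qed
    qed
    then have "Q = Poly_Mapping.single s0 1"
      by (intro poly_mapping_eqI) (metis Qs0 in_keys_iff lookup_single_eq lookup_single_not_eq)
    then show False
      using Q(3) unit[OF s0V] s0 D by simp
  qed
  then have "wdeg d s0 \<noteq> 0" using s0 by simp
  then have "\<exists>v\<in>keys s0. d v \<noteq> 0"
    by (auto simp: wdeg_def)
  then obtain v0 where v0: "v0 \<in> keys s0" "d v0 \<noteq> 0"
    by blast
  have dv0: "d v0 = 1" using v0 s0V d_cases[of v0] by auto
  obtain r where r: "s0 = r + e v0"
    using v0(1) monomial_eq_add_single by (metis in_keys_iff neq0_conv)
  have wr: "Suc (wdeg d r) = D" using s0 dv0 by (simp add: r wdeg_add)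
  have rV: "keys r \<subseteq> V" using s0V by (auto simp: r in_keys_iff lookup_add subset_iff)
  define W where "W = {v. d v = 1 \<and> r + e v \<in> keys Q}"
  have finW: "finite W"
    by (rule inj_on_finite[of "\<lambda>v. r + e v" _ "keys Q"]) (auto simp: W_def inj_on_def)
  have WV: "v \<in> V" if "v \<in> W" for v
    using that Q(2)[of "r + e v"] by (auto simp: W_def in_keys_iff lookup_add subset_iff)
  have wW: "wdeg d (r + e v) = D" "r + e v \<in> keys Q" if "v \<in> W" for v
    using that wr by (auto simp: W_def wdeg_add)
  \<comment> \<open>These are the factors with which the top monomials \<open>r + e v\<close> reach
    \<open>r\<close>. For \<open>v0\<close> the coefficient of \<open>Q\<close> is 1, so
    \<open>\<kappa> v0\<close> is the image of a positive integer and nonzero.\<close>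
  define \<kappa> where "\<kappa> = (\<lambda>v. lookup Q (r + e v) * of_nat (Suc (lookup r v)))"
  have "b * (\<sigma> (lookup Q r) + (\<Sum>v\<in>W. \<kappa> v * a v)) = lookup R r"
  proof -
    have rb: "mon_eval \<beta> r = b"
      unfolding b_def using dv0 by (intro mon_cong rV s0V) (auto simp: r lookup_add lookup_single when_def)
    have "(\<Sum>v\<in>W. \<sigma> (lookup Q (r + e v)) *
          (mon_eval \<beta> (r + e v) * (of_nat (Suc (lookup r v)) * a v))) = (\<Sum>v\<in>W. b * (\<kappa> v * a v))"
      by (intro sum.cong) (auto simp: inv top_b wW \<kappa>_def algebra_simps)
    then show ?thesis
      unfolding R_next[OF wr] W_def[symmetric] by (simp add: rb sum_distrib_left algebra_simps)
  qed
  then have eq: "\<sigma> (lookup Q r) + (\<Sum>v\<in>W. \<kappa> v * a v) = lookup Q r"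
    unfolding R_eq by (rule cancel_b)
  have v0W: "v0 \<in> W" using dv0 s0 keys_Q by (simp add: W_def r)
  have "\<sigma> (of_nat m) = of_nat m" for m
    by (induction m) (simp_all add: sigma_zero sigma_add sigma_one)
  then have \<kappa>: "d v = 1 \<and> \<kappa> v \<in> k \<and> \<sigma> (\<kappa> v) = \<kappa> v" if "v \<in> W" for v
    using wW[OF that] inv that Q by (auto simp: \<kappa>_def sigma_mult W_def simp del: of_nat_Suc intro!: mult_k of_nat_k)
  have "\<kappa> v0 \<noteq> 0"
    using Qs0 by (simp add: \<kappa>_def r del: of_nat_Suc)
  then show ?lin
    using finW WV \<kappa> v0W eq Q(1)[of r]
    by (intro exI[of _ \<kappa>] exI[of _ W] exI[of _ "lookup Q r"]) (auto simp: algebra_simps)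
qed

end

section \<open>Germs of sequences and rational functions\<close>

\<comment> \<open>Eventual equality, because a nonzero rational function may have finitely many
  zeros and poles on an orbit; as germs along an infinite orbit such functions become
  invertible.\<close>
quotient_type germ = "nat \<Rightarrow> complex" / "\<lambda>f g. \<forall>\<^sub>F n in sequentially. f n = g n"
proof (rule equivpI)
  show "reflp (\<lambda>f g :: nat \<Rightarrow> complex. \<forall>\<^sub>F n in sequentially. f n = g n)"
    by (simp add: reflp_def)
  show "symp (\<lambda>f g :: nat \<Rightarrow> complex. \<forall>\<^sub>F n in sequentially. f n = g n)"
    by (auto simp: symp_def elim: eventually_mono)
  show "transp (\<lambda>f g :: nat \<Rightarrow> complex. \<forall>\<^sub>F n in sequentially. f n = g n)"
    unfolding transp_def by (auto elim: eventually_elim2)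
qed

lift_definition germ_of :: "(nat \<Rightarrow> complex) \<Rightarrow> germ" is "\<lambda>f. f" .

lift_definition germ_shift :: "germ \<Rightarrow> germ" is "\<lambda>f n. f (Suc n)"
  by (subst eventually_sequentially_Suc)

instantiation germ :: comm_ring_1
begin

lift_definition zero_germ :: germ is "\<lambda>_. 0" .
lift_definition one_germ :: germ is "\<lambda>_. 1" .
lift_definition plus_germ :: "germ \<Rightarrow> germ \<Rightarrow> germ" is "\<lambda>f g n. f n + g n"
  by (auto elim: eventually_elim2)
lift_definition times_germ :: "germ \<Rightarrow> germ \<Rightarrow> germ" is "\<lambda>f g n. f n * g n"
  by (auto elim: eventually_elim2)
lift_definition uminus_germ :: "germ \<Rightarrow> germ" is "\<lambda>f n. - f n"
  by (auto elim: eventually_mono)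
lift_definition minus_germ :: "germ \<Rightarrow> germ \<Rightarrow> germ" is "\<lambda>f g n. f n - g n"
  by (auto elim: eventually_elim2)

instance
  by standard (transfer; simp add: algebra_simps)+

end

lemma germ_of_eq_iff: "germ_of f = germ_of g \<longleftrightarrow> (\<forall>\<^sub>F n in sequentially. f n = g n)"
  by transfer simp

lemma germ_cases: obtains f where "c = germ_of f"
  by transfer (auto intro: exI[of _ c])

lemma germ_of_zero: "germ_of (\<lambda>_. 0) = 0" by transfer simp
lemma germ_of_eq_0_iff: "germ_of f = 0 \<longleftrightarrow> (\<forall>\<^sub>F n in sequentially. f n = 0)"
  by transfer simp
lemma germ_of_one: "germ_of (\<lambda>_. 1) = 1" by transfer simp
lemma germ_of_add: "germ_of (\<lambda>n. f n + g n) = germ_of f + germ_of g" by transfer simp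
lemma germ_of_mult: "germ_of (\<lambda>n. f n * g n) = germ_of f * germ_of g" by transfer simp
lemma germ_of_uminus: "germ_of (\<lambda>n. - f n) = - germ_of f" by transfer simp
lemma germ_of_diff: "germ_of (\<lambda>n. f n - g n) = germ_of f - germ_of g" by transfer simp

lemma germ_of_power: "germ_of (\<lambda>n. f n ^ m) = germ_of f ^ m"
  by (induction m) (simp_all add: germ_of_one germ_of_mult)

lemma germ_of_sum: "germ_of (\<lambda>n. \<Sum>i\<in>I. f i n) = (\<Sum>i\<in>I. germ_of (f i))"
  by (induction I rule: infinite_finite_induct) (simp_all add: germ_of_zero germ_of_add)

lemma germ_of_prod: "germ_of (\<lambda>n. \<Prod>i\<in>I. f i n) = (\<Prod>i\<in>I. germ_of (f i))"
  by (induction I rule: infinite_finite_induct) (simp_all add: germ_of_one germ_of_mult)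

lemma germ_of_nat: "of_nat m = germ_of (\<lambda>_. of_nat m)"
  by (induction m) (simp_all add: germ_of_zero germ_of_one germ_of_add)

lemma germ_of_mon_eval: "germ_of (\<lambda>n. mon_eval (\<lambda>v. x v n) s) = mon_eval (\<lambda>v. germ_of (x v)) s"
  by (simp add: mon_eval_def germ_of_prod germ_of_power)

instance germ :: ring_char_0
  by standard (auto simp: inj_def germ_of_nat germ_of_eq_iff)

lemma germ_shift_germ_of: "germ_shift (germ_of f) = germ_of (\<lambda>n. f (Suc n))"
  by transfer simp

lemma germ_shift_ring_hom:
  "germ_shift (a + b) = germ_shift a + germ_shift b"
  "germ_shift (a * b) = germ_shift a * germ_shift b"
  "germ_shift 1 = 1"
  by (transfer; simp)+

text \<open>An eventually shift-invariant sequence is eventually constant. This is why the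
  coefficients of the linear relation come out as complex numbers.\<close>

lemma germ_shift_invariant:
  assumes "germ_shift c = c"
  obtains z where "c = germ_of (\<lambda>_. z)"
proof -
  obtain f where f: "c = germ_of f" by (rule germ_cases)
  then have "\<forall>\<^sub>F n in sequentially. f (Suc n) = f n"
    using assms by (simp add: germ_shift_germ_of germ_of_eq_iff)
  then obtain N where N: "\<And>n. n \<ge> N \<Longrightarrow> f (Suc n) = f n"
    by (auto simp: eventually_sequentially)
  have "f n = f N" if "n \<ge> N" for n
    using that by (induction n rule: dec_induct) (auto simp: N)
  then have "\<forall>\<^sub>F n in sequentially. f n = f N"
    unfolding eventually_sequentially by blast
  then have "c = germ_of (\<lambda>_. f N)"
    by (simp only: f germ_of_eq_iff)
  then show ?thesis by (rule that)
qed

text \<open>\<open>rational_functions\<close> is not closed under pointwise sums: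
  \<open>1 / x + 1\<close> takes the value 1 at 0, where a quotient of polynomials with that pole
  has the value 0. Ignoring finitely many points restores the field operations, differentiation and
  substitution.\<close>

definition almost_rational :: "(complex \<Rightarrow> complex) \<Rightarrow> bool" where
  "almost_rational f \<longleftrightarrow> (\<exists>R\<in>rational_functions. \<forall>\<^sub>F x in cofinite. f x = R x)"

lemma almost_rationalI:
  assumes "r \<noteq> 0" "\<forall>\<^sub>F x in cofinite. f x = poly p x / poly r x"
  shows "almost_rational f"
  using assms by (auto simp: almost_rational_def rational_functions_def)

lemma almost_rationalE:
  assumes "almost_rational f"
  obtains p r where "r \<noteq> 0" "\<forall>\<^sub>F x in cofinite. f x = poly p x / poly r x \<and> poly r x \<noteq> 0"
proof -
  obtain p r where r: "r \<noteq> 0" and eq: "\<forall>\<^sub>F x in cofinite. f x = poly p x / poly r x"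
    using assms by (auto simp: almost_rational_def rational_functions_def)
  have "\<forall>\<^sub>F x in cofinite. poly r x \<noteq> 0"
    using r by (simp add: eventually_cofinite poly_roots_finite)
  with eq have "\<forall>\<^sub>F x in cofinite. f x = poly p x / poly r x \<and> poly r x \<noteq> 0"
    by eventually_elim simp
  with r that show ?thesis by blast
qed

lemma almost_rational_cong:
  assumes "almost_rational f" "\<forall>\<^sub>F x in cofinite. f x = g x"
  shows "almost_rational g"
proof -
  obtain R where "R \<in> rational_functions" "\<forall>\<^sub>F x in cofinite. f x = R x"
    using assms(1) by (auto simp: almost_rational_def)
  moreover from this(2) assms(2) have "\<forall>\<^sub>F x in cofinite. g x = R x"
    by eventually_elim simp
  ultimately show ?thesis by (auto simp: almost_rational_def)
qed

lemma almost_rational_rational: "f \<in> rational_functions \<Longrightarrow> almost_rational f"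
  unfolding almost_rational_def by (rule bexI[of _ f]) auto

lemma almost_rational_poly: "almost_rational (poly p)"
  by (rule almost_rationalI[of 1 _ p]) auto

lemma almost_rational_const: "almost_rational (\<lambda>_. c)"
  by (rule almost_rational_cong[OF almost_rational_poly[of "[:c:]"]]) simp

lemma almost_rational_id: "almost_rational (\<lambda>x. x)"
  by (rule almost_rational_cong[OF almost_rational_poly[of "[:0, 1:]"]]) simp

lemma almost_rational_add:
  assumes "almost_rational f" "almost_rational g"
  shows "almost_rational (\<lambda>x. f x + g x)"
proof -
  obtain p r where f: "r \<noteq> 0" "\<forall>\<^sub>F x in cofinite. f x = poly p x / poly r x \<and> poly r x \<noteq> 0"
    using assms(1) by (rule almost_rationalE)
  obtain p' r' where g: "r' \<noteq> 0" "\<forall>\<^sub>F x in cofinite. g x = poly p' x / poly r' x \<and> poly r' x \<noteq> 0"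
    using assms(2) by (rule almost_rationalE)
  show ?thesis
  proof (rule almost_rationalI)
    show "r * r' \<noteq> 0" using f g by simp
    show "\<forall>\<^sub>F x in cofinite. f x + g x = poly (p * r' + p' * r) x / poly (r * r') x"
      using f(2) g(2) by eventually_elim (auto simp: field_simps)
  qed
qed

lemma almost_rational_mult:
  assumes "almost_rational f" "almost_rational g"
  shows "almost_rational (\<lambda>x. f x * g x)"
proof -
  obtain p r where f: "r \<noteq> 0" "\<forall>\<^sub>F x in cofinite. f x = poly p x / poly r x \<and> poly r x \<noteq> 0"
    using assms(1) by (rule almost_rationalE)
  obtain p' r' where g: "r' \<noteq> 0" "\<forall>\<^sub>F x in cofinite. g x = poly p' x / poly r' x \<and> poly r' x \<noteq> 0"
    using assms(2) by (rule almost_rationalE)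
  show ?thesis
  proof (rule almost_rationalI)
    show "r * r' \<noteq> 0" using f g by simp
    show "\<forall>\<^sub>F x in cofinite. f x * g x = poly (p * p') x / poly (r * r') x"
      using f(2) g(2) by eventually_elim auto
  qed
qed

lemma almost_rational_uminus: "almost_rational f \<Longrightarrow> almost_rational (\<lambda>x. - f x)"
  using almost_rational_mult[OF almost_rational_const[of "-1"]] by simp

lemma almost_rational_diff:
  "almost_rational f \<Longrightarrow> almost_rational g \<Longrightarrow> almost_rational (\<lambda>x. f x - g x)"
  using almost_rational_add[OF _ almost_rational_uminus, of f g] by simp

lemma almost_rational_sum:
  "(\<And>i. i \<in> I \<Longrightarrow> almost_rational (f i)) \<Longrightarrow> almost_rational (\<lambda>x. \<Sum>i\<in>I. f i x)"
  by (induction I rule: infinite_finite_induct)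
     (auto intro: almost_rational_const almost_rational_add)

lemma almost_rational_prod:
  "(\<And>i. i \<in> I \<Longrightarrow> almost_rational (f i)) \<Longrightarrow> almost_rational (\<lambda>x. \<Prod>i\<in>I. f i x)"
  by (induction I rule: infinite_finite_induct)
     (auto intro: almost_rational_const almost_rational_mult)

lemma almost_rational_power: "almost_rational f \<Longrightarrow> almost_rational (\<lambda>x. f x ^ m)"
  by (induction m) (auto intro: almost_rational_const almost_rational_mult)

lemma almost_rational_inverse:
  assumes "almost_rational f"
  shows "almost_rational (\<lambda>x. inverse (f x))"
proof -
  obtain p r where f: "r \<noteq> 0" "\<forall>\<^sub>F x in cofinite. f x = poly p x / poly r x \<and> poly r x \<noteq> 0"
    using assms by (rule almost_rationalE)
  show ?thesis
  proof (cases "p = 0")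
    case True
    then have "\<forall>\<^sub>F x in cofinite. 0 = inverse (f x)"
      using f(2) by (auto elim: eventually_mono)
    then show ?thesis by (rule almost_rational_cong[OF almost_rational_const])
  next
    case False
    then show ?thesis
      by (rule almost_rationalI[of p _ r]) (use f(2) in \<open>auto elim: eventually_mono\<close>)
  qed
qed

lemma almost_rational_divide:
  "almost_rational f \<Longrightarrow> almost_rational g \<Longrightarrow> almost_rational (\<lambda>x. f x / g x)"
  unfolding divide_inverse by (intro almost_rational_mult almost_rational_inverse)

section \<open>Derivatives, affine substitutions and zeros of rational functions\<close>

lemma analytic_on_poly: "poly (p :: complex poly) analytic_on S"
proof -
  have "poly p holomorphic_on UNIV"
    using poly_holomorphic_on[of "\<lambda>z. z" UNIV p] by simp
  then have "poly p analytic_on UNIV"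
    by (simp add: analytic_on_open)
  then show ?thesis by (rule analytic_on_subset) simp
qed

text \<open>Derivatives depend on a whole neighbourhood. A cofinite set is open in a
  \<open>t1_space\<close>, so an identity of functions off a finite set may be differentiated
  there.\<close>

lemma eventually_cofinite_nhds:
  assumes "\<forall>\<^sub>F x :: 'a::t1_space in cofinite. P x"
  shows "\<forall>\<^sub>F x in cofinite. \<forall>\<^sub>F y in nhds x. P y"
proof (rule eventually_mono[OF assms])
  fix x assume "P x"
  have "open {x. P x}"
    using finite_imp_closed[of "{x. \<not> P x}"] assms
    by (simp add: eventually_cofinite closed_def Compl_eq)
  then show "\<forall>\<^sub>F y in nhds x. P y"
    using \<open>P x\<close> by (auto simp: eventually_nhds)
qed

lemma almost_rational_deriv:
  assumes "almost_rational f"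
  shows "almost_rational (deriv f)"
    and "\<forall>\<^sub>F x in cofinite. f analytic_on {x}"
proof -
  obtain p r where r: "r \<noteq> 0" and f: "\<forall>\<^sub>F x in cofinite. f x = poly p x / poly r x \<and> poly r x \<noteq> 0"
    using assms by (rule almost_rationalE)
  let ?g = "\<lambda>x. poly p x / poly r x"
  have *: "f analytic_on {x} \<and> poly r x \<noteq> 0 \<and>
      deriv f x = poly (pderiv p * r - p * pderiv r) x / poly (r * r) x"
    if "\<forall>\<^sub>F y in nhds x. f y = ?g y \<and> poly r y \<noteq> 0" for x
  proof -
    have r: "poly r x \<noteq> 0"
      using eventually_nhds_x_imp_x[OF that] by simp
    have eq: "\<forall>\<^sub>F y in nhds x. f y = ?g y"
      using that by (rule eventually_mono) simp
    have "?g analytic_on {x}"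
      using r by (intro analytic_on_divide analytic_on_poly) auto
    moreover have "f analytic_on {x} \<longleftrightarrow> ?g analytic_on {x}"
      by (rule analytic_at_cong[OF eq refl])
    moreover have "deriv f x = deriv ?g x"
      by (rule deriv_cong_ev[OF eq refl])
    moreover have "(?g has_field_derivative poly (pderiv p * r - p * pderiv r) x / poly (r * r) x) (at x)"
      using r by (auto intro!: derivative_eq_intros)
    ultimately show ?thesis
      using r by (metis DERIV_imp_deriv)
  qed
  have ev: "\<forall>\<^sub>F x in cofinite. \<forall>\<^sub>F y in nhds x. f y = ?g y \<and> poly r y \<noteq> 0"
    by (rule eventually_cofinite_nhds[OF f])
  show "\<forall>\<^sub>F x in cofinite. f analytic_on {x}"
    using ev by (rule eventually_mono) (use * in blast)
  show "almost_rational (deriv f)"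
  proof (rule almost_rationalI)
    show "r * r \<noteq> 0" using r by simp
    show "\<forall>\<^sub>F x in cofinite. deriv f x = poly (pderiv p * r - p * pderiv r) x / poly (r * r) x"
      using ev by (rule eventually_mono) (use * in blast)
  qed
qed

lemma eventually_cofinite_compose_inj:
  assumes "\<forall>\<^sub>F x in cofinite. P x" "inj f"
  shows "\<forall>\<^sub>F x in cofinite. P (f x)"
proof -
  have "finite (f -` {x. \<not> P x})"
    using assms by (intro finite_vimageI) (auto simp: eventually_cofinite)
  then show ?thesis by (simp add: eventually_cofinite vimage_def)
qed

lemma almost_rational_compose_affine:
  assumes "almost_rational f" "A \<noteq> 0"
  shows "almost_rational (\<lambda>x. f (A * x + B))"
proof -
  obtain p r where f: "r \<noteq> 0" "\<forall>\<^sub>F x in cofinite. f x = poly p x / poly r x \<and> poly r x \<noteq> 0"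
    using assms(1) by (rule almost_rationalE)
  have "inj (\<lambda>x. A * x + B)" using assms by (auto simp: inj_def)
  from eventually_cofinite_compose_inj[OF f(2) this]
  have ev: "\<forall>\<^sub>F x in cofinite. f (A * x + B) = poly (p \<circ>\<^sub>p [:B, A:]) x / poly (r \<circ>\<^sub>p [:B, A:]) x \<and>
      poly (r \<circ>\<^sub>p [:B, A:]) x \<noteq> 0"
    by (rule eventually_mono) (simp add: poly_pcompose algebra_simps)
  show ?thesis
  proof (rule almost_rationalI)
    show "r \<circ>\<^sub>p [:B, A:] \<noteq> 0"
      using f assms by (simp add: pcompose_eq_0_iff)
    show "\<forall>\<^sub>F x in cofinite. f (A * x + B) = poly (p \<circ>\<^sub>p [:B, A:]) x / poly (r \<circ>\<^sub>p [:B, A:]) x"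
      using ev by (rule eventually_mono) simp
  qed
qed

lemma almost_rational_zero_or_nonzero:
  assumes "almost_rational f"
  shows "(\<forall>\<^sub>F x in cofinite. f x = 0) \<or> (\<forall>\<^sub>F x in cofinite. f x \<noteq> 0)"
proof -
  obtain p r where r: "r \<noteq> 0" and f: "\<forall>\<^sub>F x in cofinite. f x = poly p x / poly r x \<and> poly r x \<noteq> 0"
    using assms by (rule almost_rationalE)
  show ?thesis
  proof (cases "p = 0")
    case True
    then show ?thesis using f by (auto elim: eventually_mono)
  next
    case False
    then have "\<forall>\<^sub>F x in cofinite. poly p x \<noteq> 0"
      by (simp add: eventually_cofinite poly_roots_finite)
    with f have "\<forall>\<^sub>F x in cofinite. f x \<noteq> 0"
      by eventually_elim simp
    then show ?thesis ..
  qed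
qed

lemma eventually_cofinite_sequence:
  assumes "\<forall>\<^sub>F x in cofinite. P x" "inj t"
  shows "\<forall>\<^sub>F n in sequentially. P (t n)"
  using eventually_cofinite_compose_inj[OF assms] by (simp add: cofinite_eq_sequentially)

text \<open>An injective sequence meets the finitely many zeros of a nonzero rational function
  finitely often. In this way identities observed along one orbit become identities of rational
  functions.\<close>

lemma almost_rational_zero_on_sequence:
  assumes "almost_rational f" "inj t" "\<forall>\<^sub>F n in sequentially. f (t n) = 0"
  shows "\<forall>\<^sub>F x in cofinite. f x = 0"
proof (rule ccontr)
  assume "\<not> ?thesis"
  then have "\<forall>\<^sub>F n in sequentially. f (t n) \<noteq> 0"
    using almost_rational_zero_or_nonzero[OF assms(1)] eventually_cofinite_sequence[OF _ assms(2)] by blast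
  with assms(3) have "\<forall>\<^sub>F n in sequentially. False"
    by eventually_elim simp
  then show False by simp
qed

lemma eventually_cofinite_imp_cosparse:
  assumes "\<forall>\<^sub>F x in cofinite. P x"
  shows "\<forall>\<^sub>\<approx>x\<in>D. P (x :: complex)"
  using assms unfolding eventually_cosparse eventually_cofinite by (rule finite_imp_sparse)

definition rational_germs :: "(nat \<Rightarrow> complex) \<Rightarrow> germ set" where
  "rational_germs t = {germ_of (\<lambda>n. f (t n)) | f. almost_rational f}"

lemma rational_germs_I: "almost_rational f \<Longrightarrow> germ_of (\<lambda>n. f (t n)) \<in> rational_germs t"
  by (auto simp: rational_germs_def)

text \<open>The affine recursion turns the shift into the substitution of \<open>A * x + B\<close>.
  Inverses exist because a nonzero rational function has finitely many zeros, which the injective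
  sequence eventually avoids.\<close>

lemma difference_ring_rational_germs:
  assumes "inj t" "A \<noteq> 0" "\<And>n. t (Suc n) = A * t n + B"
  shows "difference_ring germ_shift (rational_germs t)"
proof
  show "1 \<in> rational_germs t"
    using rational_germs_I[OF almost_rational_const[of 1]] by (simp add: germ_of_one)
  fix a b assume ab: "a \<in> rational_germs t"
  then obtain f where f: "almost_rational f" "a = germ_of (\<lambda>n. f (t n))"
    by (auto simp: rational_germs_def)
  show "germ_shift a \<in> rational_germs t"
    using rational_germs_I[OF almost_rational_compose_affine[OF f(1) assms(2), of B], of t]
    by (simp add: f(2) germ_shift_germ_of assms(3))
  show "- a \<in> rational_germs t"
    using rational_germs_I[OF almost_rational_uminus[OF f(1)], of t] by (simp add: f(2) germ_of_uminus)
  show "\<exists>b\<in>rational_germs t. a * b = 1" if "a \<noteq> 0"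
  proof (rule bexI)
    show "germ_of (\<lambda>n. inverse (f (t n))) \<in> rational_germs t"
      using rational_germs_I[OF almost_rational_inverse[OF f(1)]] .
    have "\<not> (\<forall>\<^sub>F x in cofinite. f x = 0)"
      using that eventually_cofinite_sequence[OF _ assms(1)]
      unfolding f(2) germ_of_eq_0_iff by blast
    then have "\<forall>\<^sub>F x in cofinite. f x \<noteq> 0"
      using almost_rational_zero_or_nonzero[OF f(1)] by blast
    then have "\<forall>\<^sub>F n in sequentially. f (t n) \<noteq> 0"
      by (rule eventually_cofinite_sequence[OF _ assms(1)])
    then show "a * germ_of (\<lambda>n. inverse (f (t n))) = 1"
      unfolding f(2) germ_of_mult[symmetric] germ_of_one[symmetric] germ_of_eq_iff
      by eventually_elim simp
  qed
  assume "b \<in> rational_germs t"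
  then obtain g where g: "almost_rational g" "b = germ_of (\<lambda>n. g (t n))"
    by (auto simp: rational_germs_def)
  show "a + b \<in> rational_germs t" "a * b \<in> rational_germs t"
    using rational_germs_I[OF almost_rational_add[OF f(1) g(1)], of t]
      rational_germs_I[OF almost_rational_mult[OF f(1) g(1)], of t]
    by (simp_all add: f(2) g(2) germ_of_add germ_of_mult)
qed (simp_all add: germ_shift_ring_hom)

section \<open>Logarithmic derivatives and leading terms\<close>

text \<open>The choices \<open>[:1:]\<close> and \<open>[:0, 1:]\<close> for \<open>w\<close> give
  \<open>d/dx\<close> and \<open>x d/dx\<close>, so that both cases share one development.\<close>

definition wderiv :: "complex poly \<Rightarrow> (complex \<Rightarrow> complex) \<Rightarrow> complex \<Rightarrow> complex" where
  "wderiv w f = (\<lambda>x. poly w x * deriv f x)"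

lemma holomorphic_on_wderiv:
  assumes "f holomorphic_on S" "open S"
  shows "wderiv w f holomorphic_on S"
proof -
  have "poly w holomorphic_on S"
    using analytic_on_poly analytic_imp_holomorphic by blast
  then show ?thesis
    unfolding wderiv_def by (intro holomorphic_on_mult holomorphic_deriv assms)
qed

lemma holomorphic_on_wderiv_funpow:
  assumes "f holomorphic_on S" "open S"
  shows "(wderiv w ^^ j) f holomorphic_on S"
  by (induction j) (auto intro: holomorphic_on_wderiv assms)

lemma meromorphic_on_wderiv:
  assumes "f meromorphic_on S"
  shows "wderiv w f meromorphic_on S"
  unfolding wderiv_def
  by (intro meromorphic_on_mult meromorphic_on_deriv assms analytic_on_imp_meromorphic_on analytic_on_poly)

lemma meromorphic_on_wderiv_funpow:
  "f meromorphic_on S \<Longrightarrow> (wderiv w ^^ j) f meromorphic_on S"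
  by (induction j) (auto intro: meromorphic_on_wderiv)

lemma almost_rational_wderiv: "almost_rational f \<Longrightarrow> almost_rational (wderiv w f)"
  unfolding wderiv_def by (intro almost_rational_mult almost_rational_poly almost_rational_deriv)

lemma almost_rational_wderiv_funpow:
  "almost_rational f \<Longrightarrow> almost_rational ((wderiv w ^^ j) f)"
  by (induction j) (auto intro: almost_rational_wderiv)

lemma wderiv_cong:
  assumes "open S" "x \<in> S" "\<And>y. y \<in> S \<Longrightarrow> f y = g y"
  shows "wderiv w f x = wderiv w g x"
proof -
  have "\<forall>\<^sub>F y in nhds x. f y = g y"
    using assms eventually_nhds by blast
  then show ?thesis
    by (simp add: wderiv_def deriv_cong_ev)
qed

lemma wderiv_funpow_cong:
  assumes "open S" "x \<in> S" "\<And>y. y \<in> S \<Longrightarrow> f y = g y"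
  shows "(wderiv w ^^ j) f x = (wderiv w ^^ j) g x"
  using assms(2)
proof (induction j arbitrary: x)
  case (Suc j)
  then show ?case
    using wderiv_cong[OF assms(1), of x "(wderiv w ^^ j) f" "(wderiv w ^^ j) g"] by simp
qed (use assms in simp)

lemma wderiv_const [simp]: "wderiv w (\<lambda>_. c) = (\<lambda>_. 0)"
  by (simp add: wderiv_def)

context
  fixes S :: "complex set" and f g :: "complex \<Rightarrow> complex"
  assumes S: "open S" and f: "f holomorphic_on S" and g: "g holomorphic_on S"
begin

lemma wderiv_add:
  "x \<in> S \<Longrightarrow> wderiv w (\<lambda>x. f x + g x) x = wderiv w f x + wderiv w g x"
  using f g S by (simp add: wderiv_def holomorphic_on_imp_differentiable_at algebra_simps)

lemma wderiv_mult:
  "x \<in> S \<Longrightarrow> wderiv w (\<lambda>x. f x * g x) x = wderiv w f x * g x + f x * wderiv w g x"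
  using f g S by (simp add: wderiv_def holomorphic_on_imp_differentiable_at algebra_simps)

end

lemma wderiv_funpow_add:
  assumes S: "open S" "f holomorphic_on S" "g holomorphic_on S" and x: "x \<in> S"
  shows "(wderiv w ^^ j) (\<lambda>x. f x + g x) x = (wderiv w ^^ j) f x + (wderiv w ^^ j) g x"
  using x
proof (induction j arbitrary: x)
  case (Suc j)
  have "wderiv w ((wderiv w ^^ j) (\<lambda>x. f x + g x)) x =
      wderiv w (\<lambda>x. (wderiv w ^^ j) f x + (wderiv w ^^ j) g x) x"
    by (rule wderiv_cong[OF S(1) Suc.prems Suc.IH])
  also have "\<dots> = wderiv w ((wderiv w ^^ j) f) x + wderiv w ((wderiv w ^^ j) g) x"
    by (rule wderiv_add[of S]) (auto intro: holomorphic_on_wderiv_funpow assms Suc.prems)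
  finally show ?case by simp
qed simp

text \<open>By the chain rule each derivative brings a factor \<open>A\<close>, which the hypothesis
  on \<open>w\<close> absorbs: \<open>\<partial>\<close> commutes with the substitution.\<close>

lemma wderiv_funpow_compose_affine:
  assumes w: "\<And>x. poly w (A * x + B) = A * poly w x"
    and S: "open S" "f holomorphic_on S" and T: "open T" "\<And>x. x \<in> T \<Longrightarrow> A * x + B \<in> S"
    and x: "x \<in> T"
  shows "(wderiv w ^^ j) (\<lambda>x. f (A * x + B)) x = (wderiv w ^^ j) f (A * x + B)"
  using x
proof (induction j arbitrary: x)
  case (Suc j)
  let ?h = "(wderiv w ^^ j) f"
  have "wderiv w ((wderiv w ^^ j) (\<lambda>x. f (A * x + B))) x = wderiv w (\<lambda>x. ?h (A * x + B)) x"
    by (rule wderiv_cong[OF T(1) Suc.prems Suc.IH])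
  also have "\<dots> = wderiv w ?h (A * x + B)"
  proof -
    have "?h holomorphic_on S"
      by (intro holomorphic_on_wderiv_funpow S)
    then have "(?h has_field_derivative deriv ?h (A * x + B)) (at (A * x + B))"
      using S(1) T(2)[OF Suc.prems] holomorphic_derivI by blast
    moreover have "((\<lambda>x. A * x + B) has_field_derivative A) (at x)"
      by (auto intro!: derivative_eq_intros)
    ultimately have "((\<lambda>x. ?h (A * x + B)) has_field_derivative deriv ?h (A * x + B) * A) (at x)"
      by (rule DERIV_chain2)
    then show ?thesis
      by (simp add: wderiv_def w DERIV_imp_deriv)
  qed
  finally show ?case by simp
qed simp

text \<open>The polynomials of weight at most \<open>m\<close> in the \<open>\<partial>\<^sup>l v\<close>, where \<open>\<partial>\<^sup>l v\<close> gets the weight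
  \<open>2 l + 1\<close>. This is twice the order of \<open>\<partial>\<^sup>l v\<close> as a differential polynomial in \<open>log u\<close>
  diminished by the degree, so that in \<open>\<partial>\<^sup>j u / u\<close> the linear term dominates.\<close>

inductive jet :: "complex poly \<Rightarrow> complex set \<Rightarrow> (complex \<Rightarrow> complex) \<Rightarrow> nat \<Rightarrow> (complex \<Rightarrow> complex) \<Rightarrow> bool"
  for w S v where
  const: "jet w S v m (\<lambda>_. c)"
| var: "2 * l + 1 \<le> m \<Longrightarrow> jet w S v m ((wderiv w ^^ l) v)"
| add: "jet w S v m f \<Longrightarrow> jet w S v m g \<Longrightarrow> jet w S v m (\<lambda>x. f x + g x)"
| mult: "jet w S v m f \<Longrightarrow> jet w S v m' g \<Longrightarrow> m + m' \<le> m'' \<Longrightarrow> jet w S v m'' (\<lambda>x. f x * g x)"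
| cong: "jet w S v m f \<Longrightarrow> (\<And>x. x \<in> S \<Longrightarrow> f x = g x) \<Longrightarrow> jet w S v m g"

context
  fixes S :: "complex set" and v :: "complex \<Rightarrow> complex" and w :: "complex poly"
  assumes S: "open S" and v: "v holomorphic_on S"
begin

lemma jet_holomorphic: "jet w S v m f \<Longrightarrow> f holomorphic_on S"
proof (induction rule: jet.induct)
  case (cong m f g)
  then show ?case using holomorphic_transform by blast
qed (auto intro!: holomorphic_intros holomorphic_on_wderiv_funpow S v)

text \<open>The weight of \<open>\<partial>^l v\<close> grows by exactly two under
  \<open>\<partial>\<close>, and the Leibniz rule carries the bound to products.\<close>

lemma jet_wderiv: "jet w S v m f \<Longrightarrow> jet w S v (m + 2) (wderiv w f)"
proof (induction rule: jet.induct)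
  case (var l m)
  then show ?case using jet.var[of "Suc l" "m + 2" w S v] by simp
next
  case (add m f g)
  show ?case
    by (rule jet.cong[OF jet.add[OF add.IH]])
       (auto intro!: wderiv_add[symmetric] S jet_holomorphic add.hyps)
next
  case (mult m f m' g m'')
  have "jet w S v (m'' + 2) (\<lambda>x. wderiv w f x * g x + f x * wderiv w g x)"
    using jet.mult[OF mult.IH(1) mult.hyps(2), of "m'' + 2"]
      jet.mult[OF mult.hyps(1) mult.IH(2), of "m'' + 2"] mult.hyps(3)
    by (auto intro: jet.add)
  then show ?case
    by (rule jet.cong) (auto intro!: wderiv_mult[symmetric] S jet_holomorphic mult.hyps)
next
  case (cong m f g)
  show ?case
    by (rule jet.cong[OF cong.IH]) (auto intro: wderiv_cong[OF S] cong.hyps)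
qed (auto intro: jet.const)

text \<open>If \<open>\<partial>^(l+1) u = u * y\<close>, the next factor is
  \<open>\<partial> y + v * y\<close>. Differentiation raises weights by two but multiplication by
  \<open>v\<close> only by one, so \<open>\<partial>^l v\<close>, of weight
  \<open>2 * l + 1\<close>, is heavier than everything else.\<close>

lemma wderiv_funpow_eq_jet:
  assumes u: "u holomorphic_on S" and eq: "\<And>x. x \<in> S \<Longrightarrow> wderiv w u x = u x * v x"
  shows "\<exists>f. jet w S v (2 * l) f \<and>
    (\<forall>x\<in>S. (wderiv w ^^ Suc l) u x = u x * ((wderiv w ^^ l) v x + f x))"
proof (induction l)
  case 0
  show ?case
    by (rule exI[of _ "\<lambda>_. 0"]) (use eq in \<open>auto intro: jet.const\<close>)
next
  case (Suc l)
  let ?w = "(wderiv w ^^ l) v"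
  from Suc.IH obtain f where f: "jet w S v (2 * l) f"
    and eqf: "\<And>x. x \<in> S \<Longrightarrow> (wderiv w ^^ Suc l) u x = u x * (?w x + f x)"
    by blast
  have hw: "?w holomorphic_on S" and hf: "f holomorphic_on S"
    by (auto intro: holomorphic_on_wderiv_funpow S v jet_holomorphic[OF f])
  have hwf: "(\<lambda>x. ?w x + f x) holomorphic_on S"
    by (intro holomorphic_on_add hw hf)
  define h where "h = (\<lambda>x. wderiv w f x + v x * (?w x + f x))"
  have "jet w S v (2 * l + 2) (\<lambda>x. v x * (?w x + f x))"
  proof (rule jet.mult[of _ _ _ 1])
    show "jet w S v 1 v" using jet.var[of 0 1 w S v] by simp
    \<comment> \<open>Weights are upper bounds: multiplying \<open>f\<close> by the constant 1,
      taken with weight 1, raises its bound to that of \<open>?w\<close>.\<close>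
    show "jet w S v (2 * l + 1) (\<lambda>x. ?w x + f x)"
      using jet.mult[OF f jet.const[of w S v 1 1], of "2 * l + 1"] by (intro jet.add jet.var) auto
  qed simp
  then have "jet w S v (2 * Suc l) h"
    using jet_wderiv[OF f] unfolding h_def by (intro jet.add) simp_all
  moreover have "(wderiv w ^^ Suc (Suc l)) u x = u x * ((wderiv w ^^ Suc l) v x + h x)"
    if x: "x \<in> S" for x
  proof -
    have "wderiv w ((wderiv w ^^ Suc l) u) x = wderiv w (\<lambda>x. u x * (?w x + f x)) x"
      by (rule wderiv_cong[OF S x eqf])
    also have "\<dots> = wderiv w u x * (?w x + f x) + u x * wderiv w (\<lambda>x. ?w x + f x) x"
      by (rule wderiv_mult[OF S u hwf x])
    also have "wderiv w (\<lambda>x. ?w x + f x) x = wderiv w ?w x + wderiv w f x"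
      by (rule wderiv_add[OF S hw hf x])
    finally show ?thesis
      by (simp add: eq[OF x] h_def algebra_simps)
  qed
  ultimately show ?case by blast
qed

end

text \<open>The variable \<open>(i, Suc l)\<close> gets \<open>2 * l + 1\<close>, the weight used in
  \<open>jet\<close>; for \<open>(i, 0)\<close> truncated subtraction gives 0, so the factors
  \<open>u i\<close> do not influence which term leads.\<close>

definition pweight :: "nat \<times> nat \<Rightarrow> nat" where
  "pweight v = 2 * snd v - 1"

lemma wdeg_mult_keys:
  assumes "\<And>r. r \<in> keys p \<Longrightarrow> wdeg d r \<le> m" "\<And>r. r \<in> keys q \<Longrightarrow> wdeg d r \<le> m'" "r \<in> keys (p * q)"
  shows "wdeg d r \<le> m + m'"
proof -
  obtain a b where "r = a + b" "a \<in> keys p" "b \<in> keys q"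
    using keys_mult[of p q] assms(3) by blast
  with assms show ?thesis by (simp add: wdeg_add add_mono)
qed

lemma keys_add_cases: "r \<in> keys (p + q) \<Longrightarrow> r \<in> keys p \<or> r \<in> keys q"
  using keys_add[of p q] by blast

lemma keys_mult_subset:
  fixes p q :: "('v \<Rightarrow>\<^sub>0 nat) \<Rightarrow>\<^sub>0 'a::comm_ring_1"
  assumes "\<And>r. r \<in> keys p \<Longrightarrow> keys r \<subseteq> V" "\<And>r. r \<in> keys q \<Longrightarrow> keys r \<subseteq> V" "r \<in> keys (p * q)"
  shows "keys r \<subseteq> V"
proof -
  obtain a b where r: "r = a + b" "a \<in> keys p" "b \<in> keys q"
    using keys_mult[of p q] assms(3) by blast
  show ?thesis
    using keys_add[of a b] assms(1)[OF r(2)] assms(2)[OF r(3)] by (auto simp: r(1))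
qed

text \<open>\<open>jet\<close> speaks of functions, whereas nontriviality of a relation is read off
  formal polynomials; so one is extracted together with its weight bound.\<close>

lemma jet_eq_mpoly_eval:
  fixes X :: "nat \<times> nat \<Rightarrow> complex \<Rightarrow> complex"
  assumes "jet w S v m f" and X: "\<And>l. X (i, Suc l) = (wderiv w ^^ l) v"
  shows "\<exists>p. (\<forall>r\<in>keys p. wdeg pweight r \<le> m \<and> keys r \<subseteq> {i} \<times> UNIV) \<and>
    (\<forall>x\<in>S. f x = mpoly_eval (\<lambda>v. X v x) p)"
  using assms(1)
proof (induction rule: jet.induct)
  case (const m c)
  show ?case by (rule exI[of _ "Poly_Mapping.single 0 c"]) auto
next
  case (var l m)
  then show ?case
    by (intro exI[of _ "Poly_Mapping.single (Poly_Mapping.single (i, Suc l) 1) 1"])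
       (auto simp: X pweight_def)
next
  case (add m f g)
  then obtain p q where "\<forall>r\<in>keys p. wdeg pweight r \<le> m \<and> keys r \<subseteq> {i} \<times> UNIV"
      "\<forall>x\<in>S. f x = mpoly_eval (\<lambda>v. X v x) p"
      "\<forall>r\<in>keys q. wdeg pweight r \<le> m \<and> keys r \<subseteq> {i} \<times> UNIV"
      "\<forall>x\<in>S. g x = mpoly_eval (\<lambda>v. X v x) q"
    by blast
  then show ?case
    by (intro exI[of _ "p + q"]) (auto simp: mpoly_eval_add dest!: keys_add_cases)
next
  case (mult m f m' g m'')
  then obtain p q where pq: "\<forall>r\<in>keys p. wdeg pweight r \<le> m \<and> keys r \<subseteq> {i} \<times> UNIV"
      "\<forall>x\<in>S. f x = mpoly_eval (\<lambda>v. X v x) p"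
      "\<forall>r\<in>keys q. wdeg pweight r \<le> m' \<and> keys r \<subseteq> {i} \<times> UNIV"
      "\<forall>x\<in>S. g x = mpoly_eval (\<lambda>v. X v x) q"
    by blast
  have "wdeg pweight r \<le> m''" "keys r \<subseteq> {i} \<times> UNIV" if "r \<in> keys (p * q)" for r
    using wdeg_mult_keys[of p pweight m q m' r] keys_mult_subset[of p "{i} \<times> UNIV" q r] pq that mult.hyps(3)
    by auto
  with pq show ?case
    by (intro exI[of _ "p * q"]) (auto simp: mpoly_eval_mult)
next
  case (cong m f g)
  then show ?case by metis
qed

text \<open>A monic term that strictly outweighs all others. Products preserve this without a total
  order on the monomials, ties among the lower terms being harmless.\<close>

definition has_leading :: "('v \<Rightarrow> nat) \<Rightarrow> (('v \<Rightarrow>\<^sub>0 nat) \<Rightarrow>\<^sub>0 'a::comm_ring_1) \<Rightarrow> ('v \<Rightarrow>\<^sub>0 nat) \<Rightarrow> bool" where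
  "has_leading d p s \<longleftrightarrow> (\<exists>q. p = Poly_Mapping.single s 1 + q \<and> (\<forall>r\<in>keys q. wdeg d r < wdeg d s))"

lemma has_leading_single: "has_leading d (Poly_Mapping.single s 1) s"
  by (auto simp: has_leading_def intro: exI[of _ 0])

lemma has_leading_mult:
  assumes "has_leading d p s" "has_leading d q t"
  shows "has_leading d (p * q) (s + t)"
proof -
  obtain p' where p: "p = Poly_Mapping.single s 1 + p'" "\<And>r. r \<in> keys p' \<Longrightarrow> wdeg d r < wdeg d s"
    using assms(1) by (auto simp: has_leading_def)
  obtain q' where q: "q = Poly_Mapping.single t 1 + q'" "\<And>r. r \<in> keys q' \<Longrightarrow> wdeg d r < wdeg d t"
    using assms(2) by (auto simp: has_leading_def)
  define r where "r = Poly_Mapping.single s 1 * q' + (p' * Poly_Mapping.single t 1 + p' * q')"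
  have "wdeg d a < wdeg d (s + t)" if a: "a \<in> keys r" for a
  proof -
    consider "a \<in> keys (Poly_Mapping.single s 1 * q')" | "a \<in> keys (p' * Poly_Mapping.single t 1)"
      | "a \<in> keys (p' * q')"
      using a keys_add_cases[of a "p' * Poly_Mapping.single t 1" "p' * q'"]
        keys_add_cases[of a "Poly_Mapping.single s 1 * q'" "p' * Poly_Mapping.single t 1 + p' * q'"]
      unfolding r_def by blast
    then show ?thesis
    proof cases
      case 1
      then obtain b where "a = s + b" "b \<in> keys q'"
        using keys_mult[of "Poly_Mapping.single s 1" q'] by (auto split: if_splits)
      then show ?thesis using q(2) by (simp add: wdeg_add)
    next
      case 2
      then obtain b where "a = b + t" "b \<in> keys p'"
        using keys_mult[of p' "Poly_Mapping.single t 1"] by (auto split: if_splits)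
      then show ?thesis using p(2) by (simp add: wdeg_add)
    next
      case 3
      then obtain b c where "a = b + c" "b \<in> keys p'" "c \<in> keys q'"
        using keys_mult[of p' q'] by auto
      then show ?thesis using p(2)[of b] q(2)[of c] by (simp add: wdeg_add)
    qed
  qed
  moreover have "p * q = Poly_Mapping.single (s + t) 1 + r"
    by (simp add: p(1) q(1) r_def algebra_simps mult_single)
  ultimately show ?thesis
    by (auto simp: has_leading_def)
qed

lemma has_leading_lookup:
  assumes "has_leading d p s"
  shows "lookup p s = 1" "r \<in> keys p \<Longrightarrow> r = s \<or> wdeg d r < wdeg d s"
proof -
  obtain q where q: "p = Poly_Mapping.single s 1 + q" "\<And>r. r \<in> keys q \<Longrightarrow> wdeg d r < wdeg d s"
    using assms by (auto simp: has_leading_def)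
  have "s \<notin> keys q" using q(2) by blast
  then show "lookup p s = 1" by (simp add: q(1) lookup_add in_keys_iff)
  assume "r \<in> keys p"
  then have "r \<in> keys (Poly_Mapping.single s (1::'b)) \<or> r \<in> keys q"
    unfolding q(1) by (rule keys_add_cases)
  then show "r = s \<or> wdeg d r < wdeg d s"
    using q(2) by auto
qed

text \<open>The monomial \<open>\<Prod> (\<partial>\<^sup>j u\<^sub>i)\<^bsup>m(i,j)\<^esup>\<close> has the leading term \<open>lead_mon m\<close> as a polynomial in the
  variables \<open>(i, 0)\<close>, standing for \<open>u\<^sub>i\<close>, and \<open>(i, Suc l)\<close>, standing for \<open>\<partial>\<^sup>l (\<partial> u\<^sub>i / u\<^sub>i)\<close>.\<close>

definition head_mon :: "(nat \<times> nat \<Rightarrow>\<^sub>0 nat) \<Rightarrow> (nat \<times> nat \<Rightarrow>\<^sub>0 nat)" where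
  "head_mon m = (\<Sum>v\<in>keys m. if snd v = 0 then 0 else Poly_Mapping.single (fst v, 0) (lookup m v))"

definition lead_mon :: "(nat \<times> nat \<Rightarrow>\<^sub>0 nat) \<Rightarrow> (nat \<times> nat \<Rightarrow>\<^sub>0 nat)" where
  "lead_mon m = m + head_mon m"

lemma head_mon_superset:
  assumes "finite A" "keys m \<subseteq> A"
  shows "head_mon m = (\<Sum>v\<in>A. if snd v = 0 then 0 else Poly_Mapping.single (fst v, 0) (lookup m v))"
  unfolding head_mon_def
  by (rule sum.mono_neutral_left) (use assms in \<open>auto simp: in_keys_iff\<close>)

lemma lead_mon_add: "lead_mon (m + m') = lead_mon m + lead_mon m'"
proof -
  let ?A = "keys m \<union> keys m'"
  have *: "keys (m + m') \<subseteq> ?A"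
    by (rule keys_add)
  have "head_mon (m + m') = head_mon m + head_mon m'"
    unfolding head_mon_superset[OF _ *, simplified]
    by (subst (1 2) head_mon_superset[of ?A])
       (auto simp: lookup_add single_add sum.distrib[symmetric] intro!: sum.cong)
  then show ?thesis
    by (simp add: lead_mon_def algebra_simps)
qed

lemma lead_mon_single:
  "lead_mon (Poly_Mapping.single (i, 0) (Suc 0)) = Poly_Mapping.single (i, 0) (Suc 0)"
  "lead_mon (Poly_Mapping.single (i, Suc l) (Suc 0)) =
     Poly_Mapping.single (i, 0) (Suc 0) + Poly_Mapping.single (i, Suc l) (Suc 0)"
  by (simp_all add: lead_mon_def head_mon_def add.commute)

text \<open>\<open>head_mon\<close> affects only the exponents of the \<open>(i, 0)\<close> and is
  determined by those of the \<open>(i, Suc l)\<close>. The latter can be read off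
  \<open>lead_mon m\<close>, and then \<open>head_mon m\<close> can be subtracted.\<close>

lemma inj_lead_mon: "inj lead_mon"
proof (rule injI)
  fix m m' :: "nat \<times> nat \<Rightarrow>\<^sub>0 nat"
  assume eq: "lead_mon m = lead_mon m'"
  have "lookup (head_mon r) (i, Suc l) = 0" for r i l
    by (auto simp: head_mon_def lookup_sum lookup_single intro!: sum.neutral)
  then have *: "lookup m (i, Suc l) = lookup m' (i, Suc l)" for i l
    using arg_cong[OF eq, of "\<lambda>r. lookup r (i, Suc l)"] by (simp add: lead_mon_def lookup_add)
  have "head_mon m = head_mon m'"
  proof -
    let ?A = "keys m \<union> keys m'"
    have *: "(if snd v = 0 then 0 else Poly_Mapping.single (fst v, 0) (lookup m v)) =
        (if snd v = 0 then 0 else Poly_Mapping.single (fst v, 0) (lookup m' v))" for v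
      using *[of "fst v" "snd v - 1"] by (cases v) auto
    have "head_mon m = (\<Sum>v\<in>?A. if snd v = 0 then 0 else Poly_Mapping.single (fst v, 0) (lookup m v))"
      by (rule head_mon_superset) auto
    also have "\<dots> = (\<Sum>v\<in>?A. if snd v = 0 then 0 else Poly_Mapping.single (fst v, 0) (lookup m' v))"
      by (rule sum.cong[OF refl *])
    also have "\<dots> = head_mon m'"
      by (rule head_mon_superset[symmetric]) auto
    finally show ?thesis .
  qed
  with eq show "m = m'" by (simp add: lead_mon_def)
qed

section \<open>Orbits\<close>

lemma eval_diff_poly_eq:
  "eval_diff_poly \<delta> P u x =
     (\<Sum>m\<in>keys P. lookup P m x * mon_eval (\<lambda>v. (\<delta> ^^ snd v) (u (fst v)) x) m)"
  unfolding eval_diff_poly_def mon_eval_def by (simp add: case_prod_unfold)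

lemma eval_linear_diff_poly_superset:
  assumes "finite A" "keys L \<subseteq> A"
  shows "eval_linear_diff_poly \<delta> L a x = (\<Sum>v\<in>A. lookup L v * (\<delta> ^^ snd v) (a (fst v)) x)"
proof -
  have "eval_linear_diff_poly \<delta> L a x = (\<Sum>v\<in>keys L. lookup L v * (\<delta> ^^ snd v) (a (fst v)) x)"
    unfolding eval_linear_diff_poly_def by (simp add: case_prod_unfold)
  also have "\<dots> = (\<Sum>v\<in>A. lookup L v * (\<delta> ^^ snd v) (a (fst v)) x)"
    by (rule sum.mono_neutral_left) (use assms in \<open>auto simp: in_keys_iff\<close>)
  finally show ?thesis .
qed

definition germ_poly :: "('m \<Rightarrow>\<^sub>0 complex) \<Rightarrow> ('m \<Rightarrow>\<^sub>0 germ)" where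
  "germ_poly p = (\<Sum>s\<in>keys p. Poly_Mapping.single s (germ_of (\<lambda>_. lookup p s)))"

lemma lookup_germ_poly: "lookup (germ_poly p) s = germ_of (\<lambda>_. lookup p s)"
  by (auto simp: germ_poly_def lookup_sum lookup_single when_def in_keys_iff germ_of_zero)

lemma mpoly_eval_germ_poly:
  "mpoly_eval (\<lambda>v. germ_of (x v)) (germ_poly p) = germ_of (\<lambda>n. mpoly_eval (\<lambda>v. x v n) p)"
  by (simp add: germ_poly_def mpoly_eval_sum mpoly_eval_def[of _ p] germ_of_sum germ_of_mult germ_of_mon_eval)

section \<open>Logarithmic derivatives of products and powers\<close>

definition log_deriv :: "complex poly \<Rightarrow> (complex \<Rightarrow> complex) \<Rightarrow> complex \<Rightarrow> complex" where
  "log_deriv w f = (\<lambda>x. wderiv w f x / f x)"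

lemma log_deriv_cong:
  assumes "open S" "x \<in> S" "\<And>y. y \<in> S \<Longrightarrow> f y = g y"
  shows "log_deriv w f x = log_deriv w g x"
  using wderiv_cong[OF assms] assms(2,3) by (simp add: log_deriv_def)

lemma log_deriv_mult:
  assumes "open S" "f holomorphic_on S" "g holomorphic_on S" "x \<in> S" "f x \<noteq> 0" "g x \<noteq> 0"
  shows "log_deriv w (\<lambda>x. f x * g x) x = log_deriv w f x + log_deriv w g x"
  using assms by (simp add: log_deriv_def wderiv_mult[OF assms(1-4)] field_simps)

lemma log_deriv_power:
  assumes "open S" "f holomorphic_on S" "x \<in> S" "f x \<noteq> 0"
  shows "log_deriv w (\<lambda>x. f x ^ m) x = of_nat m * log_deriv w f x"
proof (induction m)
  case (Suc m)
  have "log_deriv w (\<lambda>x. f x * f x ^ m) x = log_deriv w f x + log_deriv w (\<lambda>x. f x ^ m) x"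
    using assms by (intro log_deriv_mult[of S]) (auto intro: holomorphic_intros)
  with Suc show ?case by (simp add: algebra_simps)
qed (simp add: log_deriv_def)

lemma log_deriv_prod:
  assumes "open S" "\<And>i. i \<in> I \<Longrightarrow> f i holomorphic_on S" "x \<in> S" "\<And>i. i \<in> I \<Longrightarrow> f i x \<noteq> 0"
  shows "log_deriv w (\<lambda>x. \<Prod>i\<in>I. f i x) x = (\<Sum>i\<in>I. log_deriv w (f i) x)"
  using assms(2,4)
proof (induction I rule: infinite_finite_induct)
  case (insert i I)
  have "log_deriv w (\<lambda>x. f i x * (\<Prod>i\<in>I. f i x)) x = log_deriv w (f i) x + log_deriv w (\<lambda>x. \<Prod>i\<in>I. f i x) x"
    using assms(1,3) insert.prems insert.hyps
    by (intro log_deriv_mult[of S]) (auto intro!: holomorphic_intros)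
  with insert show ?case by simp
qed (auto simp: log_deriv_def)

lemma holomorphic_on_log_deriv:
  assumes "open S" "f holomorphic_on S" "\<And>x. x \<in> S \<Longrightarrow> f x \<noteq> 0"
  shows "log_deriv w f holomorphic_on S"
  unfolding log_deriv_def using assms
  by (intro holomorphic_on_divide holomorphic_on_wderiv) auto

lemma almost_rational_log_deriv: "almost_rational f \<Longrightarrow> almost_rational (log_deriv w f)"
  unfolding log_deriv_def by (intro almost_rational_divide almost_rational_wderiv)

text \<open>Equality in the field of meromorphic functions says nothing about single values. Where
  both sides are analytic, continuity turns it into equality at the point.\<close>

lemma eq_at_analytic_point:
  fixes f :: "complex \<Rightarrow> complex"
  assumes "f analytic_on {x}" "g analytic_on {x}" "\<forall>\<^sub>F y in at x. f y = g y"
  shows "f x = g x"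
proof -
  have "(f \<longlongrightarrow> f x) (at x)" "(g \<longlongrightarrow> g x) (at x)"
    using assms(1,2) analytic_at_imp_isCont isContD by blast+
  moreover from this(1) have "(g \<longlongrightarrow> f x) (at x)"
    by (rule Lim_transform_eventually) (rule assms(3))
  ultimately show ?thesis
    using tendsto_unique trivial_limit_at by blast
qed

text \<open>The instances are \<open>D = UNIV\<close>, \<open>A = B = 1\<close>,
  \<open>w = [:1:]\<close>, and \<open>D = - {0}\<close>, \<open>A = q\<close>,
  \<open>B = 0\<close>, \<open>w = [:0, 1:]\<close>. In the second, \<open>inj_orbit\<close> holds
  because \<open>norm q \<noteq> 1\<close>.\<close>

locale difference_domain =
  fixes D :: "complex set" and A B :: complex and w :: "complex poly" and \<phi> :: "complex \<Rightarrow> complex"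
  assumes finite_Compl_D: "finite (- D)" and A_nz: "A \<noteq> 0" and phi: "\<phi> x = A * x + B"
    and phi_D: "\<phi> x \<in> D \<longleftrightarrow> x \<in> D" and w_phi: "poly w (\<phi> x) = A * poly w x"
    and inj_orbit: "x \<in> D \<Longrightarrow> inj (\<lambda>n. (\<phi> ^^ n) x)"
begin

lemma open_D: "open D"
  using finite_Compl_D by (simp add: open_closed finite_imp_closed)

lemma connected_D: "connected D"
  using connected_open_delete_finite[of UNIV "- D"] finite_Compl_D
  by (simp add: Compl_eq_Diff_UNIV[symmetric] connected_UNIV)

lemma uncountable_D: "uncountable D"
proof
  assume "countable D"
  then have "countable (D \<union> - D)"
    using finite_Compl_D countable_finite by blast
  then show False
    using uncountable_UNIV_complex by (simp add: Un_commute)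
qed

lemma inj_phi: "inj \<phi>"
  using A_nz by (auto simp: inj_def phi)

lemma phi_funpow_D: "x \<in> D \<Longrightarrow> (\<phi> ^^ m) x \<in> D"
  by (induction m) (auto simp: phi_D)

lemma phi_analytic: "\<phi> analytic_on S"
  unfolding phi[abs_def] by (intro analytic_intros)

text \<open>Being continuous and injective, \<open>\<phi>\<close> maps the points near
  \<open>x\<close> and different from it to points near \<open>\<phi> x\<close> and different from
  it.\<close>

lemma cosparse_phi:
  assumes "\<forall>\<^sub>\<approx>x\<in>D. P x"
  shows "\<forall>\<^sub>\<approx>x\<in>D. P (\<phi> x)"
  unfolding eventually_cosparse_open_eq[OF open_D]
proof
  fix x assume "x \<in> D"
  then have ev: "\<forall>\<^sub>F y in at (\<phi> x). P y"
    using assms phi_D by (auto simp: eventually_cosparse_open_eq[OF open_D])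
  have "isCont \<phi> x"
    using phi_analytic analytic_at_imp_isCont by blast
  then have "filterlim \<phi> (at (\<phi> x)) (at x)"
    unfolding filterlim_at isCont_def
    using inj_eq[OF inj_phi] by (auto simp: eventually_at_filter)
  from filterlim_iff[THEN iffD1, OF this, rule_format, OF ev]
  show "\<forall>\<^sub>F y in at x. P (\<phi> y)" .
qed

text \<open>The exceptional set is sparse in an open set, hence countable, and so are its preimages
  under the injective iterates. As \<open>D\<close> is uncountable, countably many such conditions
  can be met along a whole forward orbit.\<close>

lemma countable_exceptional_orbits:
  assumes "\<forall>\<^sub>\<approx>x\<in>D. P x"
  shows "countable {z\<in>D. \<exists>m. \<not> P ((\<phi> ^^ m) z)}"
proof -
  have c: "countable (D \<inter> {x. \<not> P x})"
    using assms by (intro sparse_imp_countable open_D) (simp add: eventually_cosparse)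
  have "countable {z\<in>D. \<not> P ((\<phi> ^^ m) z)}" for m
  proof (rule countable_image_inj_on)
    show "inj_on (\<phi> ^^ m) {z\<in>D. \<not> P ((\<phi> ^^ m) z)}"
      using inj_phi by (meson inj_fn inj_on_subset subset_UNIV)
    show "countable ((\<phi> ^^ m) ` {z\<in>D. \<not> P ((\<phi> ^^ m) z)})"
      by (rule countable_subset[OF _ c]) (auto intro: phi_funpow_D)
  qed
  moreover have "{z\<in>D. \<exists>m. \<not> P ((\<phi> ^^ m) z)} = (\<Union>m. {z\<in>D. \<not> P ((\<phi> ^^ m) z)})"
    by auto
  ultimately show ?thesis by auto
qed

definition invariants :: "(complex \<Rightarrow> complex) set" where
  "invariants = {f. f meromorphic_on D \<and> (\<forall>\<^sub>\<approx>x\<in>D. f (\<phi> x) = f x)}"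

lemma adjoin_x_meromorphic: "f \<in> adjoin_x invariants \<Longrightarrow> f meromorphic_on D"
  by (induction rule: adjoin_x.induct) (auto simp: invariants_def intro!: meromorphic_intros)

text \<open>On a generic orbit the elements of \<open>\<F>\<close> are constant, so those of \<open>\<F>(x)\<close> are rational.\<close>

lemma adjoin_x_orbit:
  assumes "f \<in> adjoin_x invariants"
  shows "\<exists>C. countable C \<and> (\<forall>z\<in>D - C. \<exists>R. almost_rational R \<and>
    (\<forall>\<^sub>F m in sequentially. f ((\<phi> ^^ m) z) = R ((\<phi> ^^ m) z)))"
  using assms
proof (induction rule: adjoin_x.induct)
  case (base f)
  define C where "C = {z\<in>D. \<exists>m. \<not> f (\<phi> ((\<phi> ^^ m) z)) = f ((\<phi> ^^ m) z)}"
  have "countable C"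
    using base unfolding C_def invariants_def by (intro countable_exceptional_orbits) auto
  moreover have "\<exists>R. almost_rational R \<and> (\<forall>\<^sub>F m in sequentially. f ((\<phi> ^^ m) z) = R ((\<phi> ^^ m) z))"
    if "z \<in> D - C" for z
  proof -
    \<comment> \<open>The constant is the value at the starting point; the rational function thus
      depends on the orbit.\<close>
    have "f ((\<phi> ^^ m) z) = f z" for m
      using that by (induction m) (auto simp: C_def)
    then show ?thesis
      by (intro exI[of _ "\<lambda>_. f z"]) (auto intro: almost_rational_const)
  qed
  ultimately show ?case by blast
next
  case x
  then show ?case
    by (intro exI[of _ "{}"]) (auto intro!: exI[of _ "\<lambda>x. x"] almost_rational_id)
next
  case (add f g)
  then obtain C C' where C: "countable C" "countable C'"
    and f: "\<And>z. z \<in> D - C \<Longrightarrow> \<exists>R. almost_rational R \<and>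
        (\<forall>\<^sub>F m in sequentially. f ((\<phi> ^^ m) z) = R ((\<phi> ^^ m) z))"
    and g: "\<And>z. z \<in> D - C' \<Longrightarrow> \<exists>R. almost_rational R \<and>
        (\<forall>\<^sub>F m in sequentially. g ((\<phi> ^^ m) z) = R ((\<phi> ^^ m) z))"
    by blast
  show ?case
  proof (intro exI[of _ "C \<union> C'"] conjI ballI)
    fix z assume z: "z \<in> D - (C \<union> C')"
    obtain R R' where "almost_rational R" "almost_rational R'"
      and ev: "\<forall>\<^sub>F m in sequentially. f ((\<phi> ^^ m) z) = R ((\<phi> ^^ m) z)"
        "\<forall>\<^sub>F m in sequentially. g ((\<phi> ^^ m) z) = R' ((\<phi> ^^ m) z)"
      using f[of z] g[of z] z by auto
    moreover from ev have "\<forall>\<^sub>F m in sequentially. f ((\<phi> ^^ m) z) + g ((\<phi> ^^ m) z) =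
        R ((\<phi> ^^ m) z) + R' ((\<phi> ^^ m) z)"
      by eventually_elim simp
    ultimately show "\<exists>R. almost_rational R \<and>
        (\<forall>\<^sub>F m in sequentially. f ((\<phi> ^^ m) z) + g ((\<phi> ^^ m) z) = R ((\<phi> ^^ m) z))"
      by (intro exI[of _ "\<lambda>x. R x + R' x"]) (auto intro: almost_rational_add)
  qed (use C in auto)
next
  case (mult f g)
  then obtain C C' where C: "countable C" "countable C'"
    and f: "\<And>z. z \<in> D - C \<Longrightarrow> \<exists>R. almost_rational R \<and>
        (\<forall>\<^sub>F m in sequentially. f ((\<phi> ^^ m) z) = R ((\<phi> ^^ m) z))"
    and g: "\<And>z. z \<in> D - C' \<Longrightarrow> \<exists>R. almost_rational R \<and>
        (\<forall>\<^sub>F m in sequentially. g ((\<phi> ^^ m) z) = R ((\<phi> ^^ m) z))"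
    by blast
  show ?case
  proof (intro exI[of _ "C \<union> C'"] conjI ballI)
    fix z assume z: "z \<in> D - (C \<union> C')"
    obtain R R' where "almost_rational R" "almost_rational R'"
      and ev: "\<forall>\<^sub>F m in sequentially. f ((\<phi> ^^ m) z) = R ((\<phi> ^^ m) z)"
        "\<forall>\<^sub>F m in sequentially. g ((\<phi> ^^ m) z) = R' ((\<phi> ^^ m) z)"
      using f[of z] g[of z] z by auto
    moreover from ev have "\<forall>\<^sub>F m in sequentially. f ((\<phi> ^^ m) z) * g ((\<phi> ^^ m) z) =
        R ((\<phi> ^^ m) z) * R' ((\<phi> ^^ m) z)"
      by eventually_elim simp
    ultimately show "\<exists>R. almost_rational R \<and>
        (\<forall>\<^sub>F m in sequentially. f ((\<phi> ^^ m) z) * g ((\<phi> ^^ m) z) = R ((\<phi> ^^ m) z))"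
      by (intro exI[of _ "\<lambda>x. R x * R' x"]) (auto intro: almost_rational_mult)
  qed (use C in auto)
next
  case (uminus f)
  then obtain C where C: "countable C"
    and f: "\<And>z. z \<in> D - C \<Longrightarrow> \<exists>R. almost_rational R \<and>
        (\<forall>\<^sub>F m in sequentially. f ((\<phi> ^^ m) z) = R ((\<phi> ^^ m) z))"
    by blast
  show ?case
  proof (intro exI[of _ C] conjI ballI C)
    fix z assume "z \<in> D - C"
    then obtain R where "almost_rational R"
      "\<forall>\<^sub>F m in sequentially. f ((\<phi> ^^ m) z) = R ((\<phi> ^^ m) z)"
      using f by blast
    then show "\<exists>R. almost_rational R \<and> (\<forall>\<^sub>F m in sequentially. - f ((\<phi> ^^ m) z) = R ((\<phi> ^^ m) z))"
      by (intro exI[of _ "\<lambda>x. - R x"]) (auto intro: almost_rational_uminus)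
  qed
next
  case (inverse f)
  then obtain C where C: "countable C"
    and f: "\<And>z. z \<in> D - C \<Longrightarrow> \<exists>R. almost_rational R \<and>
        (\<forall>\<^sub>F m in sequentially. f ((\<phi> ^^ m) z) = R ((\<phi> ^^ m) z))"
    by blast
  show ?case
  proof (intro exI[of _ C] conjI ballI C)
    fix z assume "z \<in> D - C"
    then obtain R where "almost_rational R"
      "\<forall>\<^sub>F m in sequentially. f ((\<phi> ^^ m) z) = R ((\<phi> ^^ m) z)"
      using f by blast
    then show "\<exists>R. almost_rational R \<and> (\<forall>\<^sub>F m in sequentially. inverse (f ((\<phi> ^^ m) z)) = R ((\<phi> ^^ m) z))"
      by (intro exI[of _ "\<lambda>x. inverse (R x)"]) (auto intro: almost_rational_inverse)
  qed
qed

end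

locale difference_solutions = difference_domain +
  fixes n :: nat and b u :: "nat \<Rightarrow> complex \<Rightarrow> complex"
  assumes b_rational: "i \<in> {1..n} \<Longrightarrow> b i \<in> rational_functions"
    and u_meromorphic: "i \<in> {1..n} \<Longrightarrow> u i meromorphic_on D"
    and u_nz: "i \<in> {1..n} \<Longrightarrow> \<not> (\<forall>\<^sub>\<approx>x\<in>D. u i x = 0)"
    and u_phi: "i \<in> {1..n} \<Longrightarrow> \<forall>\<^sub>\<approx>x\<in>D. u i (\<phi> x) = b i x * u i x"
begin

definition telescopes :: bool where
  "telescopes \<longleftrightarrow> (\<exists>L\<in>linear_diff_polys n. L \<noteq> 0 \<and>
     (\<exists>g\<in>rational_functions. \<forall>\<^sub>\<approx>x\<in>D.
        eval_linear_diff_poly (wderiv w) L (\<lambda>i. log_deriv w (b i)) x = g (\<phi> x) - g x))"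

lemma b_almost_rational: "i \<in> {1..n} \<Longrightarrow> almost_rational (b i)"
  by (intro almost_rational_rational b_rational)

section \<open>Regular points and the transformation of the logarithmic derivatives\<close>

definition regular :: "complex set" where
  "regular = {x\<in>D. \<forall>i\<in>{1..n}. u i analytic_on {x} \<and> u i x \<noteq> 0}"

lemma open_regular: "open regular"
proof (subst open_subopen, intro ballI)
  fix x assume x: "x \<in> regular"
  have "\<forall>\<^sub>F y in nhds x. u i analytic_on {y} \<and> u i y \<noteq> 0" if "i \<in> {1..n}" for i
  proof -
    have an: "u i analytic_on {x}" and nz: "u i x \<noteq> 0" using x that by (auto simp: regular_def)
    then obtain S where S: "open S" "x \<in> S" "u i holomorphic_on S"
      by (auto simp: analytic_at)
    then have "\<forall>y\<in>S. u i analytic_on {y}"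
      by (auto simp: analytic_at)
    then have "\<forall>\<^sub>F y in nhds x. u i analytic_on {y}"
      using S by (auto simp: eventually_nhds)
    moreover have "isCont (u i) x"
      using an by (rule analytic_at_imp_isCont)
    then have "\<forall>\<^sub>F y in nhds x. u i y \<noteq> 0"
      using nz by (intro tendsto_imp_eventually_ne) (simp_all add: isCont_def tendsto_at_iff_tendsto_nhds)
    ultimately show ?thesis by eventually_elim simp
  qed
  then have "\<forall>\<^sub>F y in nhds x. \<forall>i\<in>{1..n}. u i analytic_on {y} \<and> u i y \<noteq> 0"
    by (intro eventually_ball_finite) auto
  moreover have "\<forall>\<^sub>F y in nhds x. y \<in> D"
    using x open_D by (auto simp: regular_def intro: eventually_nhds_in_open)
  ultimately have "\<forall>\<^sub>F y in nhds x. y \<in> regular"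
    by eventually_elim (auto simp: regular_def)
  then show "\<exists>T. open T \<and> x \<in> T \<and> T \<subseteq> regular"
    by (auto simp: eventually_nhds)
qed

lemma cosparse_in_D: "\<forall>\<^sub>\<approx>x\<in>D. x \<in> D"
  by (rule eventually_in_cosparse) (auto simp: open_D)

lemma cosparse_regular: "\<forall>\<^sub>\<approx>x\<in>D. x \<in> regular"
proof -
  have "\<forall>\<^sub>\<approx>x\<in>D. u i analytic_on {x} \<and> u i x \<noteq> 0" if "i \<in> {1..n}" for i
  proof -
    have "\<forall>\<^sub>\<approx>x\<in>D. u i x \<noteq> 0"
      using meromorphic_imp_constant_or_avoid[OF u_meromorphic[OF that] open_D connected_D, of 0]
        u_nz[OF that] by blast
    with meromorphic_on_imp_analytic_cosparse[OF u_meromorphic[OF that]]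
    show ?thesis by eventually_elim simp
  qed
  then have "\<forall>\<^sub>\<approx>x\<in>D. \<forall>i\<in>{1..n}. u i analytic_on {x} \<and> u i x \<noteq> 0"
    by (intro eventually_ball_finite) auto
  with cosparse_in_D show ?thesis
    by eventually_elim (auto simp: regular_def)
qed

lemma u_holomorphic: "i \<in> {1..n} \<Longrightarrow> u i holomorphic_on regular"
  by (rule analytic_imp_holomorphic) (subst analytic_on_analytic_at, auto simp: regular_def)

lemma log_deriv_u_holomorphic: "i \<in> {1..n} \<Longrightarrow> log_deriv w (u i) holomorphic_on regular"
  by (rule holomorphic_on_log_deriv[OF open_regular u_holomorphic]) (auto simp: regular_def)

text \<open>The equations are given off a sparse set only. Where all functions involved are analytic
  they hold pointwise, and then \<open>b i x\<close> is nonzero because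
  \<open>u i (\<phi> x)\<close> is.\<close>

lemma exists_equation_domain:
  "\<exists>T. open T \<and> (\<forall>\<^sub>\<approx>x\<in>D. x \<in> T) \<and> (\<forall>x\<in>T. x \<in> regular \<and> \<phi> x \<in> regular \<and>
     (\<forall>i\<in>{1..n}. b i analytic_on {x} \<and> b i x \<noteq> 0 \<and> u i (\<phi> x) = b i x * u i x))"
proof -
  define N where "N = {x. \<forall>i\<in>{1..n}. b i analytic_on {x}}"
  define T where "T = regular \<inter> \<phi> -` regular \<inter> N"
  have N: "\<forall>\<^sub>F x in cofinite. x \<in> N"
    unfolding N_def mem_Collect_eq
    by (intro eventually_ball_finite ballI almost_rational_deriv(2) b_almost_rational) simp_all
  then have "finite (- N)"
    by (simp add: eventually_cofinite Compl_eq)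
  then have "open N"
    by (simp add: open_closed finite_imp_closed)
  moreover have "continuous_on UNIV \<phi>"
    unfolding phi[abs_def] by (intro continuous_intros)
  ultimately have "open T"
    unfolding T_def using open_regular by (intro open_Int open_vimage) auto
  moreover have "\<forall>\<^sub>\<approx>x\<in>D. x \<in> T"
    using cosparse_regular cosparse_phi[OF cosparse_regular] eventually_cofinite_imp_cosparse[OF N]
    by eventually_elim (auto simp: T_def)
  moreover have "b i x \<noteq> 0 \<and> u i (\<phi> x) = b i x * u i x" if x: "x \<in> T" and i: "i \<in> {1..n}" for x i
  proof -
    have an: "u i analytic_on {x}" "u i analytic_on {\<phi> x}" "b i analytic_on {x}"
      and nz: "u i (\<phi> x) \<noteq> 0" and xD: "x \<in> D"
      using x i by (auto simp: T_def regular_def N_def)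
    have "(\<lambda>x. u i (\<phi> x)) analytic_on {x}"
      using analytic_on_compose[of \<phi> "{x}" "u i"] phi_analytic an by (simp add: o_def)
    moreover have "(\<lambda>x. b i x * u i x) analytic_on {x}"
      by (intro analytic_on_mult an)
    moreover have "\<forall>\<^sub>F y in at x. u i (\<phi> y) = b i y * u i y"
      using u_phi[OF i] xD by (auto simp: eventually_cosparse_open_eq[OF open_D])
    ultimately have "u i (\<phi> x) = b i x * u i x"
      by (rule eq_at_analytic_point)
    with nz show ?thesis by auto
  qed
  ultimately show ?thesis
    by (intro exI[of _ T]) (auto simp: T_def N_def)
qed

definition good :: "complex set" where
  "good = (SOME T. open T \<and> (\<forall>\<^sub>\<approx>x\<in>D. x \<in> T) \<and> (\<forall>x\<in>T. x \<in> regular \<and> \<phi> x \<in> regular \<and>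
     (\<forall>i\<in>{1..n}. b i analytic_on {x} \<and> b i x \<noteq> 0 \<and> u i (\<phi> x) = b i x * u i x)))"

lemma good:
  shows open_good: "open good" and cosparse_good: "\<forall>\<^sub>\<approx>x\<in>D. x \<in> good"
    and good_regular: "x \<in> good \<Longrightarrow> x \<in> regular" "x \<in> good \<Longrightarrow> \<phi> x \<in> regular"
    and good_b: "x \<in> good \<Longrightarrow> i \<in> {1..n} \<Longrightarrow> b i analytic_on {x} \<and> b i x \<noteq> 0"
    and good_u: "x \<in> good \<Longrightarrow> i \<in> {1..n} \<Longrightarrow> u i (\<phi> x) = b i x * u i x"
  using someI_ex[OF exists_equation_domain] unfolding good_def[symmetric] by blast+

text \<open>Logarithmic differentiation of \<open>u i (\<phi> x) = b i x * u i x\<close> turns the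
  factor into a summand. As \<open>\<partial>\<close> commutes with \<open>\<phi>\<close>, the
  identity may be differentiated further.\<close>

lemma log_deriv_u_phi:
  assumes i: "i \<in> {1..n}" and x: "x \<in> good"
  shows "(wderiv w ^^ j) (log_deriv w (u i)) (\<phi> x) =
    (wderiv w ^^ j) (log_deriv w (u i)) x + (wderiv w ^^ j) (log_deriv w (b i)) x"
proof -
  let ?v = "log_deriv w (u i)"
  have b_hol: "b i holomorphic_on good"
    using good_b[OF _ i] by (intro analytic_imp_holomorphic) (subst analytic_on_analytic_at, auto)
  have u_hol: "u i holomorphic_on good"
    using u_holomorphic[OF i] good_regular by (blast intro: holomorphic_on_subset)
  have v_hol: "?v holomorphic_on good"
    using log_deriv_u_holomorphic[OF i] good_regular by (blast intro: holomorphic_on_subset)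
  have lb_hol: "log_deriv w (b i) holomorphic_on good"
    using b_hol good_b[OF _ i] by (intro holomorphic_on_log_deriv open_good) auto
  have w': "poly w (A * x + B) = A * poly w x" for x
    using w_phi[of x] by (simp add: phi)
  have eq: "?v (\<phi> y) = ?v y + log_deriv w (b i) y" if y: "y \<in> good" for y
  proof -
    have "wderiv w (\<lambda>x. u i (\<phi> x)) y = wderiv w (u i) (\<phi> y)"
      using wderiv_funpow_compose_affine[OF w' open_regular u_holomorphic[OF i] open_good _ y, of 1]
        good_regular by (simp add: phi)
    then have "?v (\<phi> y) = log_deriv w (\<lambda>x. u i (\<phi> x)) y"
      by (simp add: log_deriv_def)
    also have "\<dots> = log_deriv w (\<lambda>x. b i x * u i x) y"
      by (rule log_deriv_cong[OF open_good y]) (rule good_u[OF _ i])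
    also have "\<dots> = log_deriv w (b i) y + ?v y"
      using good_b[OF y i] good_regular(1)[OF y] i
      by (intro log_deriv_mult[OF open_good b_hol u_hol y]) (auto simp: regular_def)
    finally show ?thesis by simp
  qed
  have "(wderiv w ^^ j) ?v (\<phi> x) = (wderiv w ^^ j) (\<lambda>x. ?v (\<phi> x)) x"
    using wderiv_funpow_compose_affine[OF w' open_regular log_deriv_u_holomorphic[OF i] open_good _ x, of j]
      good_regular by (simp add: phi)
  also have "\<dots> = (wderiv w ^^ j) (\<lambda>x. ?v x + log_deriv w (b i) x) x"
    by (rule wderiv_funpow_cong[OF open_good x]) (rule eq)
  also have "\<dots> = (wderiv w ^^ j) ?v x + (wderiv w ^^ j) (log_deriv w (b i)) x"
    by (rule wderiv_funpow_add[OF open_good v_hol lb_hol x])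
  finally show ?thesis .
qed

definition jet_var :: "nat \<times> nat \<Rightarrow> complex \<Rightarrow> complex" where
  "jet_var v = (wderiv w ^^ snd v) (u (fst v))"

definition log_var :: "nat \<times> nat \<Rightarrow> complex \<Rightarrow> complex" where
  "log_var v = (if snd v = 0 then u (fst v) else (wderiv w ^^ (snd v - 1)) (log_deriv w (u (fst v))))"

lemma wderiv_u: "x \<in> regular \<Longrightarrow> i \<in> {1..n} \<Longrightarrow> wderiv w (u i) x = u i x * log_deriv w (u i) x"
  by (auto simp: log_deriv_def regular_def)

text \<open>For \<open>j = Suc l\<close> the factor \<open>u i\<close>, of weight 0, is split off;
  in the cofactor the \<open>l\<close>-th derivative of the logarithmic derivative outweighs the
  rest.\<close>

lemma jet_var_eq_mpoly_eval:
  assumes i: "i \<in> {1..n}"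
  shows "\<exists>p. has_leading pweight p (lead_mon (Poly_Mapping.single (i, j) (Suc 0))) \<and>
    (\<forall>r\<in>keys p. keys r \<subseteq> {1..n} \<times> UNIV) \<and>
    (\<forall>x\<in>regular. jet_var (i, j) x = mpoly_eval (\<lambda>v. log_var v x) p)"
proof (cases j)
  case 0
  then show ?thesis
    using i by (intro exI[of _ "Poly_Mapping.single (Poly_Mapping.single (i, 0) (Suc 0)) 1"])
      (auto simp: lead_mon_single has_leading_single jet_var_def log_var_def)
next
  case (Suc l)
  let ?e = "\<lambda>v. Poly_Mapping.single v (Suc 0)" and ?v = "log_deriv w (u i)"
  obtain f where f: "jet w regular ?v (2 * l) f"
    and eq: "\<And>x. x \<in> regular \<Longrightarrow> (wderiv w ^^ Suc l) (u i) x = u i x * ((wderiv w ^^ l) ?v x + f x)"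
    using wderiv_funpow_eq_jet[OF open_regular log_deriv_u_holomorphic u_holomorphic wderiv_u, OF i i _ i, of l]
    by blast
  obtain p where p: "\<And>r. r \<in> keys p \<Longrightarrow> wdeg pweight r \<le> 2 * l \<and> keys r \<subseteq> {i} \<times> UNIV"
    and fp: "\<And>x. x \<in> regular \<Longrightarrow> f x = mpoly_eval (\<lambda>v. log_var v x) p"
    using jet_eq_mpoly_eval[OF f, of log_var i] by (auto simp: log_var_def)
  define q where "q = Poly_Mapping.single (?e (i, Suc l)) 1 + p"
  have "has_leading pweight q (?e (i, Suc l))"
    unfolding has_leading_def q_def
    by (rule exI[of _ p]) (use p in \<open>auto simp: pweight_def less_Suc_eq_le\<close>)
  then have "has_leading pweight (Poly_Mapping.single (?e (i, 0)) 1 * q) (?e (i, 0) + ?e (i, Suc l))"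
    by (intro has_leading_mult has_leading_single)
  moreover have "keys r \<subseteq> {1..n} \<times> UNIV" if "r \<in> keys (Poly_Mapping.single (?e (i, 0)) 1 * q)" for r
  proof (rule keys_mult_subset[OF _ _ that])
    show "keys r \<subseteq> {1..n} \<times> UNIV" if "r \<in> keys q" for r
      using keys_add_cases[OF that[unfolded q_def]] p[of r] i by (auto split: if_splits)
  qed (use i in auto)
  moreover have "jet_var (i, j) x = mpoly_eval (\<lambda>v. log_var v x) (Poly_Mapping.single (?e (i, 0)) 1 * q)"
    if "x \<in> regular" for x
    using eq[OF that] fp[OF that]
    by (simp add: Suc jet_var_def q_def mpoly_eval_mult mpoly_eval_add log_var_def)
  ultimately show ?thesis
    by (intro exI[of _ "Poly_Mapping.single (?e (i, 0)) 1 * q"]) (auto simp: Suc lead_mon_single)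
qed

lemma jet_mon_eq_mpoly_eval:
  assumes "keys m \<subseteq> {1..n} \<times> UNIV"
  shows "\<exists>p. has_leading pweight p (lead_mon m) \<and> (\<forall>r\<in>keys p. keys r \<subseteq> {1..n} \<times> UNIV) \<and>
    (\<forall>x\<in>regular. mon_eval (\<lambda>v. jet_var v x) m = mpoly_eval (\<lambda>v. log_var v x) p)"
  using assms
proof (induction m rule: monomial_induct)
  case zero
  then show ?case
    using has_leading_single[of pweight 0]
    by (intro exI[of _ 1]) (auto simp: lead_mon_def head_mon_def)
next
  case (add m v)
  have "keys m \<subseteq> keys (m + Poly_Mapping.single v (Suc 0))" "v \<in> keys (m + Poly_Mapping.single v (Suc 0))"
    by (auto simp: in_keys_iff lookup_add)
  then have "keys m \<subseteq> {1..n} \<times> UNIV" and v: "fst v \<in> {1..n}"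
    using add.prems by (blast, force)
  then obtain p where p: "has_leading pweight p (lead_mon m)" "\<forall>r\<in>keys p. keys r \<subseteq> {1..n} \<times> UNIV"
    "\<forall>x\<in>regular. mon_eval (\<lambda>v. jet_var v x) m = mpoly_eval (\<lambda>v. log_var v x) p"
    using add.IH by blast
  obtain q where q: "has_leading pweight q (lead_mon (Poly_Mapping.single v (Suc 0)))"
    "\<forall>r\<in>keys q. keys r \<subseteq> {1..n} \<times> UNIV"
    "\<forall>x\<in>regular. jet_var v x = mpoly_eval (\<lambda>v. log_var v x) q"
    using jet_var_eq_mpoly_eval[OF v, of "snd v"] by auto
  show ?case
  proof (intro exI[of _ "p * q"] conjI ballI)
    show "has_leading pweight (p * q) (lead_mon (m + Poly_Mapping.single v (Suc 0)))"
      unfolding lead_mon_add by (rule has_leading_mult[OF p(1) q(1)])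
    show "keys r \<subseteq> {1..n} \<times> UNIV" if "r \<in> keys (p * q)" for r
      using keys_mult_subset[OF _ _ that, of "{1..n} \<times> UNIV"] p(2) q(2) by blast
    show "mon_eval (\<lambda>v. jet_var v x) (m + Poly_Mapping.single v (Suc 0)) =
        mpoly_eval (\<lambda>v. log_var v x) (p * q)" if "x \<in> regular" for x
      using p(3) q(3) that by (simp add: mon_eval_add mpoly_eval_mult)
  qed
qed

text \<open>Interface for relations known up to finitely many points: \<open>G\<close> is replaced
  by a genuine quotient of polynomials, and injectivity of \<open>\<phi>\<close> keeps the
  exceptional set finite after substitution.\<close>

lemma telescopesI:
  assumes "finite I" "I \<subseteq> {1..n} \<times> UNIV" "\<exists>v\<in>I. c v \<noteq> 0" "almost_rational G"
    and eq: "\<forall>\<^sub>F x in cofinite. (\<Sum>v\<in>I. c v * (wderiv w ^^ snd v) (log_deriv w (b (fst v))) x) = G (\<phi> x) - G x"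
  shows telescopes
proof -
  define L where "L = (\<Sum>v\<in>I. Poly_Mapping.single v (c v))"
  have L: "lookup L v = (if v \<in> I then c v else 0)" for v
    using assms(1) by (simp add: L_def lookup_sum lookup_single when_def)
  have keys_L: "keys L \<subseteq> I"
    by (auto simp: in_keys_iff L split: if_splits)
  have "L \<noteq> 0"
    using assms(3) L by (metis lookup_zero)
  moreover have "L \<in> linear_diff_polys n"
    using keys_L assms(2) by (auto simp: linear_diff_polys_def)
  moreover obtain R where R: "R \<in> rational_functions" and GR: "\<forall>\<^sub>F x in cofinite. G x = R x"
    using assms(4) by (auto simp: almost_rational_def)
  have "\<forall>\<^sub>F x in cofinite. eval_linear_diff_poly (wderiv w) L (\<lambda>i. log_deriv w (b i)) x = R (\<phi> x) - R x"
    using eq GR eventually_cofinite_compose_inj[OF GR inj_phi]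
    by eventually_elim (simp add: eval_linear_diff_poly_superset[OF assms(1) keys_L] L)
  from eventually_cofinite_imp_cosparse[OF this] R calculation show ?thesis
    unfolding telescopes_def by blast
qed

text \<open>Taking logarithmic derivatives turns a multiplicative relation into a linear one.\<close>

lemma telescopes_of_multiplicative_relation:
  assumes h: "almost_rational h" "\<forall>\<^sub>F x in cofinite. h x \<noteq> 0"
    and b_nz: "\<And>i. i \<in> {1..n} \<Longrightarrow> \<forall>\<^sub>F x in cofinite. b i x \<noteq> 0"
    and rel: "\<forall>\<^sub>F x in cofinite. h (\<phi> x) * (\<Prod>i\<in>{1..n}. b i x ^ k i) = (\<Prod>i\<in>{1..n}. b i x ^ l i) * h x"
    and "i0 \<in> {1..n}" "k i0 \<noteq> l i0"
  shows telescopes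
\<comment> \<open>Logarithmic derivatives of both sides give the coefficients
  \<open>k i - l i\<close>, one of which is nonzero, in front of terms of order 0. The terms from
  \<open>h\<close> go to the right, whence the sign.\<close>
proof (rule telescopesI[of "(\<lambda>i. (i, 0)) ` {1..n}" "\<lambda>v. of_nat (k (fst v)) - of_nat (l (fst v))"
      "\<lambda>x. - log_deriv w h x"])
  define P where "P = (\<lambda>x. h analytic_on {x} \<and> h x \<noteq> 0 \<and> (\<forall>i\<in>{1..n}. b i analytic_on {x} \<and> b i x \<noteq> 0))"
  have "\<forall>\<^sub>F x in cofinite. b i analytic_on {x} \<and> b i x \<noteq> 0" if "i \<in> {1..n}" for i
    using almost_rational_deriv(2)[OF b_almost_rational[OF that]] b_nz[OF that] by eventually_elim simp
  then have "\<forall>\<^sub>F x in cofinite. \<forall>i\<in>{1..n}. b i analytic_on {x} \<and> b i x \<noteq> 0"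
    by (intro eventually_ball_finite) auto
  with h(2) almost_rational_deriv(2)[OF h(1)] have evP: "\<forall>\<^sub>F x in cofinite. P x"
    by eventually_elim (auto simp: P_def)
  \<comment> \<open>On this cofinite, hence open, set the relation holds pointwise, and
    \<open>h\<close> at \<open>x\<close> and at \<open>\<phi> x\<close> as well as the
    \<open>b i\<close> at \<open>x\<close> are analytic and nonzero, so it may be
    differentiated.\<close>
  define S where "S = {x. P x \<and> P (\<phi> x) \<and>
    h (\<phi> x) * (\<Prod>i\<in>{1..n}. b i x ^ k i) = (\<Prod>i\<in>{1..n}. b i x ^ l i) * h x}"
  have evS: "\<forall>\<^sub>F x in cofinite. x \<in> S"
    using evP eventually_cofinite_compose_inj[OF evP inj_phi] rel
    by eventually_elim (simp add: S_def)
  then have "finite (- S)"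
    by (simp add: eventually_cofinite Compl_eq)
  then have S: "open S"
    by (simp add: open_closed finite_imp_closed)
  have an: "f holomorphic_on S" if "\<And>x. x \<in> S \<Longrightarrow> f analytic_on {x}" for f
    using that by (intro analytic_imp_holomorphic) (subst analytic_on_analytic_at, auto)
  have h_hol: "h holomorphic_on S" and b_hol: "\<And>i. i \<in> {1..n} \<Longrightarrow> b i holomorphic_on S"
    by (rule an; simp add: S_def P_def)+
  have hS: "h holomorphic_on {x. P x}"
    by (intro analytic_imp_holomorphic) (subst analytic_on_analytic_at, auto simp: P_def)
  have "finite (- {x. P x})"
    using evP by (simp add: eventually_cofinite Compl_eq)
  then have oP: "open {x. P x}"
    by (simp add: open_closed finite_imp_closed)
  have hphi_hol: "(\<lambda>x. h (\<phi> x)) holomorphic_on S"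
  proof (rule an)
    fix x assume "x \<in> S"
    then show "(\<lambda>x. h (\<phi> x)) analytic_on {x}"
      using analytic_on_compose[of \<phi> "{x}" h] phi_analytic by (simp add: o_def S_def P_def)
  qed
  have main: "(\<Sum>i\<in>{1..n}. (of_nat (k i) - of_nat (l i)) * log_deriv w (b i) x) =
      - log_deriv w h (\<phi> x) - - log_deriv w h x" if x: "x \<in> S" for x
  proof -
    have nz: "h x \<noteq> 0" "h (\<phi> x) \<noteq> 0" "\<And>i. i \<in> {1..n} \<Longrightarrow> b i x \<noteq> 0"
      using x by (auto simp: S_def P_def)
    have pr: "log_deriv w (\<lambda>x. \<Prod>i\<in>{1..n}. b i x ^ e i) x = (\<Sum>i\<in>{1..n}. of_nat (e i) * log_deriv w (b i) x)"
      "(\<lambda>x. \<Prod>i\<in>{1..n}. b i x ^ e i) holomorphic_on S" "(\<Prod>i\<in>{1..n}. b i x ^ e i) \<noteq> 0" for e :: "nat \<Rightarrow> nat"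
    proof -
      have "log_deriv w (\<lambda>x. \<Prod>i\<in>{1..n}. b i x ^ e i) x = (\<Sum>i\<in>{1..n}. log_deriv w (\<lambda>x. b i x ^ e i) x)"
        by (rule log_deriv_prod[OF S _ x]; intro holomorphic_on_power b_hol power_not_zero nz)
      also have "\<dots> = (\<Sum>i\<in>{1..n}. of_nat (e i) * log_deriv w (b i) x)"
        by (intro sum.cong refl log_deriv_power[OF S b_hol x] nz)
      finally show "log_deriv w (\<lambda>x. \<Prod>i\<in>{1..n}. b i x ^ e i) x = (\<Sum>i\<in>{1..n}. of_nat (e i) * log_deriv w (b i) x)" .
      show "(\<lambda>x. \<Prod>i\<in>{1..n}. b i x ^ e i) holomorphic_on S"
        by (intro holomorphic_on_prod holomorphic_on_power b_hol)
      show "(\<Prod>i\<in>{1..n}. b i x ^ e i) \<noteq> 0"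
        unfolding prod_zero_iff[OF finite_atLeastAtMost] using nz(3) power_not_zero by blast
    qed
    have w': "poly w (A * x + B) = A * poly w x" for x
      using w_phi[of x] by (simp add: phi)
    have "wderiv w (\<lambda>x. h (\<phi> x)) x = wderiv w h (\<phi> x)"
      using wderiv_funpow_compose_affine[OF w' oP hS S _ x, of 1] by (simp add: phi S_def)
    then have "log_deriv w h (\<phi> x) = log_deriv w (\<lambda>x. h (\<phi> x)) x"
      by (simp add: log_deriv_def)
    moreover have "log_deriv w (\<lambda>x. h (\<phi> x) * (\<Prod>i\<in>{1..n}. b i x ^ k i)) x =
        log_deriv w (\<lambda>x. h (\<phi> x)) x + log_deriv w (\<lambda>x. \<Prod>i\<in>{1..n}. b i x ^ k i) x"
      by (rule log_deriv_mult[OF S hphi_hol pr(2) x nz(2) pr(3)])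
    moreover have "log_deriv w (\<lambda>x. (\<Prod>i\<in>{1..n}. b i x ^ l i) * h x) x =
        log_deriv w (\<lambda>x. \<Prod>i\<in>{1..n}. b i x ^ l i) x + log_deriv w h x"
      by (rule log_deriv_mult[OF S pr(2) h_hol x pr(3) nz(1)])
    moreover have "log_deriv w (\<lambda>x. h (\<phi> x) * (\<Prod>i\<in>{1..n}. b i x ^ k i)) x =
        log_deriv w (\<lambda>x. (\<Prod>i\<in>{1..n}. b i x ^ l i) * h x) x"
      by (rule log_deriv_cong[OF S x]) (simp add: S_def)
    ultimately have "log_deriv w h (\<phi> x) + (\<Sum>i\<in>{1..n}. of_nat (k i) * log_deriv w (b i) x) =
        (\<Sum>i\<in>{1..n}. of_nat (l i) * log_deriv w (b i) x) + log_deriv w h x"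
      by (simp only: pr(1))
    then show ?thesis
      by (simp add: sum_subtractf left_diff_distrib) (simp add: algebra_simps)
  qed
  show "\<forall>\<^sub>F x in cofinite. (\<Sum>v\<in>(\<lambda>i. (i, 0)) ` {1..n}. (of_nat (k (fst v)) - of_nat (l (fst v))) *
      (wderiv w ^^ snd v) (log_deriv w (b (fst v))) x) = - log_deriv w h (\<phi> x) - - log_deriv w h x"
    using evS by (rule eventually_mono) (subst sum.reindex, auto simp: inj_on_def main[unfolded One_nat_def] o_def)
qed (use assms in \<open>auto intro: almost_rational_uminus almost_rational_log_deriv\<close>)

section \<open>The relation along a generic orbit\<close>

text \<open>Finitely many countable sets of starting points are removed from the uncountable
  \<open>D\<close>: one for regularity, the relation and the coefficient at \<open>m1\<close>, and
  one for each coefficient of \<open>P\<close>.\<close>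

lemma exists_generic_orbit:
  assumes P: "P \<in> diff_polys (adjoin_x invariants) n"
    and m1: "\<not> (\<forall>\<^sub>\<approx>x\<in>D. lookup P m1 x = 0)"
    and eval: "\<forall>\<^sub>\<approx>x\<in>D. eval_diff_poly (wderiv w) P u x = 0"
  obtains z where "z \<in> D" "\<And>m. (\<phi> ^^ m) z \<in> good" "\<And>m. lookup P m1 ((\<phi> ^^ m) z) \<noteq> 0"
    "\<And>m. eval_diff_poly (wderiv w) P u ((\<phi> ^^ m) z) = 0"
    "\<And>r. r \<in> keys P \<Longrightarrow> germ_of (\<lambda>m. lookup P r ((\<phi> ^^ m) z)) \<in> rational_germs (\<lambda>m. (\<phi> ^^ m) z)"
proof -
  have K: "lookup P r \<in> adjoin_x invariants" if "r \<in> keys P" for r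
    using P that by (auto simp: diff_polys_def)
  have "m1 \<in> keys P"
    using m1 by (cases "m1 \<in> keys P") (auto simp: in_keys_iff)
  then have "lookup P m1 meromorphic_on D"
    by (intro adjoin_x_meromorphic K)
  then have "\<forall>\<^sub>\<approx>x\<in>D. lookup P m1 x \<noteq> 0"
    using meromorphic_imp_constant_or_avoid[OF _ open_D connected_D, of "lookup P m1" 0] m1 by blast
  with eval cosparse_good
  have "\<forall>\<^sub>\<approx>x\<in>D. x \<in> good \<and> lookup P m1 x \<noteq> 0 \<and> eval_diff_poly (wderiv w) P u x = 0"
    by eventually_elim simp
  from countable_exceptional_orbits[OF this]
  have c0: "countable {z\<in>D. \<exists>m. \<not> ((\<phi> ^^ m) z \<in> good \<and> lookup P m1 ((\<phi> ^^ m) z) \<noteq> 0 \<and>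
      eval_diff_poly (wderiv w) P u ((\<phi> ^^ m) z) = 0)}" (is "countable ?C0") .
  have "\<forall>r\<in>keys P. \<exists>C. countable C \<and> (\<forall>z\<in>D - C. \<exists>R. almost_rational R \<and>
      (\<forall>\<^sub>F m in sequentially. lookup P r ((\<phi> ^^ m) z) = R ((\<phi> ^^ m) z)))"
    by (intro ballI adjoin_x_orbit K)
  from bchoice[OF this] obtain C where
    "\<forall>r\<in>keys P. countable (C r) \<and> (\<forall>z\<in>D - C r. \<exists>R. almost_rational R \<and>
      (\<forall>\<^sub>F m in sequentially. lookup P r ((\<phi> ^^ m) z) = R ((\<phi> ^^ m) z)))" ..
  then have C: "\<And>r. r \<in> keys P \<Longrightarrow> countable (C r)"
    "\<And>r z. r \<in> keys P \<Longrightarrow> z \<in> D - C r \<Longrightarrow> \<exists>R. almost_rational R \<and>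
      (\<forall>\<^sub>F m in sequentially. lookup P r ((\<phi> ^^ m) z) = R ((\<phi> ^^ m) z))"
    by simp_all
  have "countable (\<Union>r\<in>keys P. C r)"
    by (rule countable_UN[OF countable_finite[OF finite_keys] C(1)])
  note countable_Un[OF c0 this]
  moreover define E where "E = ?C0 \<union> (\<Union>r\<in>keys P. C r)"
  ultimately have "\<not> D \<subseteq> E"
    using uncountable_D countable_subset[of D E] by blast
  then obtain z where z: "z \<in> D" "z \<notin> E" by blast
  then have z: "z \<in> D" "z \<notin> ?C0" "\<And>r. r \<in> keys P \<Longrightarrow> z \<notin> C r"
    unfolding E_def Un_iff UN_iff by blast+
  have "germ_of (\<lambda>m. lookup P r ((\<phi> ^^ m) z)) \<in> rational_germs (\<lambda>m. (\<phi> ^^ m) z)" if r: "r \<in> keys P" for r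
  proof -
    obtain R where R: "almost_rational R"
      "\<forall>\<^sub>F m in sequentially. lookup P r ((\<phi> ^^ m) z) = R ((\<phi> ^^ m) z)"
      using C(2)[OF r] z(1) z(3)[OF r] by blast
    then have "germ_of (\<lambda>m. lookup P r ((\<phi> ^^ m) z)) = germ_of (\<lambda>m. R ((\<phi> ^^ m) z))"
      by (simp add: germ_of_eq_iff)
    with rational_germs_I[OF R(1)] show ?thesis by simp
  qed
  with z show ?thesis
    by (intro that[of z]) auto
qed

text \<open>Along a generic orbit the given relation becomes a nontrivial polynomial relation with
  rational coefficients between the germs of the \<open>log_var\<close>, which the shift transforms unipotently.\<close>

lemma dependent_imp_telescopes:
  assumes "differentially_dependent D (wderiv w) (adjoin_x invariants) n u"
  shows telescopes
proof -
  obtain P m1 where P: "P \<in> diff_polys (adjoin_x invariants) n"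
    and m1: "\<not> (\<forall>\<^sub>\<approx>x\<in>D. lookup P m1 x = 0)"
    and eval: "\<forall>\<^sub>\<approx>x\<in>D. eval_diff_poly (wderiv w) P u x = 0"
    using assms by (auto simp: differentially_dependent_def)
  obtain z where z: "z \<in> D" and z_good: "\<And>m. (\<phi> ^^ m) z \<in> good"
    and z_m1: "\<And>m. lookup P m1 ((\<phi> ^^ m) z) \<noteq> 0"
    and z_eval: "\<And>m. eval_diff_poly (wderiv w) P u ((\<phi> ^^ m) z) = 0"
    and z_rat: "\<And>r. r \<in> keys P \<Longrightarrow> germ_of (\<lambda>m. lookup P r ((\<phi> ^^ m) z)) \<in> rational_germs (\<lambda>m. (\<phi> ^^ m) z)"
    by (rule exists_generic_orbit[OF P m1 eval]) blast
  define t where "t = (\<lambda>m. (\<phi> ^^ m) z)"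
  have inj_t: "inj t" unfolding t_def by (rule inj_orbit[OF z])
  have t_Suc: "t (Suc m) = \<phi> (t m)" for m by (simp add: t_def)
  have t_good: "t m \<in> good" for m by (simp add: t_def z_good)
  define V :: "(nat \<times> nat) set" where "V = {1..n} \<times> UNIV"
  define d :: "nat \<times> nat \<Rightarrow> nat" where "d = (\<lambda>v. if snd v = 0 then 0 else 1)"
  define x where "x = (\<lambda>v. germ_of (\<lambda>m. log_var v (t m)))"
  define \<beta> where "\<beta> = (\<lambda>v :: nat \<times> nat. if snd v = 0 then germ_of (\<lambda>m. b (fst v) (t m)) else 1)"
  define a where "a = (\<lambda>v :: nat \<times> nat. if snd v = 0 then 0 else
      germ_of (\<lambda>m. (wderiv w ^^ (snd v - 1)) (log_deriv w (b (fst v))) (t m)))"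
  interpret dr: difference_ring germ_shift "rational_germs t"
    by (rule difference_ring_rational_germs[OF inj_t A_nz]) (simp add: t_Suc phi)
  interpret us: unipotent_system germ_shift "rational_germs t" V d x \<beta> a
  proof
    fix v assume "v \<in> V"
    then have v: "fst v \<in> {1..n}" by (auto simp: V_def)
    show "germ_shift (x v) = \<beta> v * x v + a v"
    proof (cases "snd v = 0")
      case True
      then show ?thesis
        using good_u[OF t_good v]
        by (simp add: x_def germ_shift_germ_of t_Suc log_var_def \<beta>_def a_def germ_of_mult[symmetric])
    next
      case False
      then show ?thesis
        using log_deriv_u_phi[OF v t_good]
        by (simp add: x_def germ_shift_germ_of t_Suc log_var_def \<beta>_def a_def germ_of_add[symmetric])
    qed
    show "\<beta> v \<in> rational_germs t"
      using rational_germs_I[OF b_almost_rational[OF v], of t] dr.one_k by (simp add: \<beta>_def)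
    show "\<beta> v \<noteq> 0"
      using good_b[OF t_good v] by (auto simp: \<beta>_def germ_of_eq_0_iff)
    show "a v \<in> rational_germs t"
      using rational_germs_I[OF almost_rational_wderiv_funpow[OF
            almost_rational_log_deriv[OF b_almost_rational[OF v]]], where t = t] dr.zero_k
      by (simp add: a_def)
    show "d v = 0 \<and> a v = 0 \<or> d v = 1 \<and> \<beta> v = 1"
      by (simp add: d_def a_def \<beta>_def)
  qed
  define C where "C = (\<lambda>r. germ_of (\<lambda>m. lookup P r (t m)))"
  \<comment> \<open>A coefficient indexed by \<open>keys P\<close> may still give the zero germ, for
    instance if it is zero in the field; only the others count. The choice of \<open>z\<close>
    ensures that \<open>m1\<close> is among them.\<close>
  define M where "M = {r\<in>keys P. C r \<noteq> 0}"
  have finM: "finite M" by (simp add: M_def)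
  have Ck: "C r \<in> rational_germs t" if "r \<in> M" for r
    using z_rat[of r] that by (simp add: M_def C_def t_def)
  have "m1 \<in> M"
    using z_m1 by (auto simp: M_def C_def t_def germ_of_eq_0_iff in_keys_iff fun_eq_iff)
  have keys_V: "keys r \<subseteq> {1..n} \<times> UNIV" if "r \<in> keys P" for r
    using P that by (auto simp: diff_polys_def)
  obtain p where p: "\<And>r. r \<in> keys P \<Longrightarrow> has_leading pweight (p r) (lead_mon r)"
    "\<And>r s. r \<in> keys P \<Longrightarrow> s \<in> keys (p r) \<Longrightarrow> keys s \<subseteq> {1..n} \<times> UNIV"
    "\<And>r x. r \<in> keys P \<Longrightarrow> x \<in> regular \<Longrightarrow> mon_eval (\<lambda>v. jet_var v x) r = mpoly_eval (\<lambda>v. log_var v x) (p r)"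
    using jet_mon_eq_mpoly_eval[OF keys_V] by metis
  define Q where "Q = (\<Sum>r\<in>M. Poly_Mapping.single 0 (C r) * germ_poly (p r))"
  have lookup_Q: "lookup Q s = (\<Sum>r\<in>M. C r * germ_of (\<lambda>_. lookup (p r) s))" for s
    using lookup_mult_single_zero[of "germ_poly (p _)" "C _"]
    by (simp add: Q_def lookup_sum mult.commute lookup_germ_poly)
  have "us.relation Q"
    unfolding us.relation_def
  proof (intro conjI allI ballI)
    \<comment> \<open>Choose \<open>r0\<close> in \<open>M\<close> with the heaviest leading
      monomial. No other \<open>p r\<close> contains \<open>lead_mon r0\<close>: it would be either
      the leading monomial of \<open>p r\<close>, against injectivity, or a strictly lighter one,
      against maximality. So the coefficient of \<open>Q\<close> there is
      \<open>C r0\<close>.\<close>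
    let ?f = "\<lambda>r. wdeg pweight (lead_mon r)"
    have "Max (?f ` M) \<in> ?f ` M"
      using finM \<open>m1 \<in> M\<close> by (intro Max_in) auto
    then obtain r0 where r0M: "r0 \<in> M" and "?f r0 = Max (?f ` M)"
      by (metis imageE)
    then have r0: "r0 \<in> M" "\<And>r. r \<in> M \<Longrightarrow> ?f r \<le> ?f r0"
      using finM by simp_all
    have r0P: "r0 \<in> keys P" using r0 by (simp add: M_def)
    have "lookup (p r) (lead_mon r0) = 0" if "r \<in> M" "r \<noteq> r0" for r
    proof (rule ccontr)
      assume "lookup (p r) (lead_mon r0) \<noteq> 0"
      then have "lead_mon r0 = lead_mon r \<or> wdeg pweight (lead_mon r0) < wdeg pweight (lead_mon r)"
        using has_leading_lookup(2)[OF p(1)] that by (auto simp: M_def in_keys_iff)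
      with that r0(2)[OF that(1)] show False
        using injD[OF inj_lead_mon] by fastforce
    qed
    then have "lookup Q (lead_mon r0) = (\<Sum>r\<in>M. if r = r0 then C r0 else 0)"
      unfolding lookup_Q using has_leading_lookup(1)[OF p(1)[OF r0P]]
      by (intro sum.cong) (auto simp: germ_of_zero germ_of_one)
    also have "\<dots> = C r0"
      using r0 finM by simp
    finally have "lookup Q (lead_mon r0) \<noteq> 0"
      using r0(1) by (simp add: M_def)
    then show "Q \<noteq> 0" by auto
    show "lookup Q s \<in> rational_germs t" for s
      unfolding lookup_Q
      by (intro dr.sum_k dr.mult_k Ck rational_germs_I[OF almost_rational_const]) simp
    show "keys s \<subseteq> V" if s: "s \<in> keys Q" for s
    proof -
      have "\<exists>r\<in>M. s \<in> keys (p r)"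
      proof (rule ccontr)
        assume "\<not> ?thesis"
        then have "lookup Q s = 0"
          unfolding lookup_Q by (intro sum.neutral) (auto simp: in_keys_iff germ_of_zero)
        with s show False by (simp add: in_keys_iff)
      qed
      then show ?thesis using p(2) unfolding V_def M_def by blast
    qed
    have "mpoly_eval x Q = (\<Sum>r\<in>M. C r * germ_of (\<lambda>m. mpoly_eval (\<lambda>v. log_var v (t m)) (p r)))"
      by (simp add: Q_def mpoly_eval_sum mpoly_eval_mult x_def mpoly_eval_germ_poly)
    also have "\<dots> = (\<Sum>r\<in>M. C r * germ_of (\<lambda>m. mon_eval (\<lambda>v. jet_var v (t m)) r))"
      by (intro sum.cong refl) (use p(3) good_regular(1)[OF t_good] in \<open>simp add: M_def\<close>)
    also have "\<dots> = (\<Sum>r\<in>keys P. C r * germ_of (\<lambda>m. mon_eval (\<lambda>v. jet_var v (t m)) r))"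
      by (rule sum.mono_neutral_left) (auto simp: M_def)
    also have "\<dots> = germ_of (\<lambda>m. eval_diff_poly (wderiv w) P u (t m))"
      by (simp add: C_def eval_diff_poly_eq jet_var_def germ_of_sum germ_of_mult)
    also have "\<dots> = 0"
      using z_eval by (simp add: t_def germ_of_zero)
    finally show "mpoly_eval x Q = 0" .
  qed
  \<comment> \<open>Such a monomial contains only the \<open>u i\<close>, which have no zero on the
    orbit because it stays in \<open>regular\<close>.\<close>
  moreover have "mon_eval x s \<noteq> 0" if s: "keys s \<subseteq> V" "wdeg d s = 0" for s
  proof -
    have sv: "snd v = 0" if "v \<in> keys s" for v
      using s(2) that by (auto simp: wdeg_def d_def in_keys_iff split: if_splits)
    have "mon_eval (\<lambda>v. log_var v (t m)) s \<noteq> 0" for m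
      unfolding mon_eval_def
    proof (subst prod_zero_iff)
      show "\<not> (\<exists>v\<in>keys s. log_var v (t m) ^ lookup s v = 0)"
        using sv s(1) good_regular(1)[OF t_good, of m] by (fastforce simp: V_def log_var_def regular_def)
    qed simp
    then show ?thesis
      by (simp add: x_def germ_of_mon_eval[symmetric] germ_of_eq_0_iff)
  qed
  ultimately consider
    (mult) s r c where "keys s \<subseteq> V" "keys r \<subseteq> V" "\<exists>v\<in>V. d v = 0 \<and> lookup s v \<noteq> lookup r v"
      "c \<in> rational_germs t" "c \<noteq> 0" "germ_shift c * mon_eval \<beta> s = mon_eval \<beta> r * c"
  | (lin) \<kappa> W g where "finite W" "W \<subseteq> V"
      "\<forall>v\<in>W. d v = 1 \<and> \<kappa> v \<in> rational_germs t \<and> germ_shift (\<kappa> v) = \<kappa> v"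
      "\<exists>v\<in>W. \<kappa> v \<noteq> 0" "g \<in> rational_germs t" "(\<Sum>v\<in>W. \<kappa> v * a v) = g - germ_shift g"
    using us.kolchin_ostrowski[of Q] by blast
  then show ?thesis
  proof cases
    case mult
    obtain h where h: "almost_rational h" "c = germ_of (\<lambda>m. h (t m))"
      using mult(4) by (auto simp: rational_germs_def)
    have beta: "mon_eval \<beta> s = germ_of (\<lambda>m. \<Prod>i\<in>{1..n}. b i (t m) ^ lookup s (i, 0))"
      if "keys s \<subseteq> V" for s
    proof -
      let ?U = "(\<lambda>i. (i, 0)) ` {1..n}"
      have "mon_eval \<beta> s = (\<Prod>v\<in>keys s \<union> ?U. \<beta> v ^ lookup s v)"
        by (rule mon_eval_superset) auto
      also have "\<dots> = (\<Prod>v\<in>?U. \<beta> v ^ lookup s v)"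
        by (rule prod.mono_neutral_right) (use that in \<open>auto simp: \<beta>_def V_def\<close>)
      also have "\<dots> = (\<Prod>i\<in>{1..n}. \<beta> (i, 0) ^ lookup s (i, 0))"
        by (subst prod.reindex) (auto simp: inj_on_def)
      finally show ?thesis
        by (simp add: \<beta>_def germ_of_prod germ_of_power)
    qed
    obtain i0 where i0: "i0 \<in> {1..n}" "lookup s (i0, 0) \<noteq> lookup r (i0, 0)"
      using mult(3) by (auto simp: d_def V_def split: if_splits)
    show ?thesis
    proof (rule telescopes_of_multiplicative_relation[where h = h and
          k = "\<lambda>i. lookup s (i, 0)" and l = "\<lambda>i. lookup r (i, 0)", OF h(1) _ _ _ i0])
      show "\<forall>\<^sub>F x in cofinite. h x \<noteq> 0"
      proof (rule ccontr)
        assume "\<not> ?thesis"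
        then have "\<forall>\<^sub>F x in cofinite. h x = 0"
          using almost_rational_zero_or_nonzero[OF h(1)] by blast
        then have "c = 0"
          using eventually_cofinite_sequence[OF _ inj_t]
          unfolding h(2) germ_of_eq_0_iff by blast
        with mult(5) show False by blast
      qed
      show "\<forall>\<^sub>F x in cofinite. b i x \<noteq> 0" if i: "i \<in> {1..n}" for i
      proof (rule ccontr)
        assume "\<not> ?thesis"
        then have "\<forall>\<^sub>F x in cofinite. b i x = 0"
          using almost_rational_zero_or_nonzero[OF b_almost_rational[OF i]] by blast
        then have "\<forall>\<^sub>F m in sequentially. b i (t m) = 0"
          by (rule eventually_cofinite_sequence[OF _ inj_t])
        then show False using good_b[OF t_good i] by simp
      qed
      let ?E = "\<lambda>s x. \<Prod>i\<in>{1..n}. b i x ^ lookup s (i, 0)"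
      \<comment> \<open>The relation between germs says that one rational function vanishes
        eventually along the orbit; hence it vanishes off a finite set.\<close>
      have "almost_rational (\<lambda>x. h (\<phi> x) * ?E s x - ?E r x * h x)"
        unfolding phi
        by (intro almost_rational_diff almost_rational_mult almost_rational_compose_affine
            almost_rational_prod almost_rational_power b_almost_rational h A_nz)
      moreover have "\<forall>\<^sub>F m in sequentially. h (\<phi> (t m)) * ?E s (t m) - ?E r (t m) * h (t m) = 0"
        using mult(6)[unfolded h(2) germ_shift_germ_of t_Suc beta[OF mult(1)] beta[OF mult(2)]
            germ_of_mult[symmetric] germ_of_eq_iff]
        by (rule eventually_mono) simp
      ultimately have "\<forall>\<^sub>F x in cofinite. h (\<phi> x) * ?E s x - ?E r x * h x = 0"
        using almost_rational_zero_on_sequence[OF _ inj_t] by blast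
      then show "\<forall>\<^sub>F x in cofinite. h (\<phi> x) * ?E s x = ?E r x * h x"
        by (rule eventually_mono) simp
    qed
  next
    case lin
    obtain g' where g': "almost_rational g'" "g = germ_of (\<lambda>m. g' (t m))"
      using lin(5) by (auto simp: rational_germs_def)
    have "\<forall>v\<in>W. \<exists>c. \<kappa> v = germ_of (\<lambda>_. c)"
      using lin(3) germ_shift_invariant by metis
    then obtain c where c: "\<And>v. v \<in> W \<Longrightarrow> \<kappa> v = germ_of (\<lambda>_. c v)" by metis
    have W: "snd v \<noteq> 0" "fst v \<in> {1..n}" if "v \<in> W" for v
      using lin(2,3) that by (auto simp: d_def V_def split: if_splits)
    \<comment> \<open>\<open>?\<pi>\<close> undoes the index shift: the variable
      \<open>(i, Suc l)\<close> stands for an \<open>l\<close>-th derivative, which in a linear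
      differential polynomial has the index \<open>(i, l)\<close>.\<close>
    let ?\<pi> = "\<lambda>v :: nat \<times> nat. (fst v, snd v - 1)" and ?\<iota> = "\<lambda>v :: nat \<times> nat. (fst v, Suc (snd v))"
    let ?f = "\<lambda>v. (wderiv w ^^ (snd v - 1)) (log_deriv w (b (fst v)))"
    have iota: "?\<iota> (?\<pi> v) = v" if "v \<in> W" for v
      using W[OF that] by (simp add: prod_eq_iff)
    have inj: "inj_on ?\<pi> W"
      using iota by (metis (no_types, lifting) inj_on_def)
    show ?thesis
    \<comment> \<open>The linear alternative delivers \<open>g' x - g' (\<phi> x)\<close>, the
      opposite of the required difference; hence the sign.\<close>
    proof (rule telescopesI[of "?\<pi> ` W" "\<lambda>v. c (?\<iota> v)" "\<lambda>x. - g' x"])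
      show "finite (?\<pi> ` W)" using lin(1) by simp
      show "?\<pi> ` W \<subseteq> {1..n} \<times> UNIV" using W(2) by auto
      obtain v where v: "v \<in> W" "\<kappa> v \<noteq> 0" using lin(4) by blast
      then have "c v \<noteq> 0" using c[OF v(1)] by (auto simp: germ_of_zero)
      then have "c (?\<iota> (?\<pi> v)) \<noteq> 0"
        by (simp only: iota[OF v(1)] not_False_eq_True)
      then show "\<exists>v\<in>?\<pi> ` W. c (?\<iota> v) \<noteq> 0"
        using imageI[OF v(1), of ?\<pi>] by (rule bexI)
      show "almost_rational (\<lambda>x. - g' x)" by (intro almost_rational_uminus g')
      have "almost_rational (\<lambda>x. (\<Sum>v\<in>W. c v * ?f v x) - (g' x - g' (\<phi> x)))"
        unfolding phi using W(2)
        by (intro almost_rational_diff almost_rational_sum almost_rational_mult almost_rational_const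
            almost_rational_wderiv_funpow almost_rational_log_deriv b_almost_rational g'
            almost_rational_compose_affine A_nz)
      moreover have "\<forall>\<^sub>F m in sequentially. (\<Sum>v\<in>W. c v * ?f v (t m)) - (g' (t m) - g' (\<phi> (t m))) = 0"
      proof -
        have "germ_of (\<lambda>m. \<Sum>v\<in>W. c v * ?f v (t m)) = (\<Sum>v\<in>W. \<kappa> v * a v)"
          unfolding germ_of_sum germ_of_mult
        proof (intro sum.cong refl)
          show "germ_of (\<lambda>m. c v) * germ_of (\<lambda>m. ?f v (t m)) = \<kappa> v * a v" if "v \<in> W" for v
            using W(1)[OF that] by (simp add: c[OF that] a_def)
        qed
        also have "\<dots> = germ_of (\<lambda>m. g' (t m) - g' (\<phi> (t m)))"
          by (simp add: lin(6) g'(2) germ_shift_germ_of t_Suc germ_of_diff)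
        finally show ?thesis by (simp add: germ_of_eq_iff)
      qed
      ultimately have "\<forall>\<^sub>F x in cofinite. (\<Sum>v\<in>W. c v * ?f v x) - (g' x - g' (\<phi> x)) = 0"
        using almost_rational_zero_on_sequence[OF _ inj_t] by blast
      then show "\<forall>\<^sub>F x in cofinite. (\<Sum>v\<in>?\<pi> ` W. c (?\<iota> v) * (wderiv w ^^ snd v) (log_deriv w (b (fst v))) x) =
          - g' (\<phi> x) - - g' x"
      proof (rule eventually_mono)
        fix x assume eq: "(\<Sum>v\<in>W. c v * ?f v x) - (g' x - g' (\<phi> x)) = 0"
        have "(\<Sum>v\<in>?\<pi> ` W. c (?\<iota> v) * (wderiv w ^^ snd v) (log_deriv w (b (fst v))) x) =
            (\<Sum>v\<in>W. c (?\<iota> (?\<pi> v)) * ?f v x)"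
          by (subst sum.reindex[OF inj]) simp
        also have "\<dots> = (\<Sum>v\<in>W. c v * ?f v x)"
          by (intro sum.cong refl) (simp only: iota)
        finally show "(\<Sum>v\<in>?\<pi> ` W. c (?\<iota> v) * (wderiv w ^^ snd v) (log_deriv w (b (fst v))) x) =
          - g' (\<phi> x) - - g' x"
          using eq by (simp add: algebra_simps)
      qed
    qed
  qed
qed

section \<open>From telescoping to dependence\<close>

lemma const_in_adjoin_x: "(\<lambda>_. c) \<in> adjoin_x invariants"
  by (rule adjoin_x.base) (auto simp: invariants_def)

lemma rational_in_adjoin_x:
  assumes "f \<in> rational_functions"
  shows "f \<in> adjoin_x invariants"
proof -
  have poly: "poly p \<in> adjoin_x invariants" for p :: "complex poly"
  proof (induction p)
    case 0
    then show ?case using const_in_adjoin_x[of 0] by (simp add: poly_0[abs_def])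
  next
    case (pCons c p)
    then have "(\<lambda>x. c + x * poly p x) \<in> adjoin_x invariants"
      by (intro adjoin_x.add adjoin_x.mult adjoin_x.x const_in_adjoin_x)
    then show ?case by (simp add: poly_pCons[abs_def])
  qed
  obtain p r where f: "f = (\<lambda>x. poly p x / poly r x)"
    using assms by (auto simp: rational_functions_def)
  show ?thesis
    unfolding f divide_inverse by (intro adjoin_x.mult adjoin_x.inverse poly)
qed

section \<open>Clearing denominators by powers of the product of the \<open>u i\<close>\<close>

definition u_prod :: "complex \<Rightarrow> complex" where
  "u_prod x = (\<Prod>i\<in>{1..n}. u i x)"

definition u_mon :: "nat set \<Rightarrow> nat \<Rightarrow> (nat \<times> nat \<Rightarrow>\<^sub>0 nat)" where
  "u_mon I N = (\<Sum>i\<in>I. Poly_Mapping.single (i, 0) N)"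

lemma mon_eval_u_mon: "mon_eval (\<lambda>v. jet_var v x) (u_mon I N) = (\<Prod>i\<in>I. u i x) ^ N"
  by (simp add: u_mon_def mon_eval_sum jet_var_def prod_power_distrib)

lemma lookup_u_mon: "j \<noteq> 0 \<Longrightarrow> lookup (u_mon I N) (i, j) = 0"
  by (auto simp: u_mon_def lookup_sum lookup_single intro!: sum.neutral)

lemma keys_u_mon: "keys (u_mon I N) \<subseteq> I \<times> {0}"
  unfolding u_mon_def using keys_sum[of "\<lambda>i. Poly_Mapping.single (i, 0) N" I]
  by (auto split: if_splits)

text \<open>The ring \<open>\<complex>[\<partial>\<^sup>j u\<^sub>i : (i, j) \<in> V][1 / (u\<^sub>1 \<cdots> u\<^sub>n)]\<close>.\<close>

definition localized :: "(nat \<times> nat) set \<Rightarrow> (complex \<Rightarrow> complex) \<Rightarrow> bool" where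
  "localized V f \<longleftrightarrow> (\<exists>N p. (\<forall>r\<in>keys p. keys r \<subseteq> V) \<and>
     (\<forall>x\<in>regular. u_prod x ^ N * f x = mpoly_eval (\<lambda>v. jet_var v x) p))"

lemma localizedE:
  assumes "localized V f"
  obtains N p where "\<And>r. r \<in> keys p \<Longrightarrow> keys r \<subseteq> V"
    "\<And>x. x \<in> regular \<Longrightarrow> u_prod x ^ N * f x = mpoly_eval (\<lambda>v. jet_var v x) p"
  using assms unfolding localized_def by blast

lemma localized_mono: "localized V f \<Longrightarrow> V \<subseteq> V' \<Longrightarrow> localized V' f"
  unfolding localized_def by (meson order_trans)

lemma localized_cong:
  assumes "localized V f" "\<And>x. x \<in> regular \<Longrightarrow> f x = g x"
  shows "localized V g"
  using assms unfolding localized_def by metis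

context
  fixes V :: "(nat \<times> nat) set"
  assumes V: "{1..n} \<times> {0} \<subseteq> V"
begin

lemma localized_const: "localized V (\<lambda>_. c)"
  unfolding localized_def
  by (intro exI[of _ 0] exI[of _ "Poly_Mapping.single 0 c"]) auto

lemma localized_mult:
  assumes "localized V f" "localized V g"
  shows "localized V (\<lambda>x. f x * g x)"
proof -
  obtain N p where p: "\<And>r. r \<in> keys p \<Longrightarrow> keys r \<subseteq> V"
    "\<And>x. x \<in> regular \<Longrightarrow> u_prod x ^ N * f x = mpoly_eval (\<lambda>v. jet_var v x) p"
    using assms(1) by (rule localizedE) blast
  obtain N' q where q: "\<And>r. r \<in> keys q \<Longrightarrow> keys r \<subseteq> V"
    "\<And>x. x \<in> regular \<Longrightarrow> u_prod x ^ N' * g x = mpoly_eval (\<lambda>v. jet_var v x) q"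
    using assms(2) by (rule localizedE) blast
  have "keys r \<subseteq> V" if "r \<in> keys (p * q)" for r
    using keys_mult_subset[OF _ _ that, of V] p(1) q(1) by blast
  moreover have "u_prod x ^ (N + N') * (f x * g x) = mpoly_eval (\<lambda>v. jet_var v x) (p * q)"
    if "x \<in> regular" for x
    by (simp add: mpoly_eval_mult p(2)[OF that, symmetric] q(2)[OF that, symmetric] power_add)
  ultimately show ?thesis
    unfolding localized_def by (intro exI[of _ "N + N'"] exI[of _ "p * q"]) simp
qed

lemma localized_add:
  assumes "localized V f" "localized V g"
  shows "localized V (\<lambda>x. f x + g x)"
proof -
  obtain N p where p: "\<And>r. r \<in> keys p \<Longrightarrow> keys r \<subseteq> V"
    "\<And>x. x \<in> regular \<Longrightarrow> u_prod x ^ N * f x = mpoly_eval (\<lambda>v. jet_var v x) p"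
    using assms(1) by (rule localizedE) blast
  obtain N' q where q: "\<And>r. r \<in> keys q \<Longrightarrow> keys r \<subseteq> V"
    "\<And>x. x \<in> regular \<Longrightarrow> u_prod x ^ N' * g x = mpoly_eval (\<lambda>v. jet_var v x) q"
    using assms(2) by (rule localizedE) blast
  \<comment> \<open>\<open>U N\<close> is the formal polynomial for \<open>u_prod ^ N\<close>. It
    brings both summands over the common denominator \<open>u_prod ^ (N + N')\<close>, and its
    variables lie in \<open>V\<close> by the assumption of the context.\<close>
  define U where "U = (\<lambda>N. Poly_Mapping.single (u_mon {1..n} N) (1::complex))"
  have U: "keys r \<subseteq> V" if "r \<in> keys (U N)" for r N
    using that keys_u_mon[of "{1..n}" N] V by (auto simp: U_def)
  have UV: "keys r \<subseteq> V" if "r \<in> keys (U M * p')" "\<And>r. r \<in> keys p' \<Longrightarrow> keys r \<subseteq> V" for r M p'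
    by (rule keys_mult_subset[OF _ _ that(1)]) (use U that(2) in blast)+
  have "keys r \<subseteq> V" if "r \<in> keys (U N' * p + U N * q)" for r
    using keys_add_cases[OF that]
  proof
    assume "r \<in> keys (U N' * p)"
    then show ?thesis by (rule UV) (rule p(1))
  next
    assume "r \<in> keys (U N * q)"
    then show ?thesis by (rule UV) (rule q(1))
  qed
  moreover have "u_prod x ^ (N + N') * (f x + g x) = mpoly_eval (\<lambda>v. jet_var v x) (U N' * p + U N * q)"
    if "x \<in> regular" for x
    by (simp add: mpoly_eval_mult mpoly_eval_add p(2)[OF that, symmetric] q(2)[OF that, symmetric]
        U_def mon_eval_u_mon u_prod_def power_add algebra_simps)
  ultimately show ?thesis
    unfolding localized_def by (intro exI[of _ "N + N'"] exI[of _ "U N' * p + U N * q"]) simp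
qed

lemma localized_jet_var: "v \<in> V \<Longrightarrow> localized V (jet_var v)"
  unfolding localized_def
  by (intro exI[of _ 0] exI[of _ "Poly_Mapping.single (Poly_Mapping.single v 1) 1"]) auto

lemma localized_inverse_u:
  assumes i: "i \<in> {1..n}"
  shows "localized V (\<lambda>x. inverse (u i x))"
  unfolding localized_def
proof (intro exI[of _ "1::nat"] exI[of _ "Poly_Mapping.single (u_mon ({1..n} - {i}) 1) 1"] conjI ballI)
  show "keys r \<subseteq> V" if "r \<in> keys (Poly_Mapping.single (u_mon ({1..n} - {i}) 1) (1::complex))" for r
    using that keys_u_mon[of "{1..n} - {i}" 1] V by auto
  fix x assume "x \<in> regular"
  then have "u i x \<noteq> 0" using i by (auto simp: regular_def)
  moreover have "u_prod x = u i x * (\<Prod>i\<in>{1..n} - {i}. u i x)"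
    unfolding u_prod_def using i by (intro prod.remove) auto
  ultimately show "u_prod x ^ 1 * inverse (u i x) =
      mpoly_eval (\<lambda>v. jet_var v x) (Poly_Mapping.single (u_mon ({1..n} - {i}) 1) 1)"
    by (simp add: mon_eval_u_mon field_simps)
qed

lemma localized_sum:
  "(\<And>i. i \<in> I \<Longrightarrow> localized V (f i)) \<Longrightarrow> localized V (\<lambda>x. \<Sum>i\<in>I. f i x)"
  by (induction I rule: infinite_finite_induct) (auto intro: localized_const localized_add)

lemma localized_jet:
  assumes "jet w regular v m f" "\<And>l. 2 * l + 1 \<le> m \<Longrightarrow> localized V ((wderiv w ^^ l) v)"
  shows "localized V f"
  using assms
proof (induction rule: jet.induct)
  case (mult m f m' g m'')
  then show ?case by (intro localized_mult) auto
next
  case (cong m f g)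
  then show ?case using localized_cong by blast
qed (auto intro: localized_const localized_add)

end

text \<open>Solve \<open>\<partial>^(l+1) u = u * (\<partial>^l v + f)\<close> for
  \<open>\<partial>^l v\<close>. By its weight, \<open>f\<close> involves only derivatives of
  \<open>v\<close> of order below \<open>l\<close>, which allows induction. The variables are
  tracked so that the highest derivative can later be isolated.\<close>

lemma localized_log_deriv:
  assumes i: "i \<in> {1..n}"
  shows "localized ({1..n} \<times> {0} \<union> {i} \<times> {..Suc l}) ((wderiv w ^^ l) (log_deriv w (u i)))"
proof (induction l rule: less_induct)
  case (less l)
  let ?V = "{1..n} \<times> {0} \<union> {i} \<times> {..Suc l}" and ?v = "log_deriv w (u i)"
  obtain f where f: "jet w regular ?v (2 * l) f"
    and eq: "\<And>x. x \<in> regular \<Longrightarrow> (wderiv w ^^ Suc l) (u i) x = u i x * ((wderiv w ^^ l) ?v x + f x)"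
    using wderiv_funpow_eq_jet[OF open_regular log_deriv_u_holomorphic u_holomorphic wderiv_u, OF i i _ i, of l]
    by blast
  have V: "{1..n} \<times> {0} \<subseteq> ?V" by blast
  have "localized ?V f"
  proof (rule localized_jet[OF V f])
    fix l' assume "2 * l' + 1 \<le> 2 * l"
    then show "localized ?V ((wderiv w ^^ l') ?v)"
      by (intro localized_mono[OF less.IH[of l']]) auto
  qed
  then have "localized ?V (\<lambda>x. jet_var (i, Suc l) x * inverse (u i x) + (- 1) * f x)"
    using i by (intro localized_add localized_mult localized_const localized_jet_var localized_inverse_u V) auto
  then show ?case
  proof (rule localized_cong)
    fix x assume x: "x \<in> regular"
    then have "u i x \<noteq> 0" using i by (auto simp: regular_def)
    with eq[OF x] show "jet_var (i, Suc l) x * inverse (u i x) + (- 1) * f x = (wderiv w ^^ l) ?v x"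
      by (simp add: jet_var_def field_simps)
  qed
qed

lemma telescopes_imp_eval_in_adjoin_x:
  assumes L: "L \<in> linear_diff_polys n" and g: "g \<in> rational_functions"
    and eq: "\<forall>\<^sub>\<approx>x\<in>D. eval_linear_diff_poly (wderiv w) L (\<lambda>i. log_deriv w (b i)) x = g (\<phi> x) - g x"
  shows "eval_linear_diff_poly (wderiv w) L (\<lambda>i. log_deriv w (u i)) \<in> adjoin_x invariants"
proof -
  let ?h = "eval_linear_diff_poly (wderiv w) L (\<lambda>i. log_deriv w (u i))"
  have keys_L: "fst v \<in> {1..n}" if "v \<in> keys L" for v
    using L that by (auto simp: linear_diff_polys_def)
  have lin: "eval_linear_diff_poly (wderiv w) L f = (\<lambda>x. \<Sum>v\<in>keys L. lookup L v * (wderiv w ^^ snd v) (f (fst v)) x)" for f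
    by (rule ext) (rule eval_linear_diff_poly_superset, auto)
  have g_adj: "g \<in> adjoin_x invariants" by (rule rational_in_adjoin_x[OF g])
  have mero: "(wderiv w ^^ snd v) (log_deriv w (u (fst v))) meromorphic_on D" if "v \<in> keys L" for v
    unfolding log_deriv_def using keys_L[OF that]
    by (intro meromorphic_on_wderiv_funpow meromorphic_on_divide meromorphic_on_wderiv u_meromorphic)
  have "?h meromorphic_on D"
    unfolding lin by (intro meromorphic_on_sum meromorphic_on_mult meromorphic_on_const mero)
  then have "(\<lambda>x. ?h x + - g x) meromorphic_on D"
    using adjoin_x_meromorphic[OF g_adj] by (intro meromorphic_on_add meromorphic_on_uminus)
  moreover have "\<forall>\<^sub>\<approx>x\<in>D. ?h (\<phi> x) + - g (\<phi> x) = ?h x + - g x"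
    using eq cosparse_good
  proof eventually_elim
    case (elim x)
    have "?h (\<phi> x) = (\<Sum>v\<in>keys L. lookup L v * ((wderiv w ^^ snd v) (log_deriv w (u (fst v))) x +
        (wderiv w ^^ snd v) (log_deriv w (b (fst v))) x))"
      unfolding lin by (intro sum.cong refl) (simp only: log_deriv_u_phi[OF keys_L elim(2)])
    also have "\<dots> = ?h x + (g (\<phi> x) - g x)"
      unfolding elim(1)[symmetric] lin by (simp add: distrib_left sum.distrib)
    finally show ?case by simp
  qed
  ultimately have "(\<lambda>x. ?h x + - g x) \<in> adjoin_x invariants"
    by (intro adjoin_x.base) (simp add: invariants_def)
  \<comment> \<open>\<open>adjoin_x\<close> is a set of functions, not of classes modulo sparse
    sets; \<open>?h\<close> is recovered literally as \<open>(?h - g) + g\<close>.\<close>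
  from adjoin_x.add[OF this g_adj] show ?thesis by simp
qed

definition const_poly :: "('m \<Rightarrow>\<^sub>0 complex) \<Rightarrow> ('m \<Rightarrow>\<^sub>0 (complex \<Rightarrow> complex))" where
  "const_poly p = (\<Sum>s\<in>keys p. Poly_Mapping.single s (\<lambda>_. lookup p s))"

lemma lookup_const_poly: "lookup (const_poly p) s = (\<lambda>_. lookup p s)"
  by (auto simp: const_poly_def lookup_sum lookup_single when_def in_keys_iff zero_fun_def)

text \<open>With \<open>J\<close> the order of \<open>L\<close>, attained at \<open>i0\<close>, the relation \<open>L(\<partial>u/u) = h\<close> with cleared denominators
  contains the variable \<open>\<partial>\<^bsup>J+1\<^esup> u\<^bsub>i0\<^esub>\<close> only in one monomial, with a constant coefficient.\<close>

lemma telescopes_imp_dependent: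
  assumes telescopes
  shows "differentially_dependent D (wderiv w) (adjoin_x invariants) n u"
proof -
  obtain L g where L: "L \<in> linear_diff_polys n" "L \<noteq> 0" and g: "g \<in> rational_functions"
    and eq: "\<forall>\<^sub>\<approx>x\<in>D. eval_linear_diff_poly (wderiv w) L (\<lambda>i. log_deriv w (b i)) x = g (\<phi> x) - g x"
    using assms by (auto simp: telescopes_def)
  define h where "h = eval_linear_diff_poly (wderiv w) L (\<lambda>i. log_deriv w (u i))"
  have h_adj: "h \<in> adjoin_x invariants"
    unfolding h_def by (rule telescopes_imp_eval_in_adjoin_x[OF L(1) g eq])
  define J where "J = Max (snd ` keys L)"
  have "J \<in> snd ` keys L"
    unfolding J_def using L(2) by (intro Max_in) auto
  then obtain i0 where i0J: "(i0, J) \<in> keys L" by force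
  have J_max: "snd v \<le> J" if "v \<in> keys L" for v
    using that by (simp add: J_def)
  have keys_L: "fst v \<in> {1..n}" if "v \<in> keys L" for v
    using L(1) that by (auto simp: linear_diff_polys_def)
  have i0: "i0 \<in> {1..n}" using keys_L[OF i0J] by simp
  \<comment> \<open>The other terms of \<open>L\<close> at the index \<open>i0\<close> have order
    below \<open>J\<close>, and those at other indices involve no derivative of \<open>u i0\<close>,
    so all of them live in these variables.\<close>
  define V where "V = {1..n} \<times> UNIV - {(i0, Suc J)}"
  have V: "{1..n} \<times> {0} \<subseteq> V" by (auto simp: V_def)
  let ?W = "\<lambda>v. (wderiv w ^^ snd v) (log_deriv w (u (fst v)))"
  define c where "c = lookup L (i0, J)"
  have c: "c \<noteq> 0" using i0J by (simp add: c_def in_keys_iff)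
  obtain f where f: "jet w regular (log_deriv w (u i0)) (2 * J) f"
    and eqf: "\<And>x. x \<in> regular \<Longrightarrow>
      (wderiv w ^^ Suc J) (u i0) x = u i0 x * ((wderiv w ^^ J) (log_deriv w (u i0)) x + f x)"
    using wderiv_funpow_eq_jet[OF open_regular log_deriv_u_holomorphic u_holomorphic wderiv_u, OF i0 i0 _ i0, of J]
    by blast
  have loc_f: "localized V f"
  proof (rule localized_jet[OF V f])
    fix l assume "2 * l + 1 \<le> 2 * J"
    then show "localized V ((wderiv w ^^ l) (log_deriv w (u i0)))"
      using i0 by (intro localized_mono[OF localized_log_deriv[OF i0, of l]]) (auto simp: V_def)
  qed
  have loc_W: "localized V (?W v)" if "v \<in> keys L - {(i0, J)}" for v
  proof (rule localized_mono[OF localized_log_deriv])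
    show "fst v \<in> {1..n}" using keys_L that by blast
    show "{1..n} \<times> {0} \<union> {fst v} \<times> {..Suc (snd v)} \<subseteq> V"
      using keys_L[of v] J_max[of v] that by (cases v) (auto simp: V_def)
  qed
  define \<rho> where "\<rho> = (\<lambda>x. (\<Sum>v\<in>keys L - {(i0, J)}. lookup L v * ?W v x) + (- c) * f x)"
  have "localized V \<rho>"
    unfolding \<rho>_def
    by (intro localized_add localized_sum localized_mult localized_const loc_f loc_W V)
  then obtain N p where p: "\<And>r. r \<in> keys p \<Longrightarrow> keys r \<subseteq> V"
    and eqp: "\<And>x. x \<in> regular \<Longrightarrow> u_prod x ^ N * \<rho> x = mpoly_eval (\<lambda>v. jet_var v x) p"
    by (rule localizedE) blast
  have h_eq: "h x = c * (jet_var (i0, Suc J) x / u i0 x) + \<rho> x" if x: "x \<in> regular" for x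
  proof -
    have nz: "u i0 x \<noteq> 0" using x i0 by (auto simp: regular_def)
    have "h x = (\<Sum>v\<in>keys L. lookup L v * ?W v x)"
      unfolding h_def by (rule eval_linear_diff_poly_superset) auto
    also have "\<dots> = c * ?W (i0, J) x + (\<Sum>v\<in>keys L - {(i0, J)}. lookup L v * ?W v x)"
      unfolding c_def by (rule sum.remove[OF _ i0J]) simp
    also have "?W (i0, J) x = jet_var (i0, Suc J) x / u i0 x - f x"
      using eqf[OF x] nz by (simp add: jet_var_def field_simps)
    finally show ?thesis by (simp add: \<rho>_def algebra_simps)
  qed
  \<comment> \<open>Multiply \<open>h = c * (\<partial>^(J+1) u / u) + \<rho>\<close>, with
    \<open>u\<close> at the index \<open>i0\<close>, by \<open>u_prod ^ Suc N\<close>: one factor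
    clears the denominator \<open>u i0\<close>, the other \<open>N\<close> clear those of
    \<open>\<rho>\<close>. \<open>m0\<close> is the monomial of the first summand; in
    \<open>P\<close> the function \<open>h\<close> becomes a coefficient.\<close>
  define m0 where "m0 = u_mon {1..n} N + (u_mon ({1..n} - {i0}) 1 + Poly_Mapping.single (i0, Suc J) 1)"
  define q where "q = Poly_Mapping.single m0 c + Poly_Mapping.single (u_mon {1..n} 1) 1 * p"
  define P where "P = const_poly q - Poly_Mapping.single (u_mon {1..n} (Suc N)) h"
  have q_eval: "mpoly_eval (\<lambda>v. jet_var v x) q = u_prod x ^ Suc N * h x" if x: "x \<in> regular" for x
  proof -
    have nz: "u i0 x \<noteq> 0" using x i0 by (auto simp: regular_def)
    have rem: "u_prod x = u i0 x * (\<Prod>i\<in>{1..n} - {i0}. u i x)"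
      unfolding u_prod_def using i0 by (intro prod.remove) auto
    have "mpoly_eval (\<lambda>v. jet_var v x) q =
        c * (u_prod x ^ N * ((\<Prod>i\<in>{1..n} - {i0}. u i x) * jet_var (i0, Suc J) x)) +
        u_prod x * (u_prod x ^ N * \<rho> x)"
      by (simp add: q_def m0_def mpoly_eval_add mpoly_eval_mult mon_eval_add mon_eval_u_mon eqp[OF x, symmetric]
          u_prod_def[symmetric] del: One_nat_def)
    also have "(\<Prod>i\<in>{1..n} - {i0}. u i x) = u_prod x / u i0 x"
      using nz by (simp add: rem)
    finally show ?thesis
      by (simp add: h_eq[OF x] algebra_simps)
  qed
  have V_keys: "keys (u_mon {1..n} k) \<subseteq> V" for k
    using keys_u_mon[of "{1..n}" k] V by blast
  have q_keys: "r = m0 \<or> keys r \<subseteq> V" if "r \<in> keys q" for r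
    using keys_add_cases[OF that[unfolded q_def]]
      keys_mult_subset[of "Poly_Mapping.single (u_mon {1..n} 1) 1" V p r] V_keys p
    by (auto split: if_splits)
  have m0_V: "(i0, Suc J) \<in> keys m0"
    by (simp add: m0_def in_keys_iff lookup_add lookup_u_mon)
  have m0_keys: "keys m0 \<subseteq> {1..n} \<times> UNIV"
  proof -
    have "keys m0 \<subseteq> keys (u_mon {1..n} N) \<union> (keys (u_mon ({1..n} - {i0}) 1) \<union> {(i0, Suc J)})"
      unfolding m0_def using keys_add[of "u_mon {1..n} N"] keys_add[of "u_mon ({1..n} - {i0}) 1"] by fastforce
    also have "\<dots> \<subseteq> {1..n} \<times> {0} \<union> (({1..n} - {i0}) \<times> {0} \<union> {(i0, Suc J)})"
      by (intro Un_mono keys_u_mon order_refl)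
    also have "\<dots> \<subseteq> {1..n} \<times> UNIV"
      using i0 by auto
    finally show ?thesis .
  qed
  have lookup_P: "lookup P r = (\<lambda>_. lookup q r) - (h when u_mon {1..n} (Suc N) = r)" for r
    by (simp add: P_def lookup_minus lookup_const_poly lookup_single)
  have keys_P: "keys P \<subseteq> keys q \<union> {u_mon {1..n} (Suc N)}"
    by (auto simp: in_keys_iff lookup_P zero_fun_def when_def split: if_splits)
  have "P \<in> diff_polys (adjoin_x invariants) n"
    unfolding diff_polys_def
  proof (intro CollectI ballI conjI)
    fix r assume r: "r \<in> keys P"
    have "lookup P r = (\<lambda>x. lookup q r + - (if u_mon {1..n} (Suc N) = r then h x else 0))"
      by (auto simp: lookup_P when_def fun_eq_iff)
    moreover have "(\<lambda>x. if u_mon {1..n} (Suc N) = r then h x else 0) \<in> adjoin_x invariants"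
      using h_adj const_in_adjoin_x[of 0] by (cases "u_mon {1..n} (Suc N) = r") simp_all
    ultimately show "lookup P r \<in> adjoin_x invariants"
      by (simp only: adjoin_x.add adjoin_x.uminus const_in_adjoin_x)
    have "V \<subseteq> {1..n} \<times> UNIV" by (auto simp: V_def)
    then show "keys r \<subseteq> {1..n} \<times> UNIV"
      using keys_P r q_keys[of r] m0_keys V_keys[of "Suc N"] by blast
  qed
  moreover have "\<not> (\<forall>\<^sub>\<approx>x\<in>D. lookup P m0 x = 0)"
  proof
    \<comment> \<open>\<open>m0\<close> is the only monomial that contains
      \<open>(i0, Suc J)\<close>, so neither \<open>h\<close> nor the remaining terms can cancel the
      constant \<open>c\<close>.\<close>
    have "u_mon {1..n} (Suc N) \<noteq> m0"
      using m0_V V_keys[of "Suc N"] by (auto simp: V_def)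
    moreover have "lookup q m0 = c"
    proof -
      have "m0 \<notin> keys (Poly_Mapping.single (u_mon {1..n} 1) 1 * p)"
        using keys_mult_subset[of "Poly_Mapping.single (u_mon {1..n} 1) 1" V p m0] V_keys p m0_V
        by (auto simp: V_def split: if_splits)
      then show ?thesis by (simp add: q_def lookup_add in_keys_iff)
    qed
    ultimately have "lookup P m0 x = c" for x
      by (simp add: lookup_P)
    moreover assume "\<forall>\<^sub>\<approx>x\<in>D. lookup P m0 x = 0"
    \<comment> \<open>The nonzero constant \<open>c\<close> can vanish off a sparse set only if the
      cosparse filter is trivial.\<close>
    ultimately have "D = {}"
      using c cosparse_eq_bot_iff'[of D] by (simp add: eventually_False)
    then show False using uncountable_D by simp
  qed
  moreover have "\<forall>\<^sub>\<approx>x\<in>D. eval_diff_poly (wderiv w) P u x = 0"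
    using cosparse_regular
  proof eventually_elim
    case (elim x)
    let ?A = "keys q \<union> {u_mon {1..n} (Suc N)}" and ?y = "\<lambda>v. jet_var v x"
    have "eval_diff_poly (wderiv w) P u x = (\<Sum>m\<in>?A. lookup P m x * mon_eval ?y m)"
      unfolding eval_diff_poly_eq jet_var_def
      by (rule sum.mono_neutral_left) (use keys_P in \<open>auto simp: in_keys_iff\<close>)
    also have "\<dots> = (\<Sum>m\<in>?A. lookup q m * mon_eval ?y m) -
        (\<Sum>m\<in>?A. if u_mon {1..n} (Suc N) = m then h x * mon_eval ?y m else 0)"
      by (subst sum_subtractf[symmetric], intro sum.cong refl) (auto simp: lookup_P when_def algebra_simps)
    also have "(\<Sum>m\<in>?A. lookup q m * mon_eval ?y m) = u_prod x ^ Suc N * h x"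
      by (subst mpoly_eval_superset[symmetric]) (auto simp: q_eval[OF elim])
    also have "(\<Sum>m\<in>?A. if u_mon {1..n} (Suc N) = m then h x * mon_eval ?y m else 0) =
        u_prod x ^ Suc N * h x"
      by (subst sum.delta') (auto simp: mon_eval_u_mon u_prod_def)
    finally show ?case by simp
  qed
  ultimately show ?thesis
    unfolding differentially_dependent_def by blast
qed

theorem dependent_iff_telescopes:
  "differentially_dependent D (wderiv w) (adjoin_x invariants) n u \<longleftrightarrow> telescopes"
  using dependent_imp_telescopes telescopes_imp_dependent by blast

end

section \<open>Specialisation to the shift and to the \<open>q\<close>-dilation\<close>

theorem corollary3p3:
  shows
    "(\<forall>(n :: nat) (b :: nat \<Rightarrow> complex \<Rightarrow> complex) (u :: nat \<Rightarrow> complex \<Rightarrow> complex).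
        (\<forall>i\<in>{1..n}. b i \<in> rational_functions) \<and>
        (\<forall>i\<in>{1..n}. u i meromorphic_on UNIV \<and> \<not> (\<forall>\<^sub>\<approx>x. u i x = 0)) \<and>
        (\<forall>i\<in>{1..n}. \<forall>\<^sub>\<approx>x. u i (x + 1) = b i x * u i x)
        \<longrightarrow>
        (differentially_dependent UNIV deriv (adjoin_x periodic_field) n u
         \<longleftrightarrow>
         (\<exists>L\<in>linear_diff_polys n. L \<noteq> 0 \<and>
            (\<exists>g\<in>rational_functions. \<forall>\<^sub>\<approx>x.
               eval_linear_diff_poly deriv L (\<lambda>i x. deriv (b i) x / b i x) x
                 = g (x + 1) - g x))))
     \<and>
     (\<forall>(q :: complex) (n :: nat) (b :: nat \<Rightarrow> complex \<Rightarrow> complex)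
         (u :: nat \<Rightarrow> complex \<Rightarrow> complex).
        q \<noteq> 0 \<and> norm q \<noteq> 1 \<and>
        (\<forall>i\<in>{1..n}. b i \<in> rational_functions) \<and>
        (\<forall>i\<in>{1..n}. u i meromorphic_on (- {0}) \<and> \<not> (\<forall>\<^sub>\<approx>x\<in>- {0}. u i x = 0)) \<and>
        (\<forall>i\<in>{1..n}. \<forall>\<^sub>\<approx>x\<in>- {0}. u i (q * x) = b i x * u i x)
        \<longrightarrow>
        (differentially_dependent (- {0}) q_deriv (adjoin_x (q_periodic_field q)) n u
         \<longleftrightarrow>
         (\<exists>L\<in>linear_diff_polys n. L \<noteq> 0 \<and>
            (\<exists>g\<in>rational_functions. \<forall>\<^sub>\<approx>x\<in>- {0}.
               eval_linear_diff_poly q_deriv L (\<lambda>i x. q_deriv (b i) x / b i x) x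
                 = g (q * x) - g x))))"
proof (intro conjI allI impI; elim conjE)
  fix n :: nat and b u :: "nat \<Rightarrow> complex \<Rightarrow> complex"
  assume "\<forall>i\<in>{1..n}. b i \<in> rational_functions"
    "\<forall>i\<in>{1..n}. u i meromorphic_on UNIV \<and> \<not> (\<forall>\<^sub>\<approx>x. u i x = 0)"
    "\<forall>i\<in>{1..n}. \<forall>\<^sub>\<approx>x. u i (x + 1) = b i x * u i x"
  then interpret difference_solutions UNIV 1 1 "[:1:]" "\<lambda>x. x + 1" n b u
  proof unfold_locales
    have "((\<lambda>x. x + 1) ^^ m) x = x + of_nat m" for m and x :: complex
      by (induction m) (auto simp: algebra_simps)
    then show "inj (\<lambda>m. ((\<lambda>x. x + 1) ^^ m) x)" for x :: complex
      by (auto simp: inj_def)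
  qed auto
  have "wderiv [:1:] = deriv"
    by (simp add: wderiv_def fun_eq_iff)
  moreover from this have "log_deriv [:1:] = (\<lambda>f x. deriv f x / f x)"
    by (simp add: log_deriv_def fun_eq_iff)
  moreover have "invariants = periodic_field"
    by (simp add: invariants_def periodic_field_def)
  ultimately show "differentially_dependent UNIV deriv (adjoin_x periodic_field) n u
         \<longleftrightarrow>
         (\<exists>L\<in>linear_diff_polys n. L \<noteq> 0 \<and>
            (\<exists>g\<in>rational_functions. \<forall>\<^sub>\<approx>x.
               eval_linear_diff_poly deriv L (\<lambda>i x. deriv (b i) x / b i x) x
                 = g (x + 1) - g x))"
    using dependent_iff_telescopes unfolding telescopes_def by simp
next
  fix q :: complex and n :: nat and b u :: "nat \<Rightarrow> complex \<Rightarrow> complex"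
  assume q: "q \<noteq> 0" "norm q \<noteq> 1" and "\<forall>i\<in>{1..n}. b i \<in> rational_functions"
    "\<forall>i\<in>{1..n}. u i meromorphic_on (- {0}) \<and> \<not> (\<forall>\<^sub>\<approx>x\<in>- {0}. u i x = 0)"
    "\<forall>i\<in>{1..n}. \<forall>\<^sub>\<approx>x\<in>- {0}. u i (q * x) = b i x * u i x"
  then interpret difference_solutions "- {0}" q 0 "[:0, 1:]" "\<lambda>x. q * x" n b u
  proof unfold_locales
    fix x :: complex assume x: "x \<in> - {0}"
    have iter: "((\<lambda>x. q * x) ^^ m) x = q ^ m * x" for m
      by (induction m) (auto simp: algebra_simps)
    show "inj (\<lambda>m. ((\<lambda>x. q * x) ^^ m) x)"
    proof (rule injI)
      fix m m' assume "((\<lambda>x. q * x) ^^ m) x = ((\<lambda>x. q * x) ^^ m') x"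
      \<comment> \<open>The nonzero \<open>x\<close> cancels, and the powers of a positive real
        number other than 1 are distinct.\<close>
      then have "norm (q ^ m) = norm (q ^ m')"
        using x by (simp add: iter)
      then have "norm q ^ m = norm q ^ m'"
        by (simp add: norm_power)
      then show "m = m'"
        using q by (simp add: power_inject_exp')
    qed
  qed auto
  have "wderiv [:0, 1:] = q_deriv"
    by (simp add: wderiv_def q_deriv_def fun_eq_iff)
  moreover from this have "log_deriv [:0, 1:] = (\<lambda>f x. q_deriv f x / f x)"
    by (simp add: log_deriv_def fun_eq_iff)
  moreover have "invariants = q_periodic_field q"
    by (simp add: invariants_def q_periodic_field_def)
  ultimately show "differentially_dependent (- {0}) q_deriv (adjoin_x (q_periodic_field q)) n u
         \<longleftrightarrow>
         (\<exists>L\<in>linear_diff_polys n. L \<noteq> 0 \<and>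
            (\<exists>g\<in>rational_functions. \<forall>\<^sub>\<approx>x\<in>- {0}.
               eval_linear_diff_poly q_deriv L (\<lambda>i x. q_deriv (b i) x / b i x) x
                 = g (q * x) - g x))"
    using dependent_iff_telescopes unfolding telescopes_def by simp
qed

end
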